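(* Suppose that the Model assumption and the Regularity conditions (i) and (ii) stated in the context hold. Suppose also that, as $N\to\infty$, $G_h\to\infty$ and $\max_{g\in\mathcal G_h}\pi_g/\pi\to0$. Then $$\widehat\sigma^2_{\mathrm{CRV}}=(1+o_{P_N}(1))\,e_1'Q_N^{-1}\Big(\Omega+(N-1)\sum_{g=1}^G Q_g\cdot\pi_g\delta(x_g)^2\Big)Q_N^{-1}e_1 .$$
   Context: **Model assumption.** For each $N$, the data $\{Y_i,X_i\}_{i=1}^N$ are i.i.d. with law $P_N$; $\mathbb E_N,\mathbb V_N$ denote expectation and variance under $P_N$. Under $P_N$, $X_i$ is discrete with $G=G^-+G^+$ support points $x_1<\dots<x_{G^-}<0\le x_{G^-+1}<\dots<x_G$. Let $\mu(x)=\mathbb E_N(Y_i\mid X_i=x)$, $\varepsilon_i=Y_i-\mu(X_i)$, $\sigma_g^2=\mathbb V_N(\varepsilon_i\mid X_i=x_g)$. Let $h=h_N>0$ be a non-random bandwidth sequence, $\mathcal G_h\subseteq\{1,\dots,G\}$ the set of indices with $|x_g|\le h$, and $G_h^+$, $G_h^-$ the numbers of support points with index in $\mathcal G_h$ above (i.e. $\ge 0$) and below zero, $G_h=G_h^++G_h^-$. Let $\pi_g=P_N(X_i=x_g)$, $\pi=P_N(|X_i|\le h)$, $N_h=\sum_{i=1}^N\mathbb 1\{|X_i|\le h\}$. For a fixed integer $p\ge0$ let $$m(x)=(\mathbb 1\{x\ge0\},1,x,\dots,x^p,\mathbb 1\{x\ge0\}x,\dots,\mathbb 1\{x\ge0\}x^p)',$$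 $M_i=\mathbb 1\{|X_i|\le h\}m(X_i)$, $m_g=\mathbb 1\{|x_g|\le h\}m(x_g)$, $\widehat Q=N_h^{-1}\sum_{i=1}^N M_iM_i'$, $Q_N=\mathbb E_N(M_iM_i')/\pi$, $\theta_h=Q_N^{-1}\mathbb E_N(M_iY_i)/\pi$ with first element $\tau_h$, $\widehat\theta=\widehat Q^{-1}N_h^{-1}\sum_{i=1}^N M_iY_i$ with first element $\widehat\tau$. Let $\delta(x)=\mu(x)-m(x)'\theta_h$, $u_i=Y_i-m(X_i)'\theta_h=\delta(X_i)+\varepsilon_i$, $Q_g=\frac{\pi_g}{\pi}m_gm_g'$, and $\Omega=\mathbb E_N(u_i^2M_iM_i')/\pi=\sum_{g=1}^G(\sigma_g^2+\delta(x_g)^2)Q_g$. All these quantities (including $G$, $x_g$, $\mu$, $\delta$) may change with $N$. **Regularity conditions.** Let $H=\operatorname{diag}\{m(h)\}$ (diagonal matrix with the entries of $m(h)$). (i) $\sup_N\max_{g\in\{1,\dots,G\}}\mathbb E_N(\varepsilon_i^4\mid X_i=x_g)<\infty$; $\det(H^{-1}Q_NH^{-1})=\det\big(\sum_{g\in\mathcal G_h}\frac{\pi_g}{\pi}m(x_g/h)m(x_g/h)'\big)>C$ for some $C>0$ not depending on $N$; $N\pi\to\infty$; and $\lim_{N\to\infty}H^{-1}Q_NH^{-1}$ exists. (ii) $\sup_N\max_{g\in\mathcal G_h}|\delta(x_g)|<\infty$; and $\lim_{N\to\infty}H^{-1}\Omega H^{-1}$ exists. **Variance estimator clustered by the running variable.**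 With residuals $\widehat u_i=Y_i-M_i'\widehat\theta$ and $J_g=\sum_{i=1}^N\mathbb 1\{X_i=x_g\}\widehat u_iM_i$, $$\widehat\sigma^2_{\mathrm{CRV}}=e_1'\widehat Q^{-1}\Big(\frac1{N_h}\sum_{g=1}^G J_gJ_g'\Big)\widehat Q^{-1}e_1 .$$ **Notation.** $e_1=(1,0,\dots,0)'$; $o_{P_N}(1)$ denotes a term converging to zero in probability under $P_N$ as $N\to\infty$.
   Formalization: Adds the assumption that the right-hand side e_1'Q_N^{-1}(Ω+(N-1)ΣQ_gπ_gδ(x_g)^2)Q_N^{-1}e_1 is bounded away from zero for large N; without it the claim fails, e.g. when the error variance vanishes because Y is zero except with probability 1/N. *)

theory Defs
  imports "HOL-Probability.Probability"
begin

text \<open>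
  A law \<open>P\<close> on \<open>real \<times> real\<close> is the joint law of one observation \<open>(Y, X)\<close>: the outcome is the
  first component, the running variable the second.  Vectors of length \<open>2 p + 2\<close> are of type
  \<open>real ^ 'n\<close>, where \<open>idx\<close> is a bijection from \<open>'n\<close> onto \<open>{..<2 * p + 2}\<close> that fixes the order of
  the coordinates.
\<close>

subsection \<open>Regressors\<close>

text \<open>
  Coordinates in order: \<open>1{x \<ge> 0}\<close>; then \<open>1, x, \<dots>, x^p\<close> (positions \<open>1, \<dots>, p + 1\<close>);
  then \<open>1{x \<ge> 0} x, \<dots>, 1{x \<ge> 0} x^p\<close> (positions \<open>p + 2, \<dots>, 2 p + 1\<close>).
\<close>

definition rd_entry :: "nat \<Rightarrow> real \<Rightarrow> nat \<Rightarrow> real" where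
  "rd_entry p x j =
     (if j = 0 then of_bool (0 \<le> x)
      else if j \<le> p + 1 then x ^ (j - 1)
      else of_bool (0 \<le> x) * x ^ (j - (p + 1)))"

definition rd_basis :: "nat \<Rightarrow> ('n::finite \<Rightarrow> nat) \<Rightarrow> real \<Rightarrow> real ^ 'n" where
  "rd_basis p idx x = (\<chi> j. rd_entry p x (idx j))"

definition first_unit :: "('n::finite \<Rightarrow> nat) \<Rightarrow> real ^ 'n" where
  "first_unit idx = (\<chi> j. of_bool (idx j = 0))"

definition outer :: "real ^ 'n \<Rightarrow> real ^ 'n \<Rightarrow> real ^ 'n ^ 'n::finite" where
  "outer v w = (\<chi> i j. v $ i * w $ j)"

definition diag :: "real ^ 'n \<Rightarrow> real ^ 'n ^ 'n::finite" where
  "diag v = (\<chi> i j. if i = j then v $ i else 0)"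

text \<open>Below, \<open>m\<close> stands for the regressor function \<open>rd_basis p idx\<close>.\<close>

definition win_basis :: "(real \<Rightarrow> real ^ 'n) \<Rightarrow> real \<Rightarrow> real \<Rightarrow> real ^ 'n::finite" where
  "win_basis m h x = of_bool (\<bar>x\<bar> \<le> h) *\<^sub>R m x"

subsection \<open>Population quantities\<close>

definition win_prob :: "real \<Rightarrow> (real \<times> real) measure \<Rightarrow> real" where
  "win_prob h P = \<P>(z in P. \<bar>snd z\<bar> \<le> h)"

definition point_prob :: "(real \<times> real) measure \<Rightarrow> real \<Rightarrow> real" where
  "point_prob P x = \<P>(z in P. snd z = x)"

definition cond_law :: "(real \<times> real) measure \<Rightarrow> real \<Rightarrow> (real \<times> real) measure" where
  "cond_law P x = uniform_measure P {z \<in> space P. snd z = x}"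

definition cond_mean :: "(real \<times> real) measure \<Rightarrow> real \<Rightarrow> real" where
  "cond_mean P x = (\<integral>z. fst z \<partial>cond_law P x)"

definition Q_pop :: "(real \<Rightarrow> real ^ 'n) \<Rightarrow> real \<Rightarrow> (real \<times> real) measure \<Rightarrow> real ^ 'n ^ 'n::finite" where
  "Q_pop m h P =
     (\<integral>z. outer (win_basis m h (snd z)) (win_basis m h (snd z)) \<partial>P) /\<^sub>R win_prob h P"

definition theta_pop :: "(real \<Rightarrow> real ^ 'n) \<Rightarrow> real \<Rightarrow> (real \<times> real) measure \<Rightarrow> real ^ 'n::finite" where
  "theta_pop m h P =
     matrix_inv (Q_pop m h P) *v
       ((\<integral>z. fst z *\<^sub>R win_basis m h (snd z) \<partial>P) /\<^sub>R win_prob h P)"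

definition approx_bias ::
  "(real \<Rightarrow> real ^ 'n::finite) \<Rightarrow> real \<Rightarrow> (real \<times> real) measure \<Rightarrow> real \<Rightarrow> real" where
  "approx_bias m h P x = cond_mean P x - m x \<bullet> theta_pop m h P"

definition Omega_pop ::
  "(real \<Rightarrow> real ^ 'n) \<Rightarrow> real \<Rightarrow> (real \<times> real) measure \<Rightarrow> real ^ 'n ^ 'n::finite" where
  "Omega_pop m h P =
     (\<integral>z. (fst z - m (snd z) \<bullet> theta_pop m h P)\<^sup>2 *\<^sub>R
            outer (win_basis m h (snd z)) (win_basis m h (snd z)) \<partial>P) /\<^sub>R win_prob h P"

definition Q_point ::
  "(real \<Rightarrow> real ^ 'n) \<Rightarrow> real \<Rightarrow> (real \<times> real) measure \<Rightarrow> real \<Rightarrow> real ^ 'n ^ 'n::finite" where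
  "Q_point m h P x =
     (point_prob P x / win_prob h P) *\<^sub>R outer (win_basis m h x) (win_basis m h x)"

definition normalize_mat ::
  "(real \<Rightarrow> real ^ 'n) \<Rightarrow> real \<Rightarrow> real ^ 'n ^ 'n \<Rightarrow> real ^ 'n ^ 'n::finite" where
  "normalize_mat m h A = matrix_inv (diag (m h)) ** A ** matrix_inv (diag (m h))"

text \<open>Here \<open>G\<close> is the number of support points and \<open>x 1, \<dots>, x G\<close> are the support points.\<close>

definition crv_pop ::
  "(real \<Rightarrow> real ^ 'n) \<Rightarrow> real ^ 'n \<Rightarrow> real \<Rightarrow> (real \<times> real) measure \<Rightarrow> nat \<Rightarrow> (nat \<Rightarrow> real) \<Rightarrow> nat
     \<Rightarrow> real" where
  "crv_pop m (e1 :: real ^ 'n::finite) h P G x n =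
     e1 \<bullet> ((matrix_inv (Q_pop m h P)
             ** (Omega_pop m h P
                 + (real n - 1) *\<^sub>R
                   (\<Sum>g = 1..G. (point_prob P (x g) * (approx_bias m h P (x g))\<^sup>2) *\<^sub>R
                                  Q_point m h P (x g)))
             ** matrix_inv (Q_pop m h P)) *v e1)"

subsection \<open>Sample quantities\<close>

text \<open>\<open>z 1, \<dots>, z n\<close> are the realized observations.\<close>

definition win_count :: "real \<Rightarrow> nat \<Rightarrow> (nat \<Rightarrow> real \<times> real) \<Rightarrow> real" where
  "win_count h n z = (\<Sum>i = 1..n. of_bool (\<bar>snd (z i)\<bar> \<le> h))"

definition Q_hat ::
  "(real \<Rightarrow> real ^ 'n) \<Rightarrow> real \<Rightarrow> nat \<Rightarrow> (nat \<Rightarrow> real \<times> real) \<Rightarrow> real ^ 'n ^ 'n::finite" where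
  "Q_hat m h n z =
     (\<Sum>i = 1..n. outer (win_basis m h (snd (z i))) (win_basis m h (snd (z i)))) /\<^sub>R win_count h n z"

definition theta_hat ::
  "(real \<Rightarrow> real ^ 'n) \<Rightarrow> real \<Rightarrow> nat \<Rightarrow> (nat \<Rightarrow> real \<times> real) \<Rightarrow> real ^ 'n::finite" where
  "theta_hat m h n z =
     matrix_inv (Q_hat m h n z) *v
       ((\<Sum>i = 1..n. fst (z i) *\<^sub>R win_basis m h (snd (z i))) /\<^sub>R win_count h n z)"

definition residual ::
  "(real \<Rightarrow> real ^ 'n::finite) \<Rightarrow> real \<Rightarrow> nat \<Rightarrow> (nat \<Rightarrow> real \<times> real) \<Rightarrow> nat \<Rightarrow> real" where
  "residual m h n z i = fst (z i) - win_basis m h (snd (z i)) \<bullet> theta_hat m h n z"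

definition cluster_score ::
  "(real \<Rightarrow> real ^ 'n) \<Rightarrow> real \<Rightarrow> nat \<Rightarrow> (nat \<Rightarrow> real \<times> real) \<Rightarrow> real \<Rightarrow> real ^ 'n::finite" where
  "cluster_score m h n z x =
     (\<Sum>i = 1..n. (of_bool (snd (z i) = x) * residual m h n z i) *\<^sub>R win_basis m h (snd (z i)))"

definition crv_hat ::
  "(real \<Rightarrow> real ^ 'n) \<Rightarrow> real ^ 'n \<Rightarrow> real \<Rightarrow> nat \<Rightarrow> (nat \<Rightarrow> real) \<Rightarrow> nat \<Rightarrow> (nat \<Rightarrow> real \<times> real)
     \<Rightarrow> real" where
  "crv_hat m (e1 :: real ^ 'n::finite) h G x n z =
     e1 \<bullet> ((matrix_inv (Q_hat m h n z)
             ** ((\<Sum>g = 1..G. outer (cluster_score m h n z (x g)) (cluster_score m h n z (x g)))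
                 /\<^sub>R win_count h n z)
             ** matrix_inv (Q_hat m h n z)) *v e1)"

subsection \<open>Model and regularity conditions\<close>

definition iid_sample ::
  "'w measure \<Rightarrow> nat \<Rightarrow> (nat \<Rightarrow> 'w \<Rightarrow> real \<times> real) \<Rightarrow> (real \<times> real) measure \<Rightarrow> bool" where
  "iid_sample S n Z P \<longleftrightarrow>
     prob_space S \<and>
     prob_space.indep_vars S (\<lambda>_. borel) Z {1..n} \<and>
     (\<forall>i\<in>{1..n}. distr S borel (Z i) = P)"

definition discrete_running_variable ::
  "(real \<times> real) measure \<Rightarrow> nat \<Rightarrow> nat \<Rightarrow> (nat \<Rightarrow> real) \<Rightarrow> bool" where
  "discrete_running_variable P Gm Gp x \<longleftrightarrow>
     strict_mono_on {1..Gm + Gp} x \<and>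
     (\<forall>g\<in>{1..Gm}. x g < 0) \<and>
     (\<forall>g\<in>{Gm + 1..Gm + Gp}. 0 \<le> x g) \<and>
     (\<forall>g\<in>{1..Gm + Gp}. 0 < point_prob P (x g)) \<and>
     (AE z in P. snd z \<in> x ` {1..Gm + Gp})"

text \<open>
  In the following, \<open>S N\<close> is the sample space for sample size \<open>N\<close>, \<open>Z N i\<close> is the \<open>i\<close>-th of the \<open>N\<close>
  observations, and \<open>P N\<close> is their common law.  Integrability of the outcome makes the
  conditional mean and \<open>theta_pop\<close> meaningful.
\<close>

definition rd_model ::
  "(nat \<Rightarrow> 'w measure) \<Rightarrow> (nat \<Rightarrow> nat \<Rightarrow> 'w \<Rightarrow> real \<times> real) \<Rightarrow> (nat \<Rightarrow> (real \<times> real) measure)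
     \<Rightarrow> (nat \<Rightarrow> nat) \<Rightarrow> (nat \<Rightarrow> nat) \<Rightarrow> (nat \<Rightarrow> nat \<Rightarrow> real) \<Rightarrow> (nat \<Rightarrow> real) \<Rightarrow> bool" where
  "rd_model S Z P Gm Gp x h \<longleftrightarrow>
     (\<forall>N\<ge>1. iid_sample (S N) N (Z N) (P N) \<and>
            integrable (P N) fst \<and>
            discrete_running_variable (P N) (Gm N) (Gp N) (x N) \<and>
            0 < h N)"

definition window :: "real \<Rightarrow> nat \<Rightarrow> (nat \<Rightarrow> real) \<Rightarrow> nat set" where
  "window h G x = {g \<in> {1..G}. \<bar>x g\<bar> \<le> h}"

text \<open>
  The integrability clause is needed because the Bochner integral of a non-integrable function
  is \<open>0\<close>.
\<close>

definition regularity_i ::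
  "(real \<Rightarrow> real ^ 'n::finite) \<Rightarrow> (nat \<Rightarrow> (real \<times> real) measure) \<Rightarrow> (nat \<Rightarrow> nat)
     \<Rightarrow> (nat \<Rightarrow> nat \<Rightarrow> real) \<Rightarrow> (nat \<Rightarrow> real) \<Rightarrow> bool" where
  "regularity_i m P G x h \<longleftrightarrow>
     (\<exists>B. \<forall>N\<ge>1. \<forall>g\<in>{1..G N}.
        integrable (cond_law (P N) (x N g)) (\<lambda>z. (fst z - cond_mean (P N) (snd z)) ^ 4) \<and>
        (\<integral>z. (fst z - cond_mean (P N) (snd z)) ^ 4 \<partial>cond_law (P N) (x N g)) \<le> B) \<and>
     (\<exists>C>0. \<forall>N\<ge>1. C < det (normalize_mat m (h N) (Q_pop m (h N) (P N)))) \<and>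
     filterlim (\<lambda>N. real N * win_prob (h N) (P N)) at_top sequentially \<and>
     convergent (\<lambda>N. normalize_mat m (h N) (Q_pop m (h N) (P N)))"

definition regularity_ii ::
  "(real \<Rightarrow> real ^ 'n::finite) \<Rightarrow> (nat \<Rightarrow> (real \<times> real) measure) \<Rightarrow> (nat \<Rightarrow> nat)
     \<Rightarrow> (nat \<Rightarrow> nat \<Rightarrow> real) \<Rightarrow> (nat \<Rightarrow> real) \<Rightarrow> bool" where
  "regularity_ii m P G x h \<longleftrightarrow>
     (\<exists>B. \<forall>N\<ge>1. \<forall>g\<in>window (h N) (G N) (x N). \<bar>approx_bias m (h N) (P N) (x N g)\<bar> \<le> B) \<and>
     convergent (\<lambda>N. normalize_mat m (h N) (Omega_pop m (h N) (P N)))"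

subsection \<open>Convergence in probability to zero along a triangular array\<close>

definition tendsto_zero_in_prob :: "(nat \<Rightarrow> 'w measure) \<Rightarrow> (nat \<Rightarrow> 'w \<Rightarrow> real) \<Rightarrow> bool" where
  "tendsto_zero_in_prob S R \<longleftrightarrow>
     (\<forall>N. R N \<in> borel_measurable (S N)) \<and>
     (\<forall>\<epsilon>>0. (\<lambda>N. \<P>(\<omega> in S N. \<bar>R N \<omega>\<bar> > \<epsilon>)) \<longlonglongrightarrow> 0)"

end

theory Submission
  imports Defs
begin

text \<open>
  The estimator is unchanged when the regressors \<open>m\<close> are replaced by \<open>diag (m h)\<^sup>-\<^sup>1 m\<close>, so we may assume
  that they are bounded on the window and that \<open>Q\<^sub>N\<close> tends to an invertible matrix.  Put
  \<open>q = Q\<^sub>N\<^sup>-\<^sup>1 e\<^sub>1\<close>, \<open>U\<^sub>g = \<Sum>\<^sub>i 1{X\<^sub>i = x\<^sub>g} u\<^sub>i\<close> and \<open>V = \<Sum>\<^sub>g (q \<bullet> m\<^sub>g)\<^sup>2 U\<^sub>g\<^sup>2\<close>.  The target \<open>\<tau>\<close> is exactly the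
  mean of \<open>V / (N \<pi>)\<close>.  Writing \<open>V\<close> as a diagonal sum, a linear statistic and a degenerate U-statistic,
  its relative variance is \<open>O(1 / (N \<pi>) + max \<pi>\<^sub>g / \<pi>)\<close>, so \<open>V / (N \<pi> \<tau>)\<close> tends to \<open>1\<close> in
  probability.

  The square root of the estimator is, up to the factor \<open>N\<^sub>h / (N \<pi>)\<close>, the \<open>\<ell>\<^sub>2\<close>-norm over \<open>g\<close> of
  \<open>(qhat \<bullet> m\<^sub>g) (U\<^sub>g - n\<^sub>g m\<^sub>g \<bullet> \<Delta>) / sqrt (N \<pi>)\<close>, where \<open>n\<^sub>g\<close> counts the observations at \<open>x\<^sub>g\<close> and
  \<open>\<Delta>\<close> is the estimation error of the coefficients.  The errors \<open>qhat - q\<close> and \<open>\<Delta>\<close> are of order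
  \<open>(N \<pi>) powr (-1/2)\<close>, while \<open>\<Sum>\<^sub>g U\<^sub>g\<^sup>2 / (N \<pi>)\<close> and \<open>\<Sum>\<^sub>g n\<^sub>g\<^sup>2 / (N \<pi>)\<close> are of order
  \<open>1 + N \<pi> max \<pi>\<^sub>g / \<pi>\<close>.  By the triangle inequality the norm therefore differs from
  \<open>sqrt (V / (N \<pi>))\<close> by \<open>o(1)\<close>, which is negligible because \<open>\<tau>\<close> is bounded away from \<open>0\<close>.
\<close>

section \<open>Matrices\<close>

text \<open>Two quantities may diverge when \<open>nw * \<rho>\<close> does: the cluster masses and
  the target itself. The quadratic form is therefore compared with the target as a ratio, the
  variance of its linear part being bounded by a multiple of the target. The error terms are weighed
  by a scale \<open>l\<close> chosen so that \<open>l\<close> times the estimation errors and the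
  masses divided by \<open>l^2\<close> are both small. The positive lower bound on the target is the
  hypothesis \<open>nondegenerate\<close>; it does not follow from the regularity conditions, which
  allow both noise and bias to vanish. Probability enters only through one nonnegative variable
  \<open>\<xi>\<close> whose mean tends to 0. All further limits are deterministic, along the filter
  on pairs \<open>(N, \<omega>)\<close> in which \<open>N\<close> tends to infinity and
  \<open>\<xi>\<close> to 0. A singular sample Gram matrix has an arbitrary
  \<open>matrix_inv\<close>, so the expansion is claimed only for nonzero determinants, which holds
  eventually along this filter.\<close>

lemma outer_mult_vec: "outer v w *v y = (w \<bullet> y) *\<^sub>R v"
  by (simp add: outer_def matrix_vector_mult_def inner_vec_def vec_eq_iff sum_distrib_left mult_ac)

lemma outer_congruence:
  fixes A :: "real ^ 'n ^ 'n"
  shows "A ** outer v w ** transpose A = outer (A *v v) (A *v w)"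
proof -
  have "(\<Sum>k\<in>UNIV. (\<Sum>l\<in>UNIV. A $ i $ l * (v $ l * w $ k)) * A $ j $ k)
      = (\<Sum>l\<in>UNIV. A $ i $ l * v $ l) * (\<Sum>k\<in>UNIV. A $ j $ k * w $ k)" for i j
  proof -
    have "(\<Sum>l\<in>UNIV. A $ i $ l * (v $ l * w $ k)) = (\<Sum>l\<in>UNIV. A $ i $ l * v $ l) * w $ k" for k
      by (simp add: sum_distrib_right mult.assoc)
    then show ?thesis
      by (simp only:) (simp add: sum_distrib_left mult_ac)
  qed
  then show ?thesis
    by (simp add: matrix_matrix_mult_def outer_def matrix_vector_mult_def vec_eq_iff transpose_def)
qed

lemma matrix_inv_unique:
  fixes A :: "real ^ 'n ^ 'n"
  assumes "A ** B = mat 1"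
  shows "matrix_inv A = B"
proof -
  have BA: "B ** A = mat 1"
    using assms by (simp add: matrix_left_right_inverse)
  have "A ** matrix_inv A = mat 1 \<and> matrix_inv A ** A = mat 1"
    unfolding matrix_inv_def by (rule someI[of _ B]) (use assms BA in auto)
  then have "matrix_inv A = (B ** A) ** matrix_inv A"
    by (simp add: BA)
  also have "\<dots> = B ** (A ** matrix_inv A)"
    by (simp only: matrix_mul_assoc)
  finally show ?thesis
    using \<open>A ** matrix_inv A = mat 1 \<and> _\<close> by simp
qed

lemma
  fixes A :: "real ^ 'n ^ 'n"
  assumes "invertible A"
  shows matrix_mul_inv: "A ** matrix_inv A = mat 1"
    and matrix_inv_mul: "matrix_inv A ** A = mat 1"
proof -
  have "A ** matrix_inv A = mat 1 \<and> matrix_inv A ** A = mat 1"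
    unfolding matrix_inv_def by (rule someI_ex) (use assms in \<open>simp add: invertible_def\<close>)
  then show "A ** matrix_inv A = mat 1" "matrix_inv A ** A = mat 1"
    by auto
qed

lemma matrix_inv_transpose:
  fixes A :: "real ^ 'n ^ 'n"
  assumes "invertible A"
  shows "matrix_inv (transpose A) = transpose (matrix_inv A)"
  by (intro matrix_inv_unique)
    (simp flip: matrix_transpose_mul add: matrix_inv_mul assms transpose_mat)

lemma matrix_inv_congruence:
  fixes A B :: "real ^ 'n ^ 'n"
  assumes "invertible A" "invertible B"
  shows "matrix_inv (A ** B ** transpose A)
         = transpose (matrix_inv A) ** matrix_inv B ** matrix_inv A"
proof (rule matrix_inv_unique)
  have "A ** B ** transpose A ** (transpose (matrix_inv A) ** matrix_inv B ** matrix_inv A)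
      = A ** (B ** ((transpose A ** transpose (matrix_inv A)) ** matrix_inv B)) ** matrix_inv A"
    by (simp only: matrix_mul_assoc)
  also have "\<dots> = mat 1"
    by (simp flip: matrix_transpose_mul add: matrix_inv_mul matrix_mul_inv assms transpose_mat)
  finally show "A ** B ** transpose A
      ** (transpose (matrix_inv A) ** matrix_inv B ** matrix_inv A) = mat 1" .
qed

text \<open>Cramer's rule for the columns of the inverse. Entries become quotients of determinants,
  which yields both continuity and measurability of inversion.\<close>

lemma matrix_inv_entry:
  fixes A :: "real ^ 'n ^ 'n"
  assumes "det A \<noteq> 0"
  shows "matrix_inv A $ k $ l = det (\<chi> i j. if j = k then mat 1 $ i $ l else A $ i $ j) / det A"
proof -
  have "A *v column l (matrix_inv A) = column l (mat 1)"
  proof -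
    have "A *v column l B = column l (A ** B)" for B
      by (simp add: column_def matrix_vector_mult_def matrix_matrix_mult_def vec_eq_iff)
    then show ?thesis
      using assms by (simp add: invertible_det_nz matrix_mul_inv)
  qed
  then have "column l (matrix_inv A)
      = (\<chi> k. det (\<chi> i j. if j = k then column l (mat 1) $ i else A $ i $ j) / det A)"
    using cramer[OF assms] by blast
  moreover have "matrix_inv A $ k $ l = column l (matrix_inv A) $ k"
    and "\<And>i. column l (mat 1) $ i = (mat 1 :: real ^ 'n ^ 'n) $ i $ l"
    by (simp_all add: column_def)
  ultimately show ?thesis
    by (simp only: vec_lambda_beta)
qed

section \<open>Continuity and measurability of determinant and inverse\<close>

lemma tendsto_det:
  fixes A :: "'a \<Rightarrow> real ^ 'n ^ 'n"
  assumes "(A \<longlongrightarrow> B) F"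
  shows "((\<lambda>t. det (A t)) \<longlongrightarrow> det B) F"
  unfolding det_def by (intro tendsto_intros assms)

lemma tendsto_matrix_inv:
  fixes A :: "'a \<Rightarrow> real ^ 'n ^ 'n"
  assumes "(A \<longlongrightarrow> B) F" "det B \<noteq> 0"
  shows "((\<lambda>t. matrix_inv (A t)) \<longlongrightarrow> matrix_inv B) F"
proof -
  have nz: "\<forall>\<^sub>F t in F. det (A t) \<noteq> 0"
    using tendsto_imp_eventually_ne[OF tendsto_det[OF assms(1)] assms(2)] .
  have "((\<lambda>t. matrix_inv (A t) $ k $ l) \<longlongrightarrow> matrix_inv B $ k $ l) F" for k l
  proof (subst tendsto_cong)
    show "\<forall>\<^sub>F t in F. matrix_inv (A t) $ k $ l
        = det (\<chi> i j. if j = k then mat 1 $ i $ l else A t $ i $ j) / det (A t)"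
      using nz by eventually_elim (rule matrix_inv_entry)
    have "((\<lambda>t. if j = k then mat 1 $ i $ l else A t $ i $ j) \<longlongrightarrow>
        (if j = k then mat 1 $ i $ l else B $ i $ j)) F" for i j
      by (auto intro!: tendsto_intros assms(1))
    then show "((\<lambda>t. det (\<chi> i j. if j = k then mat 1 $ i $ l else A t $ i $ j) / det (A t))
        \<longlongrightarrow> matrix_inv B $ k $ l) F"
      unfolding matrix_inv_entry[OF assms(2)]
      by (intro tendsto_divide tendsto_det tendsto_vec_lambda assms) auto
  qed
  then show ?thesis
    by (intro vec_tendstoI)
qed

lemma tendsto_matrix_vector_mult:
  fixes A :: "'a \<Rightarrow> real ^ 'n ^ 'm"
  assumes "(A \<longlongrightarrow> B) F" "(v \<longlongrightarrow> w) F"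
  shows "((\<lambda>t. A t *v v t) \<longlongrightarrow> B *v w) F"
  unfolding matrix_vector_mult_def by (intro tendsto_intros assms)

lemma borel_measurable_vecI:
  fixes f :: "'a \<Rightarrow> 'b::euclidean_space ^ 'n"
  assumes "\<And>i. (\<lambda>t. f t $ i) \<in> borel_measurable M"
  shows "f \<in> borel_measurable M"
proof (subst borel_measurable_euclidean_space, rule ballI)
  fix b :: "'b ^ 'n" assume "b \<in> Basis"
  then obtain i u where "b = axis i u"
    by (auto simp: Basis_vec_def)
  then show "(\<lambda>t. f t \<bullet> b) \<in> borel_measurable M"
    using assms by (simp add: inner_axis)
qed

lemma borel_measurable_vec_nth [measurable]:
  fixes f :: "'a \<Rightarrow> 'b::euclidean_space ^ 'n"
  assumes "f \<in> borel_measurable M"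
  shows "(\<lambda>t. f t $ i) \<in> borel_measurable M"
  by (rule measurable_compose[OF assms])
    (intro borel_measurable_continuous_onI continuous_intros)

lemma borel_measurable_matrix_vector_mult [measurable]:
  fixes A :: "'a \<Rightarrow> real ^ 'n ^ 'm"
  assumes [measurable]: "A \<in> borel_measurable M" "v \<in> borel_measurable M"
  shows "(\<lambda>t. A t *v v t) \<in> borel_measurable M"
  by (rule borel_measurable_vecI) (simp add: matrix_vector_mult_def)

lemma borel_measurable_matrix_matrix_mult [measurable]:
  fixes A :: "'a \<Rightarrow> real ^ 'n ^ 'm" and B :: "'a \<Rightarrow> real ^ 'k ^ 'n"
  assumes [measurable]: "A \<in> borel_measurable M" "B \<in> borel_measurable M"
  shows "(\<lambda>t. A t ** B t) \<in> borel_measurable M"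
  by (intro borel_measurable_vecI) (simp add: matrix_matrix_mult_def)

lemma borel_measurable_outer [measurable]:
  assumes [measurable]: "v \<in> borel_measurable M" "w \<in> borel_measurable M"
  shows "(\<lambda>t. outer (v t) (w t)) \<in> borel_measurable M"
  by (intro borel_measurable_vecI) (simp add: outer_def)

lemma borel_measurable_det [measurable]:
  fixes A :: "'a \<Rightarrow> real ^ 'n ^ 'n"
  assumes [measurable]: "A \<in> borel_measurable M"
  shows "(\<lambda>t. det (A t)) \<in> borel_measurable M"
  unfolding det_def by measurable

text \<open>On singular matrices \<open>matrix_inv\<close> is one fixed junk value.\<close>
lemma borel_measurable_matrix_inv [measurable]:
  fixes A :: "'a \<Rightarrow> real ^ 'n ^ 'n"
  assumes [measurable]: "A \<in> borel_measurable M"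
  shows "(\<lambda>t. matrix_inv (A t)) \<in> borel_measurable M"
proof -
  \<comment> \<open>For a singular matrix the predicate inside the choice that defines
    \<open>matrix_inv\<close> is constantly false, so the choice is this term for every singular
    matrix.\<close>
  define junk :: "real ^ 'n ^ 'n" where "junk = (SOME _. False)"
  have singular: "matrix_inv B = junk" if "det B = 0" for B :: "real ^ 'n ^ 'n"
  proof -
    have "(\<lambda>C. B ** C = mat 1 \<and> C ** B = mat 1) = (\<lambda>_. False)"
      using that invertible_det_nz[of B] unfolding invertible_def by (intro ext) blast
    then show ?thesis
      unfolding matrix_inv_def junk_def by simp
  qed
  have "(\<lambda>t. matrix_inv (A t)) = (\<lambda>t. if det (A t) = 0 then junk else
    (\<chi> k l. det (\<chi> i j. if j = k then mat 1 $ i $ l else A t $ i $ j) / det (A t)))"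
    by (auto simp: singular matrix_inv_entry vec_eq_iff)
  moreover have "(\<lambda>t. (\<chi> i j. if j = k then mat 1 $ i $ l else A t $ i $ j) :: real ^ 'n ^ 'n)
      \<in> borel_measurable M" for k l :: 'n
    by (intro borel_measurable_vecI) simp
  then have "(\<lambda>t. (\<chi> k l. det (\<chi> i j. if j = k then mat 1 $ i $ l else A t $ i $ j) / det (A t))
      :: real ^ 'n ^ 'n) \<in> borel_measurable M"
    by (intro borel_measurable_vecI) simp
  ultimately show ?thesis
    by simp
qed

section \<open>Linear change of regressors\<close>

lemma win_basis_linear: "win_basis (\<lambda>x. A *v m x) h x = A *v win_basis m h x"
  by (simp add: win_basis_def matrix_vector_mult_scaleR)

lemma linear_congruence:
  fixes A B :: "real ^ 'n ^ 'n"
  shows "linear (\<lambda>X. A ** X ** B)"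
  by (rule linearI)
    (simp_all add: matrix_matrix_mult_def vec_eq_iff sum.distrib sum_distrib_left sum_distrib_right
      algebra_simps)

text \<open>Invertibility takes the place of integrability of \<open>f\<close>: an invertible map
  sends non-integrable functions to non-integrable ones, and both integrals then have the default
  value 0.\<close>

lemma integral_congruence:
  fixes A :: "real ^ 'n ^ 'n" and f :: "'a \<Rightarrow> real ^ 'n ^ 'n"
  assumes "invertible A"
  shows "(\<integral>z. A ** f z ** transpose A \<partial>M) = A ** (\<integral>z. f z \<partial>M) ** transpose A"
proof (rule integral_bounded_linear')
  show "bounded_linear (\<lambda>X. A ** X ** transpose A)"
    "bounded_linear (\<lambda>X. matrix_inv A ** X ** transpose (matrix_inv A))"
    by (intro linear_conv_bounded_linear[THEN iffD1] linear_congruence)+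
  have "matrix_inv A ** (A ** X ** transpose A) ** transpose (matrix_inv A)
      = (matrix_inv A ** A) ** X ** transpose (matrix_inv A ** A)" for X
    by (simp only: matrix_transpose_mul matrix_mul_assoc)
  then show "\<forall>X. matrix_inv A ** (A ** X ** transpose A) ** transpose (matrix_inv A) = X"
    by (simp add: matrix_inv_mul assms transpose_mat)
qed

lemma integral_linear_image:
  fixes A :: "real ^ 'n ^ 'n" and f :: "'a \<Rightarrow> real ^ 'n"
  assumes "invertible A"
  shows "(\<integral>z. A *v f z \<partial>M) = A *v (\<integral>z. f z \<partial>M)"
proof (rule integral_bounded_linear')
  show "bounded_linear ((*v) A)" "bounded_linear ((*v) (matrix_inv A))"
    by (simp_all add: linear_linear)
  show "\<forall>x. matrix_inv A *v (A *v x) = x"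
    by (simp add: matrix_vector_mul_assoc matrix_inv_mul assms)
qed

section \<open>Population quantities under a change of regressors\<close>

lemma Q_pop_linear:
  fixes A :: "real ^ 'n ^ 'n"
  assumes "invertible A"
  shows "Q_pop (\<lambda>x. A *v m x) h P = A ** Q_pop m h P ** transpose A"
  unfolding Q_pop_def win_basis_linear outer_congruence[symmetric] integral_congruence[OF assms]
  by (simp add: linear_scale[OF linear_congruence])

lemma inner_matrix_vector_transpose:
  fixes A :: "real ^ 'n ^ 'm"
  shows "(A *v v) \<bullet> w = v \<bullet> (transpose A *v w)"
  by (metis dot_lmul_matrix inner_commute transpose_matrix_vector transpose_transpose)

text \<open>Regressors transform by \<open>A\<close> and coefficients by its inverse transpose, so
  fitted values, and with them biases and residuals, are invariant.\<close>

lemma inner_congruent: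
  fixes A :: "real ^ 'n ^ 'n"
  assumes "invertible A"
  shows "(A *v v) \<bullet> (transpose (matrix_inv A) *v w) = v \<bullet> w"
proof -
  have "transpose A ** transpose (matrix_inv A) = mat 1"
    by (simp add: matrix_inv_mul assms transpose_mat flip: matrix_transpose_mul)
  then show ?thesis
    by (simp only: inner_matrix_vector_transpose matrix_vector_mul_assoc matrix_vector_mul_lid)
qed

text \<open>Common form of the population and the sample coefficients: \<open>B\<close> is a Gram
  matrix, \<open>b\<close> a cross moment and \<open>c\<close> the normalising mass.\<close>

lemma weighted_solution_linear:
  fixes A B :: "real ^ 'n ^ 'n"
  assumes A: "invertible A" and B: "invertible B"
  shows "matrix_inv (A ** B ** transpose A) *v ((A *v b) /\<^sub>R c)
       = transpose (matrix_inv A) *v (matrix_inv B *v (b /\<^sub>R c))"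
proof -
  have "matrix_inv (A ** B ** transpose A) *v (A *v (b /\<^sub>R c))
      = (transpose (matrix_inv A) ** matrix_inv B ** (matrix_inv A ** A)) *v (b /\<^sub>R c)"
    by (simp only: matrix_inv_congruence[OF A B] matrix_vector_mul_assoc matrix_mul_assoc)
  then show ?thesis
    by (simp add: matrix_inv_mul A matrix_vector_mul_assoc matrix_vector_mult_scaleR)
qed

lemma theta_pop_linear:
  fixes A :: "real ^ 'n ^ 'n"
  assumes "invertible A" "invertible (Q_pop m h P)"
  shows "theta_pop (\<lambda>x. A *v m x) h P = transpose (matrix_inv A) *v theta_pop m h P"
  using weighted_solution_linear[OF assms]
  by (simp add: theta_pop_def Q_pop_linear assms(1) win_basis_linear integral_linear_image
      flip: matrix_vector_mult_scaleR)

lemma Omega_pop_linear: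
  fixes A :: "real ^ 'n ^ 'n"
  assumes "invertible A" "invertible (Q_pop m h P)"
  shows "Omega_pop (\<lambda>x. A *v m x) h P = A ** Omega_pop m h P ** transpose A"
  unfolding Omega_pop_def win_basis_linear outer_congruence[symmetric] theta_pop_linear[OF assms]
    inner_congruent[OF assms(1)] linear_scale[OF linear_congruence, symmetric]
    integral_congruence[OF assms(1)]
  by (simp add: linear_scale[OF linear_congruence])

lemma approx_bias_linear:
  fixes A :: "real ^ 'n ^ 'n"
  assumes "invertible A" "invertible (Q_pop m h P)"
  shows "approx_bias (\<lambda>x. A *v m x) h P x = approx_bias m h P x"
  by (simp add: approx_bias_def theta_pop_linear assms inner_congruent
      del: transpose_matrix_vector)

lemma Q_point_linear:
  fixes A :: "real ^ 'n ^ 'n"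
  shows "Q_point (\<lambda>x. A *v m x) h P x = A ** Q_point m h P x ** transpose A"
  by (simp add: Q_point_def win_basis_linear linear_scale[OF linear_congruence]
      flip: outer_congruence)

text \<open>All inner factors \<open>A\<close> cancel; the two outer inverses act on
  \<open>e\<close>, which they fix. For regressors normalised by \<open>m h\<close> this holds
  because the first entry of \<open>m h\<close> is 1.\<close>

lemma sandwich_linear:
  fixes A B C :: "real ^ 'n ^ 'n"
  assumes A: "invertible A" and B: "invertible B" and e: "A *v e = e"
  shows "e \<bullet> ((matrix_inv (A ** B ** transpose A) ** (A ** C ** transpose A)
                 ** matrix_inv (A ** B ** transpose A)) *v e)
       = e \<bullet> ((matrix_inv B ** C ** matrix_inv B) *v e)"
proof -
  have "matrix_inv (A ** B ** transpose A) ** (A ** C ** transpose A)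
                 ** matrix_inv (A ** B ** transpose A)
      = transpose (matrix_inv A) ** matrix_inv B ** (matrix_inv A ** A) ** C
          ** transpose (matrix_inv A ** A) ** matrix_inv B ** matrix_inv A"
    by (simp only: matrix_inv_congruence[OF A B] matrix_mul_assoc matrix_transpose_mul)
  also have "\<dots> = transpose (matrix_inv A) ** (matrix_inv B ** C ** matrix_inv B) ** matrix_inv A"
    by (simp add: matrix_inv_mul A transpose_mat matrix_mul_assoc)
  finally have eq: "matrix_inv (A ** B ** transpose A) ** (A ** C ** transpose A)
      ** matrix_inv (A ** B ** transpose A)
      = transpose (matrix_inv A) ** (matrix_inv B ** C ** matrix_inv B) ** matrix_inv A" .
  have "matrix_inv A *v e = e"
    by (metis e A matrix_inv_mul matrix_vector_mul_assoc matrix_vector_mul_lid)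
  then have "e \<bullet> (transpose (matrix_inv A) *v v) = e \<bullet> v" for v
    by (metis inner_matrix_vector_transpose)
  then show ?thesis
    unfolding eq by (simp add: \<open>matrix_inv A *v e = e\<close> flip: matrix_vector_mul_assoc)
qed

lemma crv_pop_linear:
  fixes A :: "real ^ 'n ^ 'n"
  assumes "invertible A" "invertible (Q_pop m h P)" "A *v e = e"
  shows "crv_pop (\<lambda>x. A *v m x) e h P G x n = crv_pop m e h P G x n"
  unfolding crv_pop_def Q_pop_linear[OF assms(1)] Omega_pop_linear[OF assms(1,2)]
    Q_point_linear approx_bias_linear[OF assms(1,2)]
    linear_scale[OF linear_congruence, symmetric] linear_sum[OF linear_congruence, symmetric]
    linear_add[OF linear_congruence, symmetric]
  by (rule sandwich_linear[OF assms])

section \<open>Sample quantities under a change of regressors\<close>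

lemma Q_hat_linear:
  fixes A :: "real ^ 'n ^ 'n"
  shows "Q_hat (\<lambda>x. A *v m x) h n z = A ** Q_hat m h n z ** transpose A"
  unfolding Q_hat_def win_basis_linear outer_congruence[symmetric]
  by (simp add: linear_scale[OF linear_congruence] linear_sum[OF linear_congruence])

text \<open>Invertibility of the sample Gram matrix has to be assumed: the default value of
  \<open>matrix_inv\<close> at singular matrices does not transform with \<open>A\<close>.\<close>

lemma theta_hat_linear:
  fixes A :: "real ^ 'n ^ 'n"
  assumes "invertible A" "invertible (Q_hat m h n z)"
  shows "theta_hat (\<lambda>x. A *v m x) h n z = transpose (matrix_inv A) *v theta_hat m h n z"
  using weighted_solution_linear[OF assms]
  by (simp add: theta_hat_def Q_hat_linear win_basis_linear matrix_vector_mult_scaleR[symmetric]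
      linear_sum[OF matrix_vector_mul_linear, symmetric])

lemma residual_linear:
  fixes A :: "real ^ 'n ^ 'n"
  assumes "invertible A" "invertible (Q_hat m h n z)"
  shows "residual (\<lambda>x. A *v m x) h n z i = residual m h n z i"
  by (simp add: residual_def win_basis_linear theta_hat_linear assms inner_congruent
      del: transpose_matrix_vector)

lemma cluster_score_linear:
  fixes A :: "real ^ 'n ^ 'n"
  assumes "invertible A" "invertible (Q_hat m h n z)"
  shows "cluster_score (\<lambda>x. A *v m x) h n z x = A *v cluster_score m h n z x"
  by (simp add: cluster_score_def residual_linear assms win_basis_linear
      linear_sum[OF matrix_vector_mul_linear] matrix_vector_mult_scaleR)

lemma crv_hat_linear:
  fixes A :: "real ^ 'n ^ 'n"
  assumes "invertible A" "invertible (Q_hat m h n z)" "A *v e = e"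
  shows "crv_hat (\<lambda>x. A *v m x) e h G x n z = crv_hat m e h G x n z"
  unfolding crv_hat_def Q_hat_linear cluster_score_linear[OF assms(1,2)]
    outer_congruence[symmetric]
    linear_sum[OF linear_congruence, symmetric] linear_scale[OF linear_congruence, symmetric]
  by (rule sandwich_linear[OF assms])

section \<open>Moments of sums of independent observations\<close>

lemma integrable_mult_of_squares:
  fixes f g :: "'a \<Rightarrow> real"
  assumes [measurable]: "f \<in> borel_measurable M" "g \<in> borel_measurable M"
    and "integrable M (\<lambda>x. (f x)\<^sup>2)" "integrable M (\<lambda>x. (g x)\<^sup>2)"
  shows "integrable M (\<lambda>x. f x * g x)"
proof (rule Bochner_Integration.integrable_bound)
  show "integrable M (\<lambda>x. (f x)\<^sup>2 + (g x)\<^sup>2)"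
    using assms by simp
  have "\<bar>a * b\<bar> \<le> a\<^sup>2 + b\<^sup>2" for a b :: real
  proof -
    have "2 * \<bar>a * b\<bar> \<le> a\<^sup>2 + b\<^sup>2"
      using sum_squares_bound[of "\<bar>a\<bar>" "\<bar>b\<bar>"] by (simp add: abs_mult mult.assoc)
    then show ?thesis
      using abs_ge_zero[of "a * b"] by linarith
  qed
  then show "AE x in M. norm (f x * g x) \<le> norm ((f x)\<^sup>2 + (g x)\<^sup>2)"
    by simp
qed measurable

lemma integrable_square_add:
  fixes f g :: "'a \<Rightarrow> real"
  assumes [measurable]: "f \<in> borel_measurable M" "g \<in> borel_measurable M"
    and "integrable M (\<lambda>x. (f x)\<^sup>2)" "integrable M (\<lambda>x. (g x)\<^sup>2)"
  shows "integrable M (\<lambda>x. (f x + g x)\<^sup>2)"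
  unfolding power2_sum using integrable_mult_of_squares[OF assms] assms
  by (simp add: mult.assoc)

lemma integrable_square_sum:
  fixes f :: "'i \<Rightarrow> 'a \<Rightarrow> real"
  assumes "finite I" "\<And>i. i \<in> I \<Longrightarrow> f i \<in> borel_measurable M"
    and "\<And>i. i \<in> I \<Longrightarrow> integrable M (\<lambda>x. (f i x)\<^sup>2)"
  shows "integrable M (\<lambda>x. (\<Sum>i\<in>I. f i x)\<^sup>2)"
  using assms
proof (induction I)
  case (insert i I)
  then show ?case
    by (simp add: integrable_square_add borel_measurable_sum)
qed simp

text \<open>With no observation the law \<open>P\<close> would be unconstrained;
  \<open>1 \<le> n\<close> identifies it as the law of the first observation, hence a Borel
  probability measure.\<close>

locale iid_data =
  fixes S :: "'w measure" and n :: nat and Z :: "nat \<Rightarrow> 'w \<Rightarrow> real \<times> real"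
    and P :: "(real \<times> real) measure"
  assumes sample: "iid_sample S n Z P" and sample_size: "1 \<le> n"

sublocale iid_data \<subseteq> prob_space S
  using sample by (simp add: iid_sample_def)

context iid_data
begin

lemma indep: "indep_vars (\<lambda>_. borel) Z {1..n}"
  using sample by (simp add: iid_sample_def)

lemma measurable_obs: "i \<in> {1..n} \<Longrightarrow> Z i \<in> borel_measurable S"
  using indep by (simp add: indep_vars_def)

lemma distr_obs: "i \<in> {1..n} \<Longrightarrow> distr S borel (Z i) = P"
  using sample by (simp add: iid_sample_def)

lemma sets_law [measurable_cong, simp]: "sets P = sets borel"
  using distr_obs[of 1] sample_size by auto

lemma space_law [simp]: "space P = UNIV"
  using sets_eq_imp_space_eq[OF sets_law] by simp

lemma prob_space_law: "prob_space P"
  using prob_space_distr[OF measurable_obs[of 1]] distr_obs[of 1] sample_size by simp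

lemma borel_measurable_obs:
  assumes "f \<in> borel_measurable borel" "i \<in> {1..n}"
  shows "(\<lambda>\<omega>. f (Z i \<omega>)) \<in> borel_measurable S"
  using measurable_compose[OF measurable_obs[OF assms(2)] assms(1)] .

lemma integral_obs:
  fixes f :: "real \<times> real \<Rightarrow> real"
  assumes "f \<in> borel_measurable borel" "i \<in> {1..n}"
  shows "(\<integral>\<omega>. f (Z i \<omega>) \<partial>S) = (\<integral>z. f z \<partial>P)"
  using integral_distr[OF measurable_obs[OF assms(2)] assms(1)] distr_obs[OF assms(2)] by simp

lemma integrable_obs:
  fixes f :: "real \<times> real \<Rightarrow> real"
  assumes "integrable P f" "i \<in> {1..n}"
  shows "integrable S (\<lambda>\<omega>. f (Z i \<omega>))"
  using assms distr_obs[OF assms(2)] borel_measurable_integrable[OF assms(1)]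
  by (subst integrable_distr_eq[symmetric]) (auto intro: measurable_obs)

text \<open>Replaces a filtration: the past is a function of the first \<open>k\<close>
  observations. The equation with \<open>restrict\<close> says that \<open>\<phi>\<close> reads only
  these coordinates, so that it factors through the product space over
  \<open>{1..k}\<close>.\<close>

lemma indep_prefix:
  fixes \<phi> :: "(nat \<Rightarrow> real \<times> real) \<Rightarrow> real" and \<psi> :: "real \<times> real \<Rightarrow> real"
  assumes "\<phi> \<in> borel_measurable (PiM {1..k} (\<lambda>_. borel))" "\<psi> \<in> borel_measurable borel"
    and "\<And>z. \<phi> (restrict z {1..k}) = \<phi> z" "k < j" "j \<le> n"
  shows "indep_var borel (\<lambda>\<omega>. \<phi> (\<lambda>i. Z i \<omega>)) borel (\<lambda>\<omega>. \<psi> (Z j \<omega>))"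
proof -
  have "indep_var borel (\<phi> \<circ> (\<lambda>\<omega>. restrict (\<lambda>i. Z i \<omega>) {1..k}))
        borel ((\<lambda>v. \<psi> (v j)) \<circ> (\<lambda>\<omega>. restrict (\<lambda>i. Z i \<omega>) {j}))"
    using assms by (intro indep_var_compose[OF indep_var_restrict[OF indep]]) auto
  then show ?thesis
    by (simp add: comp_def assms del: One_nat_def)
qed

text \<open>With a centred \<open>\<psi>\<close> the product has mean zero; this is the martingale
  property behind all vanishing cross terms.\<close>

lemma
  fixes \<phi> :: "(nat \<Rightarrow> real \<times> real) \<Rightarrow> real" and \<psi> :: "real \<times> real \<Rightarrow> real"
  assumes "\<phi> \<in> borel_measurable (PiM {1..k} (\<lambda>_. borel))"
    and "\<And>z. \<phi> (restrict z {1..k}) = \<phi> z" "k < j" "j \<le> n"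
    and "integrable S (\<lambda>\<omega>. \<phi> (\<lambda>i. Z i \<omega>))" "integrable P \<psi>"
  shows integrable_prefix: "integrable S (\<lambda>\<omega>. \<phi> (\<lambda>i. Z i \<omega>) * \<psi> (Z j \<omega>))"
    and integral_prefix:
      "(\<integral>\<omega>. \<phi> (\<lambda>i. Z i \<omega>) * \<psi> (Z j \<omega>) \<partial>S) = (\<integral>\<omega>. \<phi> (\<lambda>i. Z i \<omega>) \<partial>S) * (\<integral>z. \<psi> z \<partial>P)"
proof -
  have [measurable]: "\<psi> \<in> borel_measurable borel"
    using borel_measurable_integrable[OF assms(6)] by simp
  have j: "j \<in> {1..n}"
    using assms by auto
  note indep = indep_prefix[OF assms(1) _ assms(2-4), of \<psi>]
  show "integrable S (\<lambda>\<omega>. \<phi> (\<lambda>i. Z i \<omega>) * \<psi> (Z j \<omega>))"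
    using indep_var_integrable[OF indep assms(5)] integrable_obs[OF assms(6) j] by simp
  show "(\<integral>\<omega>. \<phi> (\<lambda>i. Z i \<omega>) * \<psi> (Z j \<omega>) \<partial>S) = (\<integral>\<omega>. \<phi> (\<lambda>i. Z i \<omega>) \<partial>S) * (\<integral>z. \<psi> z \<partial>P)"
    using indep_var_lebesgue_integral[OF indep assms(5)] integrable_obs[OF assms(6) j]
    by (simp add: integral_obs[OF _ j])
qed

end

lemma borel_measurable_prefix:
  assumes "f \<in> borel_measurable borel" "i \<in> J"
  shows "(\<lambda>v. f (v i)) \<in> borel_measurable (PiM J (\<lambda>_. borel))"
  using assms by (intro measurable_compose[OF measurable_component_singleton[of i J "\<lambda>_. borel"] assms(1)])

section \<open>Linear and degenerate quadratic statistics of sample prefixes\<close>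

definition linear_stat :: "('a \<Rightarrow> real) \<Rightarrow> nat \<Rightarrow> (nat \<Rightarrow> 'a) \<Rightarrow> real" where
  "linear_stat f k z = (\<Sum>i = 1..k. f (z i))"

text \<open>The sum over pairs \<open>i < j\<close> of the kernel with values
  \<open>\<Sum>g\<in>I. b g * f g u * f g v\<close>, a U-statistic of order two up to normalisation.
  Summing by the larger index exhibits it as a martingale in \<open>k\<close>; at
  \<open>j = 1\<close> the inner prefix is empty.\<close>

definition pair_stat ::
  "'i set \<Rightarrow> ('i \<Rightarrow> real) \<Rightarrow> ('i \<Rightarrow> 'a \<Rightarrow> real) \<Rightarrow> nat \<Rightarrow> (nat \<Rightarrow> 'a) \<Rightarrow> real" where
  "pair_stat I b f k z = (\<Sum>g\<in>I. b g * (\<Sum>j = 1..k. linear_stat (f g) (j - 1) z * f g (z j)))"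

lemma linear_stat_0 [simp]: "linear_stat f 0 z = 0"
  and linear_stat_Suc: "linear_stat f (Suc k) z = linear_stat f k z + f (z (Suc k))"
  by (simp_all add: linear_stat_def)

lemma pair_stat_0 [simp]: "pair_stat I b f 0 z = 0"
  and pair_stat_Suc:
    "pair_stat I b f (Suc k) z
     = pair_stat I b f k z + (\<Sum>g\<in>I. b g * (linear_stat (f g) k z * f g (z (Suc k))))"
  by (simp_all add: pair_stat_def ring_distribs sum.distrib)

lemma linear_stat_restrict: "j \<le> k \<Longrightarrow> linear_stat f j (restrict z {1..k}) = linear_stat f j z"
  by (auto simp: linear_stat_def intro!: sum.cong)

lemma pair_stat_restrict: "pair_stat I b f k (restrict z {1..k}) = pair_stat I b f k z"
  by (auto simp: pair_stat_def linear_stat_restrict simp del: One_nat_def intro!: sum.cong)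

lemma borel_measurable_linear_stat_prefix:
  fixes f :: "'a::topological_space \<Rightarrow> real"
  assumes "f \<in> borel_measurable borel" "j \<le> k"
  shows "linear_stat f j \<in> borel_measurable (PiM {1..k} (\<lambda>_. borel))"
  unfolding linear_stat_def[abs_def]
  using assms by (intro borel_measurable_sum borel_measurable_prefix) auto

lemma borel_measurable_pair_stat_prefix:
  fixes f :: "'i \<Rightarrow> 'a::topological_space \<Rightarrow> real"
  assumes "\<And>g. g \<in> I \<Longrightarrow> f g \<in> borel_measurable borel"
  shows "pair_stat I b f k \<in> borel_measurable (PiM {1..k} (\<lambda>_. borel))"
  unfolding pair_stat_def[abs_def]
  using assms
  by (intro borel_measurable_sum borel_measurable_times borel_measurable_prefix
      borel_measurable_linear_stat_prefix borel_measurable_const) auto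

context iid_data
begin

lemma borel_measurable_linear_stat:
  assumes "f \<in> borel_measurable borel" "k \<le> n"
  shows "(\<lambda>\<omega>. linear_stat f k (\<lambda>i. Z i \<omega>)) \<in> borel_measurable S"
  unfolding linear_stat_def using assms
  by (intro borel_measurable_sum borel_measurable_obs) auto

lemma borel_measurable_pair_stat:
  assumes "\<And>g. g \<in> I \<Longrightarrow> f g \<in> borel_measurable borel" "k \<le> n"
  shows "(\<lambda>\<omega>. pair_stat I b f k (\<lambda>i. Z i \<omega>)) \<in> borel_measurable S"
  unfolding pair_stat_def using assms
  by (intro borel_measurable_sum borel_measurable_times borel_measurable_obs
      borel_measurable_linear_stat borel_measurable_const) auto

lemma integrable_square_linear_stat:
  assumes [measurable]: "f \<in> borel_measurable borel"
    and "integrable P (\<lambda>z. (f z)\<^sup>2)" "k \<le> n"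
  shows "integrable S (\<lambda>\<omega>. (linear_stat f k (\<lambda>i. Z i \<omega>))\<^sup>2)"
  unfolding linear_stat_def using assms
  by (intro integrable_square_sum borel_measurable_obs integrable_obs[of "\<lambda>z. (f z)\<^sup>2"]) auto

lemma integrable_of_square:
  fixes f :: "real \<times> real \<Rightarrow> real"
  assumes "f \<in> borel_measurable borel" "integrable P (\<lambda>z. (f z)\<^sup>2)"
  shows "integrable P f"
proof -
  interpret law: prob_space P by (rule prob_space_law)
  show ?thesis
    using integrable_mult_of_squares[of f P "\<lambda>_. 1"] assms by simp
qed

text \<open>Induction on the prefix length: by centring and independence only the products at equal
  index survive. Two different functions are allowed because squaring \<open>pair_stat\<close> pairs
  the linear statistics of different \<open>g\<close>.\<close>

lemma integral_linear_stat_mult: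
  assumes [measurable]: "f \<in> borel_measurable borel" "g \<in> borel_measurable borel"
    and sq: "integrable P (\<lambda>z. (f z)\<^sup>2)" "integrable P (\<lambda>z. (g z)\<^sup>2)"
    and centred: "(\<integral>z. f z \<partial>P) = 0" "(\<integral>z. g z \<partial>P) = 0" and "k \<le> n"
  shows "(\<integral>\<omega>. linear_stat f k (\<lambda>i. Z i \<omega>) * linear_stat g k (\<lambda>i. Z i \<omega>) \<partial>S)
         = k * (\<integral>z. f z * g z \<partial>P)"
  using \<open>k \<le> n\<close>
proof (induction k)
  case (Suc k)
  let ?L = "\<lambda>f \<omega>. linear_stat f k (\<lambda>i. Z i \<omega>)" and ?f = "\<lambda>f \<omega>. f (Z (Suc k) \<omega>)"
  have k: "k < Suc k" "Suc k \<le> n" "k \<le> n" "Suc k \<in> {1..n}"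
    using Suc.prems by auto
  have int: "integrable P f" "integrable P g"
    using integrable_of_square[OF _ sq(1)] integrable_of_square[OF _ sq(2)] by simp_all
  have intL: "integrable S (\<lambda>\<omega>. ?L f \<omega>)" "integrable S (\<lambda>\<omega>. ?L g \<omega>)"
    unfolding linear_stat_def using k int
    by (auto intro!: Bochner_Integration.integrable_sum integrable_obs)
  have int1: "integrable S (\<lambda>\<omega>. ?L f \<omega> * ?L g \<omega>)"
    by (intro integrable_mult_of_squares borel_measurable_linear_stat
        integrable_square_linear_stat assms k)
  have int2: "integrable S (\<lambda>\<omega>. ?f f \<omega> * ?f g \<omega>)"
    using integrable_obs[of "\<lambda>z. f z * g z" "Suc k"] k
      integrable_mult_of_squares[of f P g] sq by simp
  have cross: "integrable S (\<lambda>\<omega>. ?L f \<omega> * ?f g \<omega>)" "integrable S (\<lambda>\<omega>. ?L g \<omega> * ?f f \<omega>)"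
    "(\<integral>\<omega>. ?L f \<omega> * ?f g \<omega> \<partial>S) = 0" "(\<integral>\<omega>. ?L g \<omega> * ?f f \<omega> \<partial>S) = 0"
    using integrable_prefix[OF borel_measurable_linear_stat_prefix[OF _ order_refl]
          linear_stat_restrict[OF order_refl] k(1,2) intL(1) int(2)]
      integrable_prefix[OF borel_measurable_linear_stat_prefix[OF _ order_refl]
          linear_stat_restrict[OF order_refl] k(1,2) intL(2) int(1)]
      integral_prefix[OF borel_measurable_linear_stat_prefix[OF _ order_refl]
          linear_stat_restrict[OF order_refl] k(1,2) intL(1) int(2)]
      integral_prefix[OF borel_measurable_linear_stat_prefix[OF _ order_refl]
          linear_stat_restrict[OF order_refl] k(1,2) intL(2) int(1)]
    by (simp_all add: centred)
  have "(\<integral>\<omega>. linear_stat f (Suc k) (\<lambda>i. Z i \<omega>) * linear_stat g (Suc k) (\<lambda>i. Z i \<omega>) \<partial>S)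
      = (\<integral>\<omega>. ?L f \<omega> * ?L g \<omega> + ?f f \<omega> * ?f g \<omega> + ?L f \<omega> * ?f g \<omega> + ?L g \<omega> * ?f f \<omega> \<partial>S)"
    by (simp add: linear_stat_Suc algebra_simps)
  also have "\<dots> = (\<integral>\<omega>. ?L f \<omega> * ?L g \<omega> \<partial>S) + (\<integral>\<omega>. ?f f \<omega> * ?f g \<omega> \<partial>S)"
    using int1 int2 cross by simp
  also have "(\<integral>\<omega>. ?f f \<omega> * ?f g \<omega> \<partial>S) = (\<integral>z. f z * g z \<partial>P)"
    by (rule integral_obs[of "\<lambda>z. f z * g z"]) (use k in auto)
  finally show ?case
    using Suc.IH k by (simp add: algebra_simps)
qed simp

lemma integral_linear_stat_square:
  assumes [measurable]: "f \<in> borel_measurable borel"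
    and sq: "integrable P (\<lambda>z. (f z)\<^sup>2)"
  shows "(\<integral>\<omega>. (linear_stat f n (\<lambda>i. Z i \<omega>) - n * (\<integral>z. f z \<partial>P))\<^sup>2 \<partial>S)
           = n * (\<integral>z. (f z - (\<integral>z. f z \<partial>P))\<^sup>2 \<partial>P)"
    and "integrable S (\<lambda>\<omega>. (linear_stat f n (\<lambda>i. Z i \<omega>) - n * (\<integral>z. f z \<partial>P))\<^sup>2)"
proof -
  interpret law: prob_space P by (rule prob_space_law)
  let ?c = "\<lambda>z. f z - (\<integral>z. f z \<partial>P)"
  have int: "integrable P f"
    by (rule integrable_of_square[OF _ sq]) measurable
  have sqc: "integrable P (\<lambda>z. (?c z)\<^sup>2)"
    using int sq by (simp add: power2_diff)
  have eq: "linear_stat f n z - n * (\<integral>z. f z \<partial>P) = linear_stat ?c n z" for z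
    by (simp add: linear_stat_def sum_subtractf)
  show "(\<integral>\<omega>. (linear_stat f n (\<lambda>i. Z i \<omega>) - n * (\<integral>z. f z \<partial>P))\<^sup>2 \<partial>S)
           = n * (\<integral>z. (f z - (\<integral>z. f z \<partial>P))\<^sup>2 \<partial>P)"
    unfolding eq using integral_linear_stat_mult[of ?c ?c n] sqc int
    by (simp add: power2_eq_square law.prob_space[unfolded space_law])
  show "integrable S (\<lambda>\<omega>. (linear_stat f n (\<lambda>i. Z i \<omega>) - n * (\<integral>z. f z \<partial>P))\<^sup>2)"
    unfolding eq by (rule integrable_square_linear_stat) (use sqc in auto)
qed

lemma integral_linear_stat_deviation_le:
  assumes [measurable]: "f \<in> borel_measurable borel"
    and sq: "integrable P (\<lambda>z. (f z)\<^sup>2)"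
  shows "(\<integral>\<omega>. (linear_stat f n (\<lambda>i. Z i \<omega>) - n * (\<integral>z. f z \<partial>P))\<^sup>2 \<partial>S) \<le> n * (\<integral>z. (f z)\<^sup>2 \<partial>P)"
proof -
  interpret law: prob_space P by (rule prob_space_law)
  have "integrable P f"
    by (rule integrable_of_square[OF _ sq]) measurable
  then have "(\<integral>z. (f z - (\<integral>z. f z \<partial>P))\<^sup>2 \<partial>P) = (\<integral>z. (f z)\<^sup>2 \<partial>P) - (\<integral>z. f z \<partial>P)\<^sup>2"
    using law.variance_eq sq by simp
  then show ?thesis
    unfolding integral_linear_stat_square[OF assms]
    by (intro mult_left_mono) auto
qed

text \<open>Variance and squared mean are kept apart because they scale differently: for cluster
  sums the squared mean, of order \<open>(n * pt g)^2\<close>, is the part that can make the total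
  mass diverge.\<close>

lemma integral_linear_stat_square_le:
  assumes [measurable]: "f \<in> borel_measurable borel"
    and sq: "integrable P (\<lambda>z. (f z)\<^sup>2)"
  shows "(\<integral>\<omega>. (linear_stat f n (\<lambda>i. Z i \<omega>))\<^sup>2 \<partial>S)
           \<le> n * (\<integral>z. (f z)\<^sup>2 \<partial>P) + (n * (\<integral>z. f z \<partial>P))\<^sup>2"
proof -
  let ?L = "\<lambda>\<omega>. linear_stat f n (\<lambda>i. Z i \<omega>)" and ?c = "n * (\<integral>z. f z \<partial>P)"
  have int: "integrable P f"
    by (rule integrable_of_square[OF _ sq]) measurable
  have intL: "integrable S ?L" "integrable S (\<lambda>\<omega>. (?L \<omega>)\<^sup>2)"
    using integrable_square_linear_stat[OF assms] int
    by (auto simp: linear_stat_def intro!: Bochner_Integration.integrable_sum integrable_obs)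
  have "expectation ?L = ?c"
    using int unfolding linear_stat_def
    by (subst Bochner_Integration.integral_sum) (auto intro!: integrable_obs simp: integral_obs)
  then have "(\<integral>\<omega>. (?L \<omega>)\<^sup>2 \<partial>S) = (\<integral>\<omega>. (?L \<omega> - ?c)\<^sup>2 \<partial>S) + ?c\<^sup>2"
    using variance_eq[OF intL] by simp
  then show ?thesis
    using integral_linear_stat_deviation_le[OF assms] by simp
qed

text \<open>
  Conditionally on the first \<open>k\<close> observations the increment of \<open>pair_stat\<close> has mean zero, so the
  second moments of the increments add up.
\<close>
lemma
  assumes fin: "finite I" and meas: "\<And>g. g \<in> I \<Longrightarrow> f g \<in> borel_measurable borel"
    and sq: "\<And>g. g \<in> I \<Longrightarrow> integrable P (\<lambda>z. (f g z)\<^sup>2)"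
    and centred: "\<And>g. g \<in> I \<Longrightarrow> (\<integral>z. f g z \<partial>P) = 0" and "k \<le> n"
  shows integrable_pair_stat_square: "integrable S (\<lambda>\<omega>. (pair_stat I b f k (\<lambda>i. Z i \<omega>))\<^sup>2)"
    and integral_pair_stat_square: "(\<integral>\<omega>. (pair_stat I b f k (\<lambda>i. Z i \<omega>))\<^sup>2 \<partial>S)
         = (real k * (real k - 1) / 2)
           * (\<Sum>g\<in>I. \<Sum>g'\<in>I. b g * b g' * (\<integral>z. f g z * f g' z \<partial>P)\<^sup>2)"
proof -
  let ?K = "\<Sum>g\<in>I. \<Sum>g'\<in>I. b g * b g' * (\<integral>z. f g z * f g' z \<partial>P)\<^sup>2"
  have int: "integrable P (f g)" if "g \<in> I" for g
    by (rule integrable_of_square[OF meas sq]) (fact that)+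
  have "integrable S (\<lambda>\<omega>. (pair_stat I b f k (\<lambda>i. Z i \<omega>))\<^sup>2)
    \<and> (\<integral>\<omega>. (pair_stat I b f k (\<lambda>i. Z i \<omega>))\<^sup>2 \<partial>S) = (real k * (real k - 1) / 2) * ?K"
    using \<open>k \<le> n\<close>
  proof (induction k)
    case (Suc k)
    let ?L = "\<lambda>g \<omega>. linear_stat (f g) k (\<lambda>i. Z i \<omega>)" and ?f = "\<lambda>g \<omega>. f g (Z (Suc k) \<omega>)"
    let ?A = "\<lambda>\<omega>. pair_stat I b f k (\<lambda>i. Z i \<omega>)"
    let ?D = "\<lambda>\<omega>. \<Sum>g\<in>I. b g * (?L g \<omega> * ?f g \<omega>)"
    have k: "k < Suc k" "Suc k \<le> n" "k \<le> n" "Suc k \<in> {1..n}"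
      using Suc.prems by auto
    have mA: "?A \<in> borel_measurable S"
      by (rule borel_measurable_pair_stat) (use meas k in auto)
    have mL: "?L g \<in> borel_measurable S" if "g \<in> I" for g
      by (rule borel_measurable_linear_stat) (use meas k that in auto)
    have sqA: "integrable S (\<lambda>\<omega>. (?A \<omega>)\<^sup>2)"
      using Suc.IH k by simp
    have sqL: "integrable S (\<lambda>\<omega>. (?L g \<omega>)\<^sup>2)" if "g \<in> I" for g
      by (rule integrable_square_linear_stat) (use meas sq k that in auto)
    \<comment> \<open>The past \<open>?A * ?L g\<close> is square integrable factor by factor, and
      the new observation enters through the centred \<open>f g\<close>.\<close>
    have AD: "integrable S (\<lambda>\<omega>. (?A \<omega> * ?L g \<omega>) * ?f g \<omega>)
        \<and> (\<integral>\<omega>. (?A \<omega> * ?L g \<omega>) * ?f g \<omega> \<partial>S) = 0" if g: "g \<in> I" for g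
    proof -
      let ?\<phi> = "\<lambda>z. pair_stat I b f k z * linear_stat (f g) k z"
      have \<phi>: "?\<phi> \<in> borel_measurable (PiM {1..k} (\<lambda>_. borel))"
        using meas g by (intro borel_measurable_times borel_measurable_pair_stat_prefix
            borel_measurable_linear_stat_prefix) auto
      have r: "?\<phi> (restrict z {1..k}) = ?\<phi> z" for z
        by (simp only: pair_stat_restrict linear_stat_restrict order_refl)
      have i: "integrable S (\<lambda>\<omega>. ?\<phi> (\<lambda>i. Z i \<omega>))"
        using integrable_mult_of_squares[OF mA mL[OF g] sqA sqL[OF g]] .
      show ?thesis
        using integrable_prefix[OF \<phi> r k(1,2) i int[OF g]]
          integral_prefix[OF \<phi> r k(1,2) i int[OF g]]
        by (simp add: centred g)
    qed
    \<comment> \<open>The covariance of \<open>f g\<close> and \<open>f g'\<close> appears twice,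
      \<open>k\<close> times from the past and once from the new observation, hence its square.
      Adding these \<open>k\<close> over all steps produces \<open>k (k - 1) / 2\<close>.\<close>
    have DD: "integrable S (\<lambda>\<omega>. (?L g \<omega> * ?L g' \<omega>) * (?f g \<omega> * ?f g' \<omega>))
        \<and> (\<integral>\<omega>. (?L g \<omega> * ?L g' \<omega>) * (?f g \<omega> * ?f g' \<omega>) \<partial>S)
           = k * (\<integral>z. f g z * f g' z \<partial>P)\<^sup>2" if g: "g \<in> I" "g' \<in> I" for g g'
    proof -
      let ?\<phi> = "\<lambda>z. linear_stat (f g) k z * linear_stat (f g') k z"
      let ?\<psi> = "\<lambda>z. f g z * f g' z"
      have \<phi>: "?\<phi> \<in> borel_measurable (PiM {1..k} (\<lambda>_. borel))"
        using meas g by (intro borel_measurable_times borel_measurable_linear_stat_prefix) auto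
      have r: "?\<phi> (restrict z {1..k}) = ?\<phi> z" for z
        by (simp only: linear_stat_restrict order_refl)
      have i: "integrable S (\<lambda>\<omega>. ?\<phi> (\<lambda>i. Z i \<omega>))"
        using integrable_mult_of_squares[OF mL[OF g(1)] mL[OF g(2)] sqL[OF g(1)] sqL[OF g(2)]] .
      have j: "integrable P ?\<psi>"
        using integrable_mult_of_squares[of "f g" P "f g'"] meas sq g by simp
      show ?thesis
        using integrable_prefix[OF \<phi> r k(1,2) i j] integral_prefix[OF \<phi> r k(1,2) i j]
          integral_linear_stat_mult[of "f g" "f g'" k] meas sq centred g k
        by (simp add: power2_eq_square)
    qed
    have D2: "(?D \<omega>)\<^sup>2
        = (\<Sum>g\<in>I. \<Sum>g'\<in>I. (b g * b g') * ((?L g \<omega> * ?L g' \<omega>) * (?f g \<omega> * ?f g' \<omega>)))" for \<omega>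
      by (simp add: power2_eq_square sum_product mult_ac)
    have intD2: "integrable S (\<lambda>\<omega>. (?D \<omega>)\<^sup>2)" and ED2: "(\<integral>\<omega>. (?D \<omega>)\<^sup>2 \<partial>S) = k * ?K"
      unfolding D2 using DD by (simp_all add: sum_distrib_left mult_ac)
    have AD2: "?A \<omega> * ?D \<omega> = (\<Sum>g\<in>I. b g * ((?A \<omega> * ?L g \<omega>) * ?f g \<omega>))" for \<omega>
      by (simp add: sum_distrib_left mult_ac)
    have intAD: "integrable S (\<lambda>\<omega>. ?A \<omega> * ?D \<omega>)" and EAD: "(\<integral>\<omega>. ?A \<omega> * ?D \<omega> \<partial>S) = 0"
      unfolding AD2 using AD by simp_all
    have eq: "(pair_stat I b f (Suc k) (\<lambda>i. Z i \<omega>))\<^sup>2 = (?A \<omega>)\<^sup>2 + (?D \<omega>)\<^sup>2 + 2 * (?A \<omega> * ?D \<omega>)" for \<omega>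
      by (simp add: pair_stat_Suc power2_sum)
    show ?case
      unfolding eq using sqA intD2 intAD EAD ED2 Suc.IH k by (simp add: field_simps)
  qed simp
  then show "integrable S (\<lambda>\<omega>. (pair_stat I b f k (\<lambda>i. Z i \<omega>))\<^sup>2)"
    "(\<integral>\<omega>. (pair_stat I b f k (\<lambda>i. Z i \<omega>))\<^sup>2 \<partial>S) = (real k * (real k - 1) / 2) * ?K"
    by auto
qed

end

section \<open>A discrete running variable\<close>

lemma sum_matrix_vector_mult:
  fixes A :: "'i \<Rightarrow> real ^ 'n ^ 'm"
  shows "(\<Sum>i\<in>I. A i) *v v = (\<Sum>i\<in>I. A i *v v)"
  by (induction I rule: infinite_finite_induct) (simp_all add: matrix_vector_mult_add_rdistrib)

text \<open>The Hoeffding decomposition of a squared sum, with \<open>c\<close> in the role of the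
  mean. The diagonal keeps the uncentred squares; the off-diagonal pairs split into a degenerate
  part, a linear part and a constant.\<close>

lemma linear_stat_square:
  fixes f :: "'a \<Rightarrow> real"
  shows "(linear_stat f k z)\<^sup>2
    = linear_stat (\<lambda>v. (f v)\<^sup>2) k z
      + 2 * (\<Sum>j = 1..k. linear_stat (\<lambda>v. f v - c) (j - 1) z * (f (z j) - c))
      + 2 * (real k - 1) * (c * linear_stat (\<lambda>v. f v - c) k z) + real k * (real k - 1) * c\<^sup>2"
proof (induction k)
  case (Suc k)
  have shift: "linear_stat f k z = linear_stat (\<lambda>v. f v - c) k z + k * c"
    by (simp add: linear_stat_def sum_subtractf)
  have "(linear_stat f (Suc k) z)\<^sup>2
      = (linear_stat f k z)\<^sup>2 + 2 * linear_stat f k z * f (z (Suc k)) + (f (z (Suc k)))\<^sup>2"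
    by (simp add: linear_stat_Suc power2_sum)
  also have "2 * linear_stat f k z * f (z (Suc k))
      = 2 * (linear_stat (\<lambda>v. f v - c) k z + k * c) * f (z (Suc k))"
    by (simp only: shift)
  finally show ?case
    unfolding Suc.IH by (simp add: linear_stat_Suc algebra_simps power2_eq_square)
qed simp

lemma linear_stat_sum: "linear_stat (\<lambda>v. \<Sum>g\<in>I. f g v) k z = (\<Sum>g\<in>I. linear_stat (f g) k z)"
  unfolding linear_stat_def by (rule sum.swap)

lemma linear_stat_mult: "linear_stat (\<lambda>v. c * f v) k z = c * linear_stat f k z"
  by (simp add: linear_stat_def sum_distrib_left)

lemma square_sum_three_le: "((a::real) + b + c)\<^sup>2 \<le> 3 * (a\<^sup>2 + b\<^sup>2 + c\<^sup>2)"
proof -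
  have "3 * (a\<^sup>2 + b\<^sup>2 + c\<^sup>2) - (a + b + c)\<^sup>2 = (a - b)\<^sup>2 + (b - c)\<^sup>2 + (a - c)\<^sup>2"
    by (simp add: power2_eq_square algebra_simps)
  moreover have "0 \<le> (a - b)\<^sup>2 + (b - c)\<^sup>2 + (a - c)\<^sup>2"
    by simp
  ultimately show ?thesis
    by linarith
qed

lemma (in prob_space) integral_uniform_measure:
  fixes f :: "'a \<Rightarrow> real"
  assumes [measurable]: "A \<in> sets M" "f \<in> borel_measurable M" and pos: "0 < prob A"
  shows "(\<integral>z. f z \<partial>uniform_measure M A) = (\<integral>z. indicator A z * f z \<partial>M) / prob A"
    and "integrable (uniform_measure M A) f \<longleftrightarrow> integrable M (\<lambda>z. indicator A z * f z)"
proof -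
  have eq: "uniform_measure M A = density M (\<lambda>z. ennreal (indicator A z / prob A))"
    unfolding uniform_measure_def
    by (intro arg_cong[of _ _ "density M"] ext)
      (use pos in \<open>auto simp: emeasure_eq_measure divide_ennreal simp flip: ennreal_1
         split: split_indicator\<close>)
  have "(\<integral>z. f z \<partial>uniform_measure M A) = (\<integral>z. (indicator A z * f z) / prob A \<partial>M)"
    unfolding eq by (subst integral_density) (auto simp: pos less_imp_le)
  then show "(\<integral>z. f z \<partial>uniform_measure M A) = (\<integral>z. indicator A z * f z \<partial>M) / prob A"
    by simp
  have "integrable (uniform_measure M A) f \<longleftrightarrow> integrable M (\<lambda>z. (indicator A z * f z) / prob A)"
    unfolding eq by (subst integrable_density) (auto simp: pos less_imp_le)
  then show "integrable (uniform_measure M A) f \<longleftrightarrow> integrable M (\<lambda>z. indicator A z * f z)"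
    using pos by (simp add: divide_inverse integrable_mult_left_iff)
qed

text \<open>The setting for one sample size, with \<open>m\<close> the normalised regressors.
  \<open>K\<close> and \<open>B\<close> will be the same for all sample sizes while
  \<open>\<rho>\<close>, a bound on the shares of single points in the window, tends to 0. Moments
  are required of the error \<open>u\<close>, which includes the approximation bias.\<close>

locale rd_sample = iid_data S n Z P
  for S :: "'w measure" and n Z P +
  fixes m :: "real \<Rightarrow> real ^ 'n::finite" and e :: "real ^ 'n" and h :: real
    and G :: nat and x :: "nat \<Rightarrow> real" and K B \<rho> :: real
  assumes m_measurable [measurable]: "m \<in> borel_measurable borel"
    and m_bound: "\<bar>t\<bar> \<le> h \<Longrightarrow> norm (m t) \<le> K"
    and integrable_fst: "integrable P fst"
    and inj: "inj_on x {1..G}"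
    and point_pos: "g \<in> {1..G} \<Longrightarrow> 0 < point_prob P (x g)"
    and support: "AE z in P. snd z \<in> x ` {1..G}"
    and Q_invertible: "invertible (Q_pop m h P)"
    and win_pos: "0 < win_prob h P"
    and integrable_u4: "g \<in> window h G x \<Longrightarrow>
      integrable P (\<lambda>z. of_bool (snd z = x g) * (fst z - m (snd z) \<bullet> theta_pop m h P) ^ 4)"
    and integral_u4: "g \<in> window h G x \<Longrightarrow>
      (\<integral>z. of_bool (snd z = x g) * (fst z - m (snd z) \<bullet> theta_pop m h P) ^ 4 \<partial>P)
        \<le> B * point_prob P (x g)"
    and bias_bound: "g \<in> window h G x \<Longrightarrow> \<bar>approx_bias m h P (x g)\<bar> \<le> B"
    and share_bound: "g \<in> window h G x \<Longrightarrow> point_prob P (x g) \<le> \<rho> * win_prob h P"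
    and \<rho>: "0 \<le> \<rho>" "\<rho> \<le> 1" and K: "0 \<le> K" and B: "0 \<le> B"

sublocale rd_sample \<subseteq> law: prob_space P
  by (rule prob_space_law)

context rd_sample
begin

abbreviation "W \<equiv> window h G x"
abbreviation "\<pi> \<equiv> win_prob h P"
abbreviation "pt g \<equiv> point_prob P (x g)"
abbreviation "\<delta> g \<equiv> approx_bias m h P (x g)"
abbreviation "Q \<equiv> Q_pop m h P"
abbreviation "\<theta> \<equiv> theta_pop m h P"
abbreviation "M t \<equiv> win_basis m h t"
abbreviation "X g \<equiv> m (x g)"

definition "err z = fst z - m (snd z) \<bullet> \<theta>"
definition "at_point g z = (of_bool (snd z = x g) :: real)"
definition "score g z = at_point g z * err z"
definition "\<mu> g = pt g * \<delta> g"
definition "q = matrix_inv Q *v e"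
definition "wt g = (q \<bullet> X g)\<^sup>2"

lemma finite_W [simp]: "finite W"
  by (simp add: window_def)

lemma W_subset: "g \<in> W \<Longrightarrow> g \<in> {1..G}"
  by (simp add: window_def)

lemma M_W [simp]: "g \<in> W \<Longrightarrow> M (x g) = X g"
  by (simp add: window_def win_basis_def)

lemma X_bound: "g \<in> W \<Longrightarrow> norm (X g) \<le> K"
  by (auto simp: window_def intro: m_bound)

lemma M_bound: "norm (M t) \<le> K"
  using m_bound[of t] K by (auto simp: win_basis_def)

lemma pt_nonneg: "0 \<le> pt g"
  by (simp add: point_prob_def)

lemma \<pi>_le_1: "\<pi> \<le> 1"
  by (simp add: win_prob_def)

lemma measurable_basic [measurable]:
  "fst \<in> borel_measurable P" "snd \<in> borel_measurable P"
  "fst \<in> borel_measurable (borel :: (real \<times> real) measure)"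
  "snd \<in> borel_measurable (borel :: (real \<times> real) measure)"
proof -
  show "fst \<in> borel_measurable (borel :: (real \<times> real) measure)"
    "snd \<in> borel_measurable (borel :: (real \<times> real) measure)"
    by (intro borel_measurable_continuous_onI continuous_intros)+
  then show "fst \<in> borel_measurable P" "snd \<in> borel_measurable P"
    by (simp_all cong: measurable_cong_sets)
qed

lemma measurable_M [measurable]: "M \<in> borel_measurable borel"
  unfolding win_basis_def[abs_def] by measurable

lemma measurable_err [measurable]: "err \<in> borel_measurable borel"
  unfolding err_def[abs_def] by measurable

lemma measurable_at_point [measurable]: "at_point g \<in> borel_measurable borel"
proof -
  have eq: "at_point g = indicator {z. snd z = x g}"
    by (auto simp: at_point_def split: split_indicator)
  show ?thesis
    unfolding eq
    by (intro borel_measurable_indicator borel_closed closed_Collect_eq continuous_intros)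
qed

lemma measurable_score [measurable]: "score g \<in> borel_measurable borel"
  unfolding score_def[abs_def] by measurable

lemma at_point_square [simp]: "(at_point g z)\<^sup>2 = at_point g z"
  by (simp add: at_point_def)

lemma integral_at_point: "(\<integral>z. at_point g z \<partial>P) = pt g"
  and integrable_at_point: "integrable P (at_point g)"
proof -
  have [simp]: "{z. snd z = x g} \<in> sets P"
    by measurable
  have eq: "at_point g = indicator {z. snd z = x g}"
    by (auto simp: at_point_def split: split_indicator)
  show "(\<integral>z. at_point g z \<partial>P) = pt g" "integrable P (at_point g)"
    unfolding eq by (simp_all add: point_prob_def integrable_indicator_iff law.emeasure_eq_measure)
qed

lemma integrable_point_fst: "integrable P (\<lambda>z. at_point g z * fst z)"
  by (rule Bochner_Integration.integrable_bound[OF integrable_fst])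
    (auto simp: at_point_def)

lemma at_point_distinct:
  assumes "g \<in> W" "g' \<in> W" "g \<noteq> g'"
  shows "at_point g z * at_point g' z = 0"
  using assms inj W_subset by (auto simp: at_point_def dest: inj_onD)

lemma score_distinct:
  assumes "g \<in> W" "g' \<in> W" "g \<noteq> g'"
  shows "score g z * score g' z = 0"
  using at_point_distinct[OF assms, of z] by (auto simp: score_def)

lemma cond_mean_eq:
  assumes "g \<in> W"
  shows "cond_mean P (x g) = (\<integral>z. at_point g z * fst z \<partial>P) / pt g"
proof -
  have [measurable]: "{z. snd z = x g} \<in> sets P"
    by measurable
  have "(\<integral>z. fst z \<partial>uniform_measure P {z. snd z = x g})
      = (\<integral>z. indicator {z. snd z = x g} z * fst z \<partial>P) / law.prob {z. snd z = x g}"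
    using point_pos[OF W_subset[OF assms]]
    by (intro law.integral_uniform_measure) (auto simp: point_prob_def)
  also have "(\<lambda>z. indicator {z. snd z = x g} z * fst z) = (\<lambda>z. at_point g z * fst z)"
    by (auto simp: at_point_def split: split_indicator)
  finally show ?thesis
    by (simp add: cond_mean_def cond_law_def point_prob_def)
qed

lemma score_eq: "score g z = at_point g z * fst z - (X g \<bullet> \<theta>) * at_point g z"
  by (auto simp: score_def at_point_def err_def)

lemma integrable_score: "integrable P (score g)"
  unfolding score_eq using integrable_point_fst integrable_at_point by simp

lemma integral_score:
  assumes "g \<in> W"
  shows "(\<integral>z. score g z \<partial>P) = \<mu> g"
  using point_pos[OF W_subset[OF assms]] integrable_point_fst[of g] integrable_at_point[of g]
  unfolding score_eq \<mu>_def approx_bias_def cond_mean_eq[OF assms]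
  by (simp add: integral_at_point field_simps)

lemma score_power4: "(score g z) ^ 4 = of_bool (snd z = x g) * err z ^ 4"
  by (simp add: score_def at_point_def)

lemma
  assumes "g \<in> W"
  shows integrable_score4: "integrable P (\<lambda>z. (score g z) ^ 4)"
    and integral_score4: "(\<integral>z. (score g z) ^ 4 \<partial>P) \<le> B * pt g"
  using integrable_u4[OF assms] integral_u4[OF assms] by (simp_all add: score_power4 err_def)

text \<open>Comparing with \<open>1 + t^4\<close> on the event that the observation sits at the
  point leaves a second moment proportional to \<open>pt g\<close>; this is the origin of the
  constant \<open>1 + B\<close>.\<close>

lemma score2_le: "(score g z)\<^sup>2 \<le> at_point g z + (score g z) ^ 4"
proof -
  have "t\<^sup>2 \<le> 1 + t ^ 4" for t :: real
  proof -
    have "2 * t\<^sup>2 \<le> t ^ 4 + 1"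
      using sum_squares_bound[of "t\<^sup>2" 1] by (simp flip: power_mult)
    then show ?thesis
      using zero_le_power2[of t] by linarith
  qed
  then show ?thesis
    by (simp add: score_def at_point_def)
qed

lemma
  assumes "g \<in> W"
  shows integrable_score2: "integrable P (\<lambda>z. (score g z)\<^sup>2)"
    and integral_score2: "(\<integral>z. (score g z)\<^sup>2 \<partial>P) \<le> (1 + B) * pt g"
proof -
  have int: "integrable P (\<lambda>z. at_point g z + (score g z) ^ 4)"
    using integrable_at_point integrable_score4[OF assms] by simp
  show sq: "integrable P (\<lambda>z. (score g z)\<^sup>2)"
    by (rule Bochner_Integration.integrable_bound[OF int])
      (use score2_le in \<open>auto simp: at_point_def\<close>)
  have "(\<integral>z. (score g z)\<^sup>2 \<partial>P) \<le> (\<integral>z. at_point g z + (score g z) ^ 4 \<partial>P)"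
    by (intro integral_mono sq int score2_le)
  then show "(\<integral>z. (score g z)\<^sup>2 \<partial>P) \<le> (1 + B) * pt g"
    using integrable_at_point[of g] integrable_score4[OF assms] integral_score4[OF assms]
    by (simp add: integral_at_point algebra_simps)
qed

lemma \<mu>_square_le:
  assumes "g \<in> W"
  shows "(\<mu> g)\<^sup>2 \<le> B\<^sup>2 * (pt g)\<^sup>2"
  using power_mono[OF bias_bound[OF assms], of 2]
  by (auto simp: \<mu>_def power_mult_distrib mult.commute[of _ "(\<delta> g)\<^sup>2"] intro: mult_right_mono)

text \<open>Discreteness enters here: almost surely the window is a disjoint union of atoms, so
  integrals over the window become finite sums over \<open>W\<close>.\<close>

lemma AE_window: "AE z in P. of_bool (\<bar>snd z\<bar> \<le> h) = (\<Sum>g\<in>W. at_point g z)"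
  using support
proof eventually_elim
  case (elim z)
  then obtain g where g: "g \<in> {1..G}" "snd z = x g"
    by auto
  have "at_point g' z = of_bool (g' = g)" if "g' \<in> W" for g'
    using inj g W_subset[OF that] by (auto simp: at_point_def dest: inj_onD)
  then have "(\<Sum>g'\<in>W. at_point g' z) = (\<Sum>g'\<in>W. of_bool (g' = g))"
    by simp
  also have "\<dots> = of_bool (g \<in> W)"
    by simp
  finally show ?case
    using g by (simp add: window_def)
qed

lemma \<pi>_eq_sum: "\<pi> = (\<Sum>g\<in>W. pt g)"
proof -
  have [measurable]: "{z. \<bar>snd z\<bar> \<le> h} \<in> sets P"
    by measurable
  have "\<pi> = (\<integral>z. indicator {z. \<bar>snd z\<bar> \<le> h} z \<partial>P)"
    by (simp add: win_prob_def)
  also have "\<dots> = (\<integral>z. (\<Sum>g\<in>W. at_point g z) \<partial>P)"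
    by (rule integral_cong_AE) (use AE_window in \<open>auto simp: indicator_def\<close>)
  finally show ?thesis
    using integrable_at_point by (simp add: integral_at_point)
qed

text \<open>The shares \<open>pt g / \<pi>\<close> sum to 1 and none exceeds \<open>\<rho>\<close>,
  so their squares sum to at most \<open>\<rho>\<close>. This converts the absence of dominating
  points into smallness of quadratic terms.\<close>

lemma sum_pt_square_le: "(\<Sum>g\<in>W. (pt g)\<^sup>2) \<le> \<rho> * \<pi>\<^sup>2"
proof -
  have "(\<Sum>g\<in>W. (pt g)\<^sup>2) \<le> (\<Sum>g\<in>W. (\<rho> * \<pi>) * pt g)"
    unfolding power2_eq_square
    by (intro sum_mono mult_right_mono share_bound pt_nonneg)
  also have "\<dots> = (\<rho> * \<pi>) * \<pi>"
    by (subst (2) \<pi>_eq_sum) (simp add: sum_distrib_left)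
  finally show ?thesis
    by (simp add: power2_eq_square mult.assoc)
qed

lemma AE_outer_window:
  "AE z in P. c z *\<^sub>R outer (M (snd z)) (M (snd z))
     = (\<Sum>g\<in>W. (at_point g z * c z) *\<^sub>R outer (X g) (X g))"
  using AE_window
proof eventually_elim
  case (elim z)
  have "(\<Sum>g\<in>W. (at_point g z * c z) *\<^sub>R outer (X g) (X g))
      = (\<Sum>g\<in>W. (at_point g z * c z) *\<^sub>R outer (M (snd z)) (M (snd z)))"
    by (intro sum.cong refl) (auto simp: at_point_def)
  also have "\<dots> = ((\<Sum>g\<in>W. at_point g z) * c z) *\<^sub>R outer (M (snd z)) (M (snd z))"
    by (simp add: scaleR_left.sum sum_distrib_right)
  also have "\<dots> = c z *\<^sub>R outer (M (snd z)) (M (snd z))"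
    unfolding elim[symmetric] by (auto simp: win_basis_def outer_def vec_eq_iff)
  finally show ?case ..
qed

lemma integral_outer_window:
  assumes [measurable]: "c \<in> borel_measurable borel"
    and "\<And>g. g \<in> W \<Longrightarrow> integrable P (\<lambda>z. at_point g z * c z)"
  shows "(\<integral>z. c z *\<^sub>R outer (M (snd z)) (M (snd z)) \<partial>P)
    = (\<Sum>g\<in>W. (\<integral>z. at_point g z * c z \<partial>P) *\<^sub>R outer (X g) (X g))"
proof -
  have "(\<integral>z. c z *\<^sub>R outer (M (snd z)) (M (snd z)) \<partial>P)
      = (\<integral>z. (\<Sum>g\<in>W. (at_point g z * c z) *\<^sub>R outer (X g) (X g)) \<partial>P)"
    by (rule integral_cong_AE) (use AE_outer_window in auto)
  also have "\<dots> = (\<Sum>g\<in>W. (\<integral>z. at_point g z * c z \<partial>P) *\<^sub>R outer (X g) (X g))"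
    using assms by (subst Bochner_Integration.integral_sum) auto
  finally show ?thesis .
qed

lemma Q_eq: "Q = (\<Sum>g\<in>W. pt g *\<^sub>R outer (X g) (X g)) /\<^sub>R \<pi>"
  using integral_outer_window[of "\<lambda>_. 1"] integrable_at_point
  by (simp add: Q_pop_def integral_at_point)

lemma Omega_eq:
  "Omega_pop m h P = (\<Sum>g\<in>W. (\<integral>z. (score g z)\<^sup>2 \<partial>P) *\<^sub>R outer (X g) (X g)) /\<^sub>R \<pi>"
proof -
  have sq: "at_point g z * (err z)\<^sup>2 = (score g z)\<^sup>2" for g z
    by (simp add: score_def at_point_def)
  show ?thesis
    using integral_outer_window[of "\<lambda>z. (err z)\<^sup>2"] integrable_score2
    by (simp add: Omega_pop_def sq flip: err_def)
qed

lemma transpose_Q: "transpose Q = Q"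
  by (simp add: Q_eq transpose_def outer_def vec_eq_iff mult_ac)

lemma inner_e_matrix_inv: "e \<bullet> (matrix_inv Q *v v) = q \<bullet> v"
  unfolding q_def
  by (metis Q_invertible inner_matrix_vector_transpose matrix_inv_transpose transpose_Q)

lemma AE_basis_window:
  "AE z in P. c z *\<^sub>R M (snd z) = (\<Sum>g\<in>W. (at_point g z * c z) *\<^sub>R X g)"
  using AE_window
proof eventually_elim
  case (elim z)
  have "(\<Sum>g\<in>W. (at_point g z * c z) *\<^sub>R X g) = (\<Sum>g\<in>W. (at_point g z * c z) *\<^sub>R M (snd z))"
    by (intro sum.cong refl) (auto simp: at_point_def)
  also have "\<dots> = ((\<Sum>g\<in>W. at_point g z) * c z) *\<^sub>R M (snd z)"
    by (simp add: scaleR_left.sum sum_distrib_right)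
  also have "\<dots> = c z *\<^sub>R M (snd z)"
    unfolding elim[symmetric] by (auto simp: win_basis_def)
  finally show ?case ..
qed

lemma integral_fst_M:
  "(\<integral>z. fst z *\<^sub>R M (snd z) \<partial>P) = (\<Sum>g\<in>W. (\<integral>z. at_point g z * fst z \<partial>P) *\<^sub>R X g)"
proof -
  have "(\<integral>z. fst z *\<^sub>R M (snd z) \<partial>P) = (\<integral>z. (\<Sum>g\<in>W. (at_point g z * fst z) *\<^sub>R X g) \<partial>P)"
    by (rule integral_cong_AE) (use AE_basis_window in auto)
  then show ?thesis
    using integrable_point_fst by (subst (asm) Bochner_Integration.integral_sum) auto
qed

text \<open>First-order condition of the population regression. A single cluster mean
  \<open>\<mu> g\<close> may be nonzero under misspecification, but weighted by the regressors the
  means cancel.\<close>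

lemma normal_equations: "(\<Sum>g\<in>W. \<mu> g *\<^sub>R X g) = 0"
proof -
  have "Q *v \<theta> = (\<integral>z. fst z *\<^sub>R M (snd z) \<partial>P) /\<^sub>R \<pi>"
    unfolding theta_pop_def
    by (simp add: matrix_vector_mul_assoc matrix_mul_inv Q_invertible)
  moreover have "Q *v \<theta> = (\<Sum>g\<in>W. (pt g * (X g \<bullet> \<theta>)) *\<^sub>R X g) /\<^sub>R \<pi>"
    unfolding Q_eq
    by (simp add: scaleR_matrix_vector_assoc[symmetric] outer_mult_vec sum_matrix_vector_mult)
  ultimately have "(\<Sum>g\<in>W. (pt g * (X g \<bullet> \<theta>)) *\<^sub>R X g)
      = (\<Sum>g\<in>W. (\<integral>z. at_point g z * fst z \<partial>P) *\<^sub>R X g)"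
    using win_pos by (simp add: integral_fst_M)
  moreover have "\<mu> g = (\<integral>z. at_point g z * fst z \<partial>P) - pt g * (X g \<bullet> \<theta>)" if "g \<in> W" for g
    unfolding integral_score[OF that, symmetric] score_eq
    using integrable_point_fst[of g] integrable_at_point[of g] by (simp add: integral_at_point)
  ultimately show ?thesis
    by (simp add: scaleR_diff_left sum_subtractf)
qed

text \<open>A cluster sum has second moment \<open>n * E(score^2) + n * (n - 1) * \<mu>^2\<close>,
  so for \<open>N = n\<close> the right side is the mean of the weighted squared cluster sums
  divided by \<open>n\<close>. The factor \<open>N - 1\<close> of the target counts ordered pairs
  per observation.\<close>

lemma crv_pop_eq:
  "\<pi> * crv_pop m e h P G x N
     = (\<Sum>g\<in>W. wt g * (\<integral>z. (score g z)\<^sup>2 \<partial>P)) + (real N - 1) * (\<Sum>g\<in>W. wt g * (\<mu> g)\<^sup>2)"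
proof -
  have quad: "q \<bullet> (outer v v *v q) = (q \<bullet> v)\<^sup>2" for v
    by (simp add: outer_mult_vec power2_eq_square inner_commute)
  \<comment> \<open>Points outside the window have zero windowed regressor; inside,
    \<open>pt * \<delta>^2\<close> times the share \<open>pt / \<pi>\<close> is
    \<open>\<mu>^2 / \<pi>\<close>.\<close>
  have points: "(\<Sum>g = 1..G. (pt g * (\<delta> g)\<^sup>2) *\<^sub>R Q_point m h P (x g))
      = (\<Sum>g\<in>W. (\<mu> g)\<^sup>2 *\<^sub>R outer (X g) (X g)) /\<^sub>R \<pi>"
  proof -
    have "(\<Sum>g = 1..G. (pt g * (\<delta> g)\<^sup>2) *\<^sub>R Q_point m h P (x g))
        = (\<Sum>g\<in>W. (pt g * (\<delta> g)\<^sup>2) *\<^sub>R Q_point m h P (x g))"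
      by (rule sum.mono_neutral_right)
        (auto simp: window_def Q_point_def win_basis_def outer_def vec_eq_iff)
    also have "\<dots> = (\<Sum>g\<in>W. (\<mu> g)\<^sup>2 *\<^sub>R outer (X g) (X g) /\<^sub>R \<pi>)"
      by (intro sum.cong refl) (simp add: Q_point_def \<mu>_def power2_eq_square field_simps)
    finally show ?thesis
      by (simp add: scaleR_right.sum)
  qed
  have "crv_pop m e h P G x N
      = q \<bullet> ((Omega_pop m h P
          + (real N - 1) *\<^sub>R ((\<Sum>g\<in>W. (\<mu> g)\<^sup>2 *\<^sub>R outer (X g) (X g)) /\<^sub>R \<pi>)) *v q)"
    unfolding crv_pop_def points
    by (simp add: inner_e_matrix_inv q_def flip: matrix_vector_mul_assoc)
  also have "\<dots> = inverse \<pi> * (\<Sum>g\<in>W. (\<integral>z. (score g z)\<^sup>2 \<partial>P) * wt g)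
      + (real N - 1) * (inverse \<pi> * (\<Sum>g\<in>W. (\<mu> g)\<^sup>2 * wt g))"
    unfolding Omega_eq
    by (simp add: matrix_vector_mult_add_rdistrib scaleR_matrix_vector_assoc[symmetric]
        sum_matrix_vector_mult inner_add_right inner_sum_right quad wt_def)
  finally have eq: "crv_pop m e h P G x N
      = inverse \<pi> * (\<Sum>g\<in>W. (\<integral>z. (score g z)\<^sup>2 \<partial>P) * wt g)
        + (real N - 1) * (inverse \<pi> * (\<Sum>g\<in>W. (\<mu> g)\<^sup>2 * wt g))" .
  have "\<pi> * (inverse \<pi> * a + c * (inverse \<pi> * b)) = a + c * b" for a b c :: real
    using win_pos by (simp add: field_simps)
  then show ?thesis
    unfolding eq by (simp only: mult.commute[of "wt _"])
qed

end

section \<open>Moment bounds for the sample statistics\<close>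

context rd_sample
begin

abbreviation "zs \<omega> \<equiv> (\<lambda>i. Z i \<omega>)"

definition "nw = real n * \<pi>"

lemma nw_pos: "0 < nw"
  using win_pos sample_size by (simp add: nw_def)

text \<open>Chebyshev input for the window count, the Gram matrix and the score. Since the second
  moment is of order \<open>\<pi>\<close>, not merely bounded, the error is governed by the expected
  window count \<open>nw\<close>.\<close>

lemma
  assumes F: "F \<in> borel_measurable borel" "integrable P (\<lambda>z. (F z)\<^sup>2)"
    and mean: "(\<integral>z. F z \<partial>P) = \<pi> * c" and second: "(\<integral>z. (F z)\<^sup>2 \<partial>P) \<le> \<beta> * \<pi>"
  shows integrable_scaled_deviation: "integrable S (\<lambda>\<omega>. (linear_stat F n (zs \<omega>) / nw - c)\<^sup>2)"
    and integral_scaled_deviation: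
      "(\<integral>\<omega>. (linear_stat F n (zs \<omega>) / nw - c)\<^sup>2 \<partial>S) \<le> \<beta> / nw"
proof -
  have eq: "(linear_stat F n (zs \<omega>) / nw - c)\<^sup>2
      = (linear_stat F n (zs \<omega>) - n * (\<integral>z. F z \<partial>P))\<^sup>2 / nw\<^sup>2" for \<omega>
    using win_pos sample_size unfolding mean nw_def
    by (simp add: divide_simps power2_eq_square) (simp add: algebra_simps)
  show "integrable S (\<lambda>\<omega>. (linear_stat F n (zs \<omega>) / nw - c)\<^sup>2)"
    unfolding eq using integral_linear_stat_square(2)[OF F] by simp
  have "(\<integral>\<omega>. (linear_stat F n (zs \<omega>) / nw - c)\<^sup>2 \<partial>S)
      = (\<integral>\<omega>. (linear_stat F n (zs \<omega>) - n * (\<integral>z. F z \<partial>P))\<^sup>2 \<partial>S) / nw\<^sup>2"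
    unfolding eq by simp
  also have "\<dots> \<le> n * (\<beta> * \<pi>) / nw\<^sup>2"
    using order_trans[OF integral_linear_stat_deviation_le[OF F] mult_left_mono[OF second]]
    by (intro divide_right_mono) auto
  also have "\<dots> = \<beta> / nw"
    using nw_pos by (simp add: nw_def power2_eq_square field_simps)
  finally show "(\<integral>\<omega>. (linear_stat F n (zs \<omega>) / nw - c)\<^sup>2 \<partial>S) \<le> \<beta> / nw" .
qed

text \<open>Summed over clusters, the variances contribute \<open>\<beta>\<close>, while the squared
  means contribute \<open>n^2\<close> times the sum of \<open>pt^2\<close>, which the share bound
  turns into \<open>nw * \<rho>\<close> after division by \<open>nw\<close>.\<close>

lemma
  assumes F: "\<And>g. g \<in> W \<Longrightarrow> F g \<in> borel_measurable borel"
      "\<And>g. g \<in> W \<Longrightarrow> integrable P (\<lambda>z. (F g z)\<^sup>2)"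
    and second: "\<And>g. g \<in> W \<Longrightarrow> (\<integral>z. (F g z)\<^sup>2 \<partial>P) \<le> \<beta> * pt g"
    and mean: "\<And>g. g \<in> W \<Longrightarrow> (\<integral>z. F g z \<partial>P)\<^sup>2 \<le> \<gamma> * (pt g)\<^sup>2" and "0 \<le> \<gamma>"
  shows integrable_cluster_mass:
      "integrable S (\<lambda>\<omega>. (\<Sum>g\<in>W. (linear_stat (F g) n (zs \<omega>))\<^sup>2) / nw)"
    and integral_cluster_mass:
      "(\<integral>\<omega>. (\<Sum>g\<in>W. (linear_stat (F g) n (zs \<omega>))\<^sup>2) / nw \<partial>S) \<le> \<beta> + \<gamma> * (nw * \<rho>)"
proof -
  have int: "integrable S (\<lambda>\<omega>. (linear_stat (F g) n (zs \<omega>))\<^sup>2)" if "g \<in> W" for g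
    by (rule integrable_square_linear_stat) (use F that in auto)
  show "integrable S (\<lambda>\<omega>. (\<Sum>g\<in>W. (linear_stat (F g) n (zs \<omega>))\<^sup>2) / nw)"
    using int by simp
  have "(\<integral>\<omega>. (linear_stat (F g) n (zs \<omega>))\<^sup>2 \<partial>S) \<le> n * (\<beta> * pt g) + (real n)\<^sup>2 * (\<gamma> * (pt g)\<^sup>2)"
    if g: "g \<in> W" for g
    using integral_linear_stat_square_le[OF F[OF g]] mult_left_mono[OF second[OF g], of n]
      mult_left_mono[OF mean[OF g], of "(real n)\<^sup>2"]
    by (simp add: power_mult_distrib)
  then have "(\<integral>\<omega>. (\<Sum>g\<in>W. (linear_stat (F g) n (zs \<omega>))\<^sup>2) \<partial>S)
      \<le> (\<Sum>g\<in>W. n * (\<beta> * pt g) + (real n)\<^sup>2 * (\<gamma> * (pt g)\<^sup>2))"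
    using int by (simp add: sum_mono)
  also have "\<dots> = n * \<beta> * \<pi> + (real n)\<^sup>2 * \<gamma> * (\<Sum>g\<in>W. (pt g)\<^sup>2)"
    unfolding \<pi>_eq_sum by (simp add: sum.distrib sum_distrib_left mult.assoc)
  also have "\<dots> \<le> n * \<beta> * \<pi> + (real n)\<^sup>2 * \<gamma> * (\<rho> * \<pi>\<^sup>2)"
    using \<open>0 \<le> \<gamma>\<close> by (intro add_left_mono mult_left_mono sum_pt_square_le) auto
  also have "\<dots> = (\<beta> + \<gamma> * (nw * \<rho>)) * nw"
    by (simp add: nw_def power2_eq_square algebra_simps)
  finally show "(\<integral>\<omega>. (\<Sum>g\<in>W. (linear_stat (F g) n (zs \<omega>))\<^sup>2) / nw \<partial>S)
      \<le> \<beta> + \<gamma> * (nw * \<rho>)"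
    using nw_pos by (simp add: pos_divide_le_eq)
qed

text \<open>These statistics are normalised by the nonrandom \<open>nw\<close> instead of the random
  window count, which keeps their moments explicit; \<open>count_stat\<close> is the ratio of the
  two normalisations.\<close>

definition "count_stat z = win_count h n z / nw"
definition "gram_stat z j k = linear_stat (\<lambda>v :: real \<times> real. M (snd v) $ j * M (snd v) $ k) n z / nw"
definition "score_stat z j = linear_stat (\<lambda>v. err v * M (snd v) $ j) n z / nw"
definition "score_mass z = (\<Sum>g\<in>W. (linear_stat (score g) n z)\<^sup>2) / nw"
definition "count_mass z = (\<Sum>g\<in>W. (linear_stat (at_point g) n z)\<^sup>2) / nw"
definition "main_stat z = (\<Sum>g\<in>W. wt g * (linear_stat (score g) n z)\<^sup>2)"

abbreviation "T \<equiv> crv_pop m e h P G x n"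

lemma
  shows integrable_count_stat: "integrable S (\<lambda>\<omega>. (count_stat (zs \<omega>) - 1)\<^sup>2)"
    and integral_count_stat: "(\<integral>\<omega>. (count_stat (zs \<omega>) - 1)\<^sup>2 \<partial>S) \<le> 1 / nw"
proof -
  let ?F = "\<lambda>v :: real \<times> real. of_bool (\<bar>snd v\<bar> \<le> h) :: real"
  have int: "integrable P ?F"
    by (rule law.integrable_const_bound[of _ 1]) auto
  have mean: "(\<integral>v. ?F v \<partial>P) = \<pi>"
  proof -
    have "(\<integral>v. ?F v \<partial>P) = (\<integral>z. (\<Sum>g\<in>W. at_point g z) \<partial>P)"
      by (rule integral_cong_AE) (use AE_window in auto)
    then show ?thesis
      using integrable_at_point by (simp add: integral_at_point \<pi>_eq_sum)
  qed
  have eq: "count_stat z = linear_stat ?F n z / nw" for z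
    by (simp add: count_stat_def win_count_def linear_stat_def)
  have sq: "(?F v)\<^sup>2 = ?F v" for v
    by simp
  show "integrable S (\<lambda>\<omega>. (count_stat (zs \<omega>) - 1)\<^sup>2)"
    unfolding eq by (rule integrable_scaled_deviation[where \<beta>=1]) (use int mean sq in auto)
  show "(\<integral>\<omega>. (count_stat (zs \<omega>) - 1)\<^sup>2 \<partial>S) \<le> 1 / nw"
    unfolding eq by (rule integral_scaled_deviation) (use int mean sq in auto)
qed

lemma measurable_M_component [measurable]:
  "(\<lambda>v :: real \<times> real. M (snd v) $ j) \<in> borel_measurable borel"
  by (rule borel_measurable_vec_nth) (rule measurable_compose[OF measurable_basic(4) measurable_M])

lemma M_component: "\<bar>M t $ j\<bar> \<le> K"
  using component_le_norm_cart[of "M t" j] M_bound[of t] by linarith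

lemma X_component: "g \<in> W \<Longrightarrow> \<bar>X g $ j\<bar> \<le> K"
  using M_component[of "x g" j] by simp

lemma AE_product_window:
  "AE z in P. c z * (M (snd z) $ j * M (snd z) $ k)
     = (\<Sum>g\<in>W. (at_point g z * c z) * (X g $ j * X g $ k))"
  using AE_outer_window[of c]
proof eventually_elim
  case (elim z)
  then have "(c z *\<^sub>R outer (M (snd z)) (M (snd z))) $ j $ k
      = (\<Sum>g\<in>W. (at_point g z * c z) *\<^sub>R outer (X g) (X g)) $ j $ k"
    by simp
  then show ?case
    by (simp add: outer_def)
qed

lemma
  shows integrable_gram_stat: "integrable S (\<lambda>\<omega>. (gram_stat (zs \<omega>) j k - Q $ j $ k)\<^sup>2)"
    and integral_gram_stat: "(\<integral>\<omega>. (gram_stat (zs \<omega>) j k - Q $ j $ k)\<^sup>2 \<partial>S) \<le> K ^ 4 / nw"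
proof -
  let ?F = "\<lambda>v :: real \<times> real. M (snd v) $ j * M (snd v) $ k"
  have bound: "\<bar>?F v\<bar> \<le> K\<^sup>2" for v
    using mult_mono[OF M_component[of "snd v" j] M_component[of "snd v" k]] K
    by (simp add: abs_mult power2_eq_square)
  have meas: "?F \<in> borel_measurable borel"
    by (intro borel_measurable_times measurable_M_component)
  have int: "integrable P (\<lambda>v. (?F v)\<^sup>2)"
    using power_mono[OF bound, of _ 2]
    by (intro law.integrable_const_bound[of _ "K ^ 4"]) (auto simp flip: power_mult)
  have "(\<integral>v. ?F v \<partial>P) = (\<integral>z. (\<Sum>g\<in>W. at_point g z * (X g $ j * X g $ k)) \<partial>P)"
    by (rule integral_cong_AE) (use AE_product_window[of "\<lambda>_. 1" j k] in auto)
  also have "\<dots> = (\<Sum>g\<in>W. pt g * (X g $ j * X g $ k))"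
    using integrable_at_point by (simp add: integral_at_point)
  also have "\<dots> = \<pi> * Q $ j $ k"
    using win_pos by (simp add: Q_eq outer_def)
  finally have mean: "(\<integral>v. ?F v \<partial>P) = \<pi> * Q $ j $ k" .
  have "(\<integral>v. (?F v)\<^sup>2 \<partial>P) \<le> (\<integral>v. K ^ 4 * (\<Sum>g\<in>W. at_point g v) \<partial>P)"
  proof (rule integral_mono_AE)
    show "integrable P (\<lambda>v. K ^ 4 * (\<Sum>g\<in>W. at_point g v))"
      using integrable_at_point by simp
    show "AE v in P. (?F v)\<^sup>2 \<le> K ^ 4 * (\<Sum>g\<in>W. at_point g v)"
      using AE_window
    proof eventually_elim
      case (elim v)
      have "(?F v)\<^sup>2 \<le> K ^ 4"
        using power_mono[OF bound[of v], of 2] by (simp flip: power_mult)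
      then show ?case
        unfolding elim[symmetric] by (cases "\<bar>snd v\<bar> \<le> h") (auto simp: win_basis_def)
    qed
  qed (rule int)
  also have "\<dots> = K ^ 4 * \<pi>"
    using integrable_at_point by (simp add: integral_at_point \<pi>_eq_sum)
  finally have second: "(\<integral>v. (?F v)\<^sup>2 \<partial>P) \<le> K ^ 4 * \<pi>" .
  show "integrable S (\<lambda>\<omega>. (gram_stat (zs \<omega>) j k - Q $ j $ k)\<^sup>2)"
    "(\<integral>\<omega>. (gram_stat (zs \<omega>) j k - Q $ j $ k)\<^sup>2 \<partial>S) \<le> K ^ 4 / nw"
    unfolding gram_stat_def
    using integrable_scaled_deviation[OF meas int mean second]
      integral_scaled_deviation[OF meas int mean second] by auto
qed

lemma
  shows integrable_score_stat: "integrable S (\<lambda>\<omega>. (score_stat (zs \<omega>) j)\<^sup>2)"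
    and integral_score_stat: "(\<integral>\<omega>. (score_stat (zs \<omega>) j)\<^sup>2 \<partial>S) \<le> K\<^sup>2 * (1 + B) / nw"
proof -
  let ?F = "\<lambda>v. err v * M (snd v) $ j"
  have meas: "?F \<in> borel_measurable borel"
    by measurable
  have AE2: "AE v in P. (?F v)\<^sup>2 = (\<Sum>g\<in>W. (score g v)\<^sup>2 * (X g $ j)\<^sup>2)"
    using AE_product_window[of "\<lambda>v. (err v)\<^sup>2" j j]
    by eventually_elim
      (simp add: score_def power_mult_distrib flip: power2_eq_square)
  have int_sum: "integrable P (\<lambda>v. \<Sum>g\<in>W. (score g v)\<^sup>2 * (X g $ j)\<^sup>2)"
    using integrable_score2 by simp
  have int: "integrable P (\<lambda>v. (?F v)\<^sup>2)"
    using AE2 by (subst integrable_cong_AE[OF _ _ AE2]) (auto intro: int_sum)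
  have "(\<integral>v. ?F v \<partial>P) = (\<integral>z. (\<Sum>g\<in>W. score g z *\<^sub>R X g $ j) \<partial>P)"
  proof (rule integral_cong_AE)
    show "AE v in P. ?F v = (\<Sum>g\<in>W. score g v *\<^sub>R X g $ j)"
      using AE_basis_window[of err]
    proof eventually_elim
      case (elim v)
      then have "(err v *\<^sub>R M (snd v)) $ j = (\<Sum>g\<in>W. (at_point g v * err v) *\<^sub>R X g) $ j"
        by simp
      then show ?case
        by (simp add: score_def)
    qed
  qed auto
  also have "\<dots> = (\<Sum>g\<in>W. \<mu> g *\<^sub>R X g) $ j"
    using integrable_score by (simp add: integral_score)
  \<comment> \<open>The normal equations centre the total score. The form \<open>\<pi> * 0\<close>
    fits the general deviation bound with \<open>c = 0\<close>.\<close>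
  finally have mean: "(\<integral>v. ?F v \<partial>P) = \<pi> * 0"
    by (simp add: normal_equations)
  have "(\<integral>v. (?F v)\<^sup>2 \<partial>P) = (\<integral>v. (\<Sum>g\<in>W. (score g v)\<^sup>2 * (X g $ j)\<^sup>2) \<partial>P)"
    by (rule integral_cong_AE) (use AE2 in auto)
  also have "\<dots> = (\<Sum>g\<in>W. (\<integral>v. (score g v)\<^sup>2 \<partial>P) * (X g $ j)\<^sup>2)"
    using integrable_score2 by simp
  also have "\<dots> \<le> (\<Sum>g\<in>W. ((1 + B) * pt g) * K\<^sup>2)"
    using X_component power_mono[OF X_component, of _ _ 2] B pt_nonneg
    by (intro sum_mono mult_mono integral_score2) auto
  also have "\<dots> = K\<^sup>2 * (1 + B) * \<pi>"
    by (simp add: \<pi>_eq_sum sum_distrib_left mult_ac)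
  finally have second: "(\<integral>v. (?F v)\<^sup>2 \<partial>P) \<le> K\<^sup>2 * (1 + B) * \<pi>" .
  show "integrable S (\<lambda>\<omega>. (score_stat (zs \<omega>) j)\<^sup>2)"
    "(\<integral>\<omega>. (score_stat (zs \<omega>) j)\<^sup>2 \<partial>S) \<le> K\<^sup>2 * (1 + B) / nw"
    using integrable_scaled_deviation[OF meas int mean second]
      integral_scaled_deviation[OF meas int mean second] by (auto simp: score_stat_def)
qed

lemma
  shows integrable_score_mass: "integrable S (\<lambda>\<omega>. score_mass (zs \<omega>))"
    and integral_score_mass: "(\<integral>\<omega>. score_mass (zs \<omega>) \<partial>S) \<le> (1 + B) + B\<^sup>2 * (nw * \<rho>)"
proof -
  note bounds = integrable_score2 integral_score2 \<mu>_square_le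
  show "integrable S (\<lambda>\<omega>. score_mass (zs \<omega>))"
    unfolding score_mass_def
    by (rule integrable_cluster_mass[where \<beta>="1 + B" and \<gamma>="B\<^sup>2"])
      (use bounds in \<open>simp_all add: integral_score\<close>)
  show "(\<integral>\<omega>. score_mass (zs \<omega>) \<partial>S) \<le> (1 + B) + B\<^sup>2 * (nw * \<rho>)"
    unfolding score_mass_def
    by (rule integral_cluster_mass) (use bounds in \<open>simp_all add: integral_score\<close>)
qed

lemma
  shows integrable_count_mass: "integrable S (\<lambda>\<omega>. count_mass (zs \<omega>))"
    and integral_count_mass: "(\<integral>\<omega>. count_mass (zs \<omega>) \<partial>S) \<le> 1 + 1 * (nw * \<rho>)"
proof -
  show "integrable S (\<lambda>\<omega>. count_mass (zs \<omega>))"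
    unfolding count_mass_def
    by (rule integrable_cluster_mass[where \<beta>=1 and \<gamma>=1])
      (simp_all add: integral_at_point integrable_at_point)
  show "(\<integral>\<omega>. count_mass (zs \<omega>) \<partial>S) \<le> 1 + 1 * (nw * \<rho>)"
    unfolding count_mass_def
    by (rule integral_cluster_mass) (simp_all add: integral_at_point integrable_at_point)
qed

section \<open>Relative variance of the main quadratic form\<close>

definition "scoreC g z = score g z - \<mu> g"
definition "diag_kernel z = (\<Sum>g\<in>W. wt g * (score g z)\<^sup>2)"
definition "proj_kernel z = (\<Sum>g\<in>W. (wt g * \<mu> g) * scoreC g z)"

lemma wt_nonneg: "0 \<le> wt g"
  by (simp add: wt_def)

lemma measurable_scoreC [measurable]: "scoreC g \<in> borel_measurable borel"
  unfolding scoreC_def[abs_def] by measurable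

lemma
  assumes "g \<in> W"
  shows integral_scoreC: "(\<integral>z. scoreC g z \<partial>P) = 0"
    and integrable_scoreC2: "integrable P (\<lambda>z. (scoreC g z)\<^sup>2)"
  using integrable_score[of g] integrable_score2[OF assms]
  by (simp_all add: scoreC_def[abs_def] integral_score[OF assms] power2_diff
      law.prob_space[unfolded space_law])

text \<open>The Hoeffding decomposition is applied in each cluster with \<open>c\<close> the mean
  \<open>\<mu> g\<close>. Its constants, together with the mean of the diagonal, make up
  \<open>nw * T\<close>, so all three remaining terms are centred.\<close>

lemma main_stat_decomp:
  "main_stat z - nw * T
   = (linear_stat diag_kernel n z - n * (\<integral>z. diag_kernel z \<partial>P))
     + 2 * pair_stat W wt scoreC n z + 2 * (real n - 1) * linear_stat proj_kernel n z"
proof -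
  have mean: "(\<integral>z. diag_kernel z \<partial>P) = (\<Sum>g\<in>W. wt g * (\<integral>z. (score g z)\<^sup>2 \<partial>P))"
    using integrable_score2 by (simp add: diag_kernel_def)
  have "nw * T = n * (\<integral>z. diag_kernel z \<partial>P) + real n * (real n - 1) * (\<Sum>g\<in>W. wt g * (\<mu> g)\<^sup>2)"
    unfolding nw_def mult.assoc crv_pop_eq mean by (simp add: algebra_simps)
  moreover have "main_stat z = linear_stat diag_kernel n z
     + 2 * pair_stat W wt scoreC n z + 2 * (real n - 1) * linear_stat proj_kernel n z
     + real n * (real n - 1) * (\<Sum>g\<in>W. wt g * (\<mu> g)\<^sup>2)"
    unfolding main_stat_def diag_kernel_def[abs_def] proj_kernel_def[abs_def] pair_stat_def
      linear_stat_sum linear_stat_mult scoreC_def[abs_def] sum_distrib_left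
      sum.distrib[symmetric]
    by (intro sum.cong refl, subst linear_stat_square[where c="\<mu> _"])
      (simp add: algebra_simps sum_distrib_left)
  ultimately show ?thesis
    by simp
qed

text \<open>One observation lies in at most one cluster, so products of scores of different clusters
  vanish pointwise.\<close>

lemma diag_kernel_square: "(diag_kernel z)\<^sup>2 = (\<Sum>g\<in>W. (wt g)\<^sup>2 * (score g z) ^ 4)"
proof -
  have "(\<Sum>g'\<in>W. (wt g * (score g z)\<^sup>2) * (wt g' * (score g' z)\<^sup>2)) = (wt g)\<^sup>2 * (score g z) ^ 4"
    if g: "g \<in> W" for g
  proof -
    have zero: "(wt g * (score g z)\<^sup>2) * (wt g' * (score g' z)\<^sup>2) = 0" if "g' \<in> W - {g}" for g'
      using score_distinct[of g g' z] g that by auto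
    have "(\<Sum>g'\<in>W. (wt g * (score g z)\<^sup>2) * (wt g' * (score g' z)\<^sup>2))
        = (wt g * (score g z)\<^sup>2) * (wt g * (score g z)\<^sup>2)"
      by (subst sum.remove[OF finite_W g]) (simp only: sum.neutral[OF ballI[OF zero]] add_0_right)
    then show ?thesis
      by (simp add: power2_eq_square power4_eq_xxxx mult_ac)
  qed
  then show ?thesis
    by (simp add: diag_kernel_def power2_eq_square[of "sum _ _"] sum_product)
qed

lemma weighted_score_square:
  "(\<Sum>g\<in>W. c g * score g z)\<^sup>2 = (\<Sum>g\<in>W. (c g)\<^sup>2 * (score g z)\<^sup>2)"
proof -
  have "(\<Sum>g'\<in>W. (c g * score g z) * (c g' * score g' z)) = (c g)\<^sup>2 * (score g z)\<^sup>2"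
    if g: "g \<in> W" for g
  proof -
    have zero: "(c g * score g z) * (c g' * score g' z) = 0" if "g' \<in> W - {g}" for g'
      using score_distinct[of g g' z] g that by auto
    have "(\<Sum>g'\<in>W. (c g * score g z) * (c g' * score g' z))
        = (c g * score g z) * (c g * score g z)"
      by (subst sum.remove[OF finite_W g]) (simp only: sum.neutral[OF ballI[OF zero]] add_0_right)
    then show ?thesis
      by (simp add: power2_eq_square mult_ac)
  qed
  then show ?thesis
    by (simp add: power2_eq_square[of "sum _ _"] sum_product)
qed

text \<open>Disjointness removes the mixed moment of different clusters, but centring leaves the
  covariance \<open>- \<mu> g * \<mu> g'\<close>. The bound separates this rank-one part from the
  diagonal.\<close>

lemma integral_scoreC_mult_square_le:
  assumes g: "g \<in> W" "g' \<in> W"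
  shows "(\<integral>z. scoreC g z * scoreC g' z \<partial>P)\<^sup>2
    \<le> 2 * (if g = g' then (\<integral>z. (score g z)\<^sup>2 \<partial>P)\<^sup>2 else 0) + 2 * ((\<mu> g)\<^sup>2 * (\<mu> g')\<^sup>2)"
proof -
  have int: "integrable P (\<lambda>z. score g z * score g' z)"
    using integrable_mult_of_squares[of "score g" P "score g'"] integrable_score2 g by simp
  have "(\<integral>z. scoreC g z * scoreC g' z \<partial>P)
      = (\<integral>z. score g z * score g' z - \<mu> g' * score g z - \<mu> g * score g' z + \<mu> g * \<mu> g' \<partial>P)"
    by (simp add: scoreC_def algebra_simps)
  also have "\<dots> = (\<integral>z. score g z * score g' z \<partial>P) - \<mu> g * \<mu> g'"
    using int integrable_score g
    by (simp add: integral_score law.prob_space[unfolded space_law])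
  also have "(\<integral>z. score g z * score g' z \<partial>P) = (if g = g' then (\<integral>z. (score g z)\<^sup>2 \<partial>P) else 0)"
    by (cases "g = g'") (simp_all add: score_distinct[OF g] power2_eq_square)
  finally have eq: "(\<integral>z. scoreC g z * scoreC g' z \<partial>P)
      = (if g = g' then (\<integral>z. (score g z)\<^sup>2 \<partial>P) else 0) - \<mu> g * \<mu> g'" .
  have "(s - t)\<^sup>2 \<le> 2 * s\<^sup>2 + 2 * t\<^sup>2" for s t :: real
    using zero_le_power2[of "s + t"] by (simp add: power2_sum power2_diff)
  from this[of "if g = g' then (\<integral>z. (score g z)\<^sup>2 \<partial>P) else 0" "\<mu> g * \<mu> g'"]
  show ?thesis
    unfolding eq by (cases "g = g'") (simp_all add: power_mult_distrib)
qed

context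
  fixes A c :: real
  assumes A: "\<And>g. g \<in> W \<Longrightarrow> wt g \<le> A" and A0: "0 \<le> A"
    and c: "0 < c" "c \<le> T"
begin

lemma
  shows integrable_diag_deviation:
      "integrable S (\<lambda>\<omega>. (linear_stat diag_kernel n (zs \<omega>) - n * (\<integral>z. diag_kernel z \<partial>P))\<^sup>2)"
    and integral_diag_deviation:
      "(\<integral>\<omega>. (linear_stat diag_kernel n (zs \<omega>) - n * (\<integral>z. diag_kernel z \<partial>P))\<^sup>2 \<partial>S)
        \<le> A\<^sup>2 * B * nw"
proof -
  have meas: "diag_kernel \<in> borel_measurable borel"
    unfolding diag_kernel_def[abs_def] by measurable
  have int: "integrable P (\<lambda>z. (diag_kernel z)\<^sup>2)"
    unfolding diag_kernel_square using integrable_score4 by simp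
  have "(\<integral>z. (diag_kernel z)\<^sup>2 \<partial>P) = (\<Sum>g\<in>W. (wt g)\<^sup>2 * (\<integral>z. (score g z) ^ 4 \<partial>P))"
    unfolding diag_kernel_square using integrable_score4 by simp
  also have "\<dots> \<le> (\<Sum>g\<in>W. A\<^sup>2 * (B * pt g))"
    using A A0 wt_nonneg by (intro sum_mono mult_mono power_mono integral_score4) auto
  also have "\<dots> = A\<^sup>2 * B * \<pi>"
    by (simp add: \<pi>_eq_sum sum_distrib_left mult.assoc)
  finally have "n * (\<integral>z. (diag_kernel z)\<^sup>2 \<partial>P) \<le> n * (A\<^sup>2 * B * \<pi>)"
    by (intro mult_left_mono) auto
  then show "(\<integral>\<omega>. (linear_stat diag_kernel n (zs \<omega>) - n * (\<integral>z. diag_kernel z \<partial>P))\<^sup>2 \<partial>S)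
      \<le> A\<^sup>2 * B * nw"
    using integral_linear_stat_deviation_le[OF meas int] by (simp add: nw_def mult_ac)
  show "integrable S (\<lambda>\<omega>. (linear_stat diag_kernel n (zs \<omega>) - n * (\<integral>z. diag_kernel z \<partial>P))\<^sup>2)"
    by (rule integral_linear_stat_square(2)[OF meas int])
qed

lemma
  shows integrable_pair_stat_scoreC: "integrable S (\<lambda>\<omega>. (pair_stat W wt scoreC n (zs \<omega>))\<^sup>2)"
    and integral_pair_stat_scoreC:
      "(\<integral>\<omega>. (pair_stat W wt scoreC n (zs \<omega>))\<^sup>2 \<partial>S) \<le> A\<^sup>2 * ((1 + B)\<^sup>2 + B ^ 4) * \<rho> * nw\<^sup>2"
proof -
  let ?v = "\<lambda>g. \<integral>z. (score g z)\<^sup>2 \<partial>P"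
  note pair = finite_W measurable_scoreC integrable_scoreC2 integral_scoreC order_refl
  show "integrable S (\<lambda>\<omega>. (pair_stat W wt scoreC n (zs \<omega>))\<^sup>2)"
    by (rule integrable_pair_stat_square[OF pair])
  have v: "(?v g)\<^sup>2 \<le> (1 + B)\<^sup>2 * (pt g)\<^sup>2" if "g \<in> W" for g
    using power_mono[OF integral_score2[OF that], of 2] by (simp add: power_mult_distrib)
  have \<mu>: "(\<Sum>g\<in>W. (\<mu> g)\<^sup>2) \<le> B\<^sup>2 * (\<rho> * \<pi>\<^sup>2)"
  proof -
    have "(\<Sum>g\<in>W. (\<mu> g)\<^sup>2) \<le> (\<Sum>g\<in>W. B\<^sup>2 * (pt g)\<^sup>2)"
      by (intro sum_mono \<mu>_square_le)
    also have "\<dots> \<le> B\<^sup>2 * (\<rho> * \<pi>\<^sup>2)"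
      unfolding sum_distrib_left[symmetric] by (intro mult_left_mono sum_pt_square_le) auto
    finally show ?thesis .
  qed
  have "(\<Sum>g\<in>W. (\<mu> g)\<^sup>2)\<^sup>2 \<le> (B\<^sup>2 * (\<rho> * \<pi>\<^sup>2))\<^sup>2"
    by (intro power_mono \<mu> sum_nonneg) auto
  also have "\<dots> = B ^ 4 * (\<rho> * \<pi>\<^sup>2) * (\<rho> * \<pi>\<^sup>2)"
    by (simp add: power2_eq_square power4_eq_xxxx mult_ac)
  \<comment> \<open>One of the two factors \<open>\<rho> * \<pi>^2\<close> is bounded by 1, so that
    this part takes the same form as the diagonal contribution.\<close>
  also have "\<dots> \<le> B ^ 4 * (\<rho> * \<pi>\<^sup>2) * 1"
    using \<rho> \<pi>_le_1 win_pos by (intro mult_left_mono mult_le_one power_le_one) auto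
  finally have \<mu>2: "(\<Sum>g\<in>W. (\<mu> g)\<^sup>2)\<^sup>2 \<le> B ^ 4 * (\<rho> * \<pi>\<^sup>2)"
    by simp
  have wt2: "wt g * wt g' \<le> A\<^sup>2" if "g \<in> W" "g' \<in> W" for g g'
    unfolding power2_eq_square using A A0 wt_nonneg that by (intro mult_mono) auto
  have "(\<Sum>g\<in>W. \<Sum>g'\<in>W. wt g * wt g' * (\<integral>z. scoreC g z * scoreC g' z \<partial>P)\<^sup>2)
      \<le> (\<Sum>g\<in>W. \<Sum>g'\<in>W. A\<^sup>2 * (2 * (if g = g' then (?v g)\<^sup>2 else 0) + 2 * ((\<mu> g)\<^sup>2 * (\<mu> g')\<^sup>2)))"
    using wt_nonneg by (intro sum_mono mult_mono wt2 integral_scoreC_mult_square_le) auto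
  also have "\<dots> = A\<^sup>2 * (2 * (\<Sum>g\<in>W. (?v g)\<^sup>2) + 2 * (\<Sum>g\<in>W. (\<mu> g)\<^sup>2)\<^sup>2)"
    by (simp add: sum.distrib sum_distrib_left[symmetric] power2_eq_square[of "sum _ _"]
        sum_product cong: if_cong)
  also have "\<dots> \<le> A\<^sup>2 * (2 * ((1 + B)\<^sup>2 * (\<rho> * \<pi>\<^sup>2)) + 2 * (B ^ 4 * (\<rho> * \<pi>\<^sup>2)))"
  proof -
    have "(\<Sum>g\<in>W. (?v g)\<^sup>2) \<le> (\<Sum>g\<in>W. (1 + B)\<^sup>2 * (pt g)\<^sup>2)"
      by (intro sum_mono v)
    also have "\<dots> \<le> (1 + B)\<^sup>2 * (\<rho> * \<pi>\<^sup>2)"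
      unfolding sum_distrib_left[symmetric] by (intro mult_left_mono sum_pt_square_le) auto
    finally show ?thesis
      using \<mu>2 by (intro mult_left_mono add_mono) auto
  qed
  finally have sum: "(\<Sum>g\<in>W. \<Sum>g'\<in>W. wt g * wt g' * (\<integral>z. scoreC g z * scoreC g' z \<partial>P)\<^sup>2)
      \<le> A\<^sup>2 * (2 * ((1 + B)\<^sup>2 * (\<rho> * \<pi>\<^sup>2)) + 2 * (B ^ 4 * (\<rho> * \<pi>\<^sup>2)))" .
  have "(\<integral>\<omega>. (pair_stat W wt scoreC n (zs \<omega>))\<^sup>2 \<partial>S) = (real n * (real n - 1) / 2)
      * (\<Sum>g\<in>W. \<Sum>g'\<in>W. wt g * wt g' * (\<integral>z. scoreC g z * scoreC g' z \<partial>P)\<^sup>2)"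
    by (rule integral_pair_stat_square[OF pair])
  also have "\<dots> \<le> (real n)\<^sup>2 / 2
      * (A\<^sup>2 * (2 * ((1 + B)\<^sup>2 * (\<rho> * \<pi>\<^sup>2)) + 2 * (B ^ 4 * (\<rho> * \<pi>\<^sup>2))))"
  proof (intro mult_mono sum)
    show "real n * (real n - 1) / 2 \<le> (real n)\<^sup>2 / 2"
      by (simp add: power2_eq_square mult_left_mono)
  qed (auto intro!: sum_nonneg mult_nonneg_nonneg wt_nonneg)
  also have "\<dots> = A\<^sup>2 * ((1 + B)\<^sup>2 + B ^ 4) * \<rho> * nw\<^sup>2"
    by (simp add: nw_def power_mult_distrib algebra_simps)
  finally show "(\<integral>\<omega>. (pair_stat W wt scoreC n (zs \<omega>))\<^sup>2 \<partial>S)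
      \<le> A\<^sup>2 * ((1 + B)\<^sup>2 + B ^ 4) * \<rho> * nw\<^sup>2" .
qed

text \<open>The linear part carries the factor \<open>(n - 1)^2\<close>. One factor
  \<open>n - 1\<close> is absorbed by the pair part of the target, which costs a factor
  \<open>T\<close>; the other is bounded by \<open>n\<close>. After division by
  \<open>(nw * T)^2\<close> this gives order \<open>\<rho> / T\<close> even when \<open>T\<close> is
  large.\<close>

lemma
  shows integrable_proj_stat: "integrable S (\<lambda>\<omega>. (linear_stat proj_kernel n (zs \<omega>))\<^sup>2)"
    and integral_proj_stat:
      "(real n - 1)\<^sup>2 * (\<integral>\<omega>. (linear_stat proj_kernel n (zs \<omega>))\<^sup>2 \<partial>S)
        \<le> A * (1 + B) * \<rho> * nw\<^sup>2 * T"
proof -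
  let ?\<psi> = "\<lambda>z. \<Sum>g\<in>W. (wt g * \<mu> g) * score g z"
  let ?D = "\<Sum>g\<in>W. wt g * (\<mu> g)\<^sup>2"
  have meas: "?\<psi> \<in> borel_measurable borel"
    by measurable
  have int: "integrable P (\<lambda>z. (?\<psi> z)\<^sup>2)"
    unfolding weighted_score_square using integrable_score2 by simp
  have mean: "(\<integral>z. ?\<psi> z \<partial>P) = (\<Sum>g\<in>W. (wt g * \<mu> g) * \<mu> g)"
    using integrable_score by (simp add: integral_score)
  have eq: "linear_stat proj_kernel n z = linear_stat ?\<psi> n z - n * (\<integral>z. ?\<psi> z \<partial>P)" for z
    unfolding mean
    by (simp add: proj_kernel_def scoreC_def linear_stat_def right_diff_distrib sum_subtractf)
  show "integrable S (\<lambda>\<omega>. (linear_stat proj_kernel n (zs \<omega>))\<^sup>2)"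
    unfolding eq by (rule integral_linear_stat_square(2)[OF meas int])
  have "(\<integral>z. (?\<psi> z)\<^sup>2 \<partial>P) = (\<Sum>g\<in>W. (wt g * \<mu> g)\<^sup>2 * (\<integral>z. (score g z)\<^sup>2 \<partial>P))"
    unfolding weighted_score_square using integrable_score2 by simp
  also have "\<dots> \<le> (\<Sum>g\<in>W. (A * (wt g * (\<mu> g)\<^sup>2)) * ((1 + B) * (\<rho> * \<pi>)))"
  proof (intro sum_mono mult_mono)
    fix g assume g: "g \<in> W"
    show "(wt g * \<mu> g)\<^sup>2 \<le> A * (wt g * (\<mu> g)\<^sup>2)"
      using mult_right_mono[OF A[OF g] mult_nonneg_nonneg[OF wt_nonneg[of g]
          zero_le_power2[of "\<mu> g"]]]
      by (simp add: power2_eq_square mult_ac)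
    show "(\<integral>z. (score g z)\<^sup>2 \<partial>P) \<le> (1 + B) * (\<rho> * \<pi>)"
      by (rule order_trans[OF integral_score2[OF g] mult_left_mono[OF share_bound[OF g]]])
        (use B in simp)
  qed (use A0 wt_nonneg in auto)
  also have "\<dots> = A * (1 + B) * \<rho> * \<pi> * ?D"
    by (simp add: sum_distrib_left mult_ac)
  finally have second: "(\<integral>z. (?\<psi> z)\<^sup>2 \<partial>P) \<le> A * (1 + B) * \<rho> * \<pi> * ?D" .
  \<comment> \<open>Of the two nonnegative parts of \<open>\<pi> * T\<close> only the pair part is
    kept.\<close>
  have D: "(real n - 1) * ?D \<le> \<pi> * T"
    unfolding crv_pop_eq using wt_nonneg by (auto intro!: sum_nonneg)
  have D0: "0 \<le> ?D"
    using wt_nonneg by (auto intro!: sum_nonneg)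
  have n1: "0 \<le> real n - 1"
    using sample_size by simp
  have "(real n - 1)\<^sup>2 * (\<integral>\<omega>. (linear_stat proj_kernel n (zs \<omega>))\<^sup>2 \<partial>S)
      \<le> (real n - 1)\<^sup>2 * (n * (A * (1 + B) * \<rho> * \<pi> * ?D))"
    unfolding eq
    using order_trans[OF integral_linear_stat_deviation_le[OF meas int] mult_left_mono[OF second]]
    by (intro mult_left_mono) auto
  also have "\<dots> = (A * (1 + B) * \<rho> * \<pi> * n) * ((real n - 1) * ((real n - 1) * ?D))"
    by (simp add: power2_eq_square mult_ac)
  also have "\<dots> \<le> (A * (1 + B) * \<rho> * \<pi> * n) * (n * (\<pi> * T))"
    using A0 B \<rho> win_pos n1 D D0
    by (intro mult_left_mono[OF mult_mono]) auto
  also have "\<dots> = A * (1 + B) * \<rho> * nw\<^sup>2 * T"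
    by (simp add: nw_def power2_eq_square mult_ac)
  finally show "(real n - 1)\<^sup>2 * (\<integral>\<omega>. (linear_stat proj_kernel n (zs \<omega>))\<^sup>2 \<partial>S)
      \<le> A * (1 + B) * \<rho> * nw\<^sup>2 * T" .
qed

lemma
  shows integrable_main_stat: "integrable S (\<lambda>\<omega>. (main_stat (zs \<omega>) / (nw * T) - 1)\<^sup>2)"
    and integral_main_stat: "(\<integral>\<omega>. (main_stat (zs \<omega>) / (nw * T) - 1)\<^sup>2 \<partial>S)
      \<le> 3 * (A\<^sup>2 * B / (nw * c\<^sup>2)
          + 4 * (A\<^sup>2 * ((1 + B)\<^sup>2 + B ^ 4) * \<rho>) / c\<^sup>2 + 4 * (A * (1 + B) * \<rho>) / c)"
proof -
  define d where "d \<omega> = linear_stat diag_kernel n (zs \<omega>) - n * (\<integral>z. diag_kernel z \<partial>P)" for \<omega>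
  define s where "s \<omega> = pair_stat W wt scoreC n (zs \<omega>)" for \<omega>
  define r where "r \<omega> = (real n - 1) * linear_stat proj_kernel n (zs \<omega>)" for \<omega>
  have T: "0 < T"
    using c by simp
  have bound: "(main_stat (zs \<omega>) / (nw * T) - 1)\<^sup>2
      \<le> 3 * ((d \<omega>)\<^sup>2 + 4 * (s \<omega>)\<^sup>2 + 4 * (r \<omega>)\<^sup>2) / (nw * T)\<^sup>2" for \<omega>
  proof -
    have "main_stat (zs \<omega>) - nw * T = d \<omega> + 2 * s \<omega> + 2 * r \<omega>"
      unfolding main_stat_decomp d_def s_def r_def by simp
    then have "main_stat (zs \<omega>) / (nw * T) - 1 = (d \<omega> + 2 * s \<omega> + 2 * r \<omega>) / (nw * T)"
      using T nw_pos by (simp add: diff_divide_distrib flip: \<open>main_stat (zs \<omega>) - nw * T = _\<close>)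
    then show ?thesis
      using square_sum_three_le[of "d \<omega>" "2 * s \<omega>" "2 * r \<omega>"]
      by (simp add: power_divide power_mult_distrib divide_right_mono)
  qed
  have int: "integrable S (\<lambda>\<omega>. (d \<omega>)\<^sup>2)" "integrable S (\<lambda>\<omega>. (s \<omega>)\<^sup>2)" "integrable S (\<lambda>\<omega>. (r \<omega>)\<^sup>2)"
    using integrable_diag_deviation integrable_pair_stat_scoreC integrable_proj_stat
    by (simp_all add: d_def s_def r_def power_mult_distrib)
  then have int_bound: "integrable S
      (\<lambda>\<omega>. 3 * ((d \<omega>)\<^sup>2 + 4 * (s \<omega>)\<^sup>2 + 4 * (r \<omega>)\<^sup>2) / (nw * T)\<^sup>2)"
    by simp
  have meas: "(\<lambda>\<omega>. (main_stat (zs \<omega>) / (nw * T) - 1)\<^sup>2) \<in> borel_measurable S"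
    unfolding main_stat_def
    by (intro borel_measurable_power borel_measurable_diff borel_measurable_divide
        borel_measurable_sum borel_measurable_times borel_measurable_const
        borel_measurable_linear_stat measurable_score order_refl)
  show int_main: "integrable S (\<lambda>\<omega>. (main_stat (zs \<omega>) / (nw * T) - 1)\<^sup>2)"
    by (rule Bochner_Integration.integrable_bound[OF int_bound meas])
      (use bound in \<open>auto intro!: AE_I2 order_trans[OF bound]\<close>)
  have "(\<integral>\<omega>. (main_stat (zs \<omega>) / (nw * T) - 1)\<^sup>2 \<partial>S)
      \<le> (\<integral>\<omega>. 3 * ((d \<omega>)\<^sup>2 + 4 * (s \<omega>)\<^sup>2 + 4 * (r \<omega>)\<^sup>2) / (nw * T)\<^sup>2 \<partial>S)"
    by (intro integral_mono int_main int_bound bound)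
  also have "\<dots> = 3 * ((\<integral>\<omega>. (d \<omega>)\<^sup>2 \<partial>S) + 4 * (\<integral>\<omega>. (s \<omega>)\<^sup>2 \<partial>S) + 4 * (\<integral>\<omega>. (r \<omega>)\<^sup>2 \<partial>S))
      / (nw * T)\<^sup>2"
    using int by simp
  also have "\<dots> \<le> 3 * (A\<^sup>2 * B * nw + 4 * (A\<^sup>2 * ((1 + B)\<^sup>2 + B ^ 4) * \<rho> * nw\<^sup>2)
      + 4 * (A * (1 + B) * \<rho> * nw\<^sup>2 * T)) / (nw * T)\<^sup>2"
    using integral_diag_deviation integral_pair_stat_scoreC integral_proj_stat
    by (intro divide_right_mono mult_left_mono add_mono)
      (simp_all add: d_def s_def r_def power_mult_distrib)
  also have "\<dots> = 3 * (A\<^sup>2 * B / (nw * T\<^sup>2)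
      + 4 * (A\<^sup>2 * ((1 + B)\<^sup>2 + B ^ 4) * \<rho>) / T\<^sup>2 + 4 * (A * (1 + B) * \<rho>) / T)"
    using T nw_pos by (simp add: power2_eq_square divide_simps) (simp add: algebra_simps)
  \<comment> \<open>The lower bound \<open>c\<close> replaces \<open>T\<close> only after all powers
    of \<open>T\<close> have been collected in denominators.\<close>
  also have "\<dots> \<le> 3 * (A\<^sup>2 * B / (nw * c\<^sup>2)
      + 4 * (A\<^sup>2 * ((1 + B)\<^sup>2 + B ^ 4) * \<rho>) / c\<^sup>2 + 4 * (A * (1 + B) * \<rho>) / c)"
    using c nw_pos A0 B \<rho>
    by (intro mult_left_mono add_mono divide_left_mono power_mono mult_pos_pos zero_less_power
        mult_nonneg_nonneg add_nonneg_nonneg) auto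
  finally show "(\<integral>\<omega>. (main_stat (zs \<omega>) / (nw * T) - 1)\<^sup>2 \<partial>S)
      \<le> 3 * (A\<^sup>2 * B / (nw * c\<^sup>2)
          + 4 * (A\<^sup>2 * ((1 + B)\<^sup>2 + B ^ 4) * \<rho>) / c\<^sup>2 + 4 * (A * (1 + B) * \<rho>) / c)" .
qed

end

end

section \<open>The limit of the variance ratio\<close>

text \<open>
  The tuple \<open>(l, r, G, s, a, b, v)\<close> collects a scale \<open>l\<close> and statistics of the sample, and \<open>\<xi>\<close> is their
  total squared error: \<open>r\<close> is close to \<open>1\<close>, \<open>G\<close> to \<open>Q\<close>, \<open>s\<close> to \<open>0\<close> and \<open>v\<close> to \<open>1\<close>, while \<open>a\<close> and \<open>b\<close> are
  \<open>o(l\<^sup>2)\<close>.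
\<close>
definition crv_expansion ::
  "real ^ 'n ^ 'n \<Rightarrow> real ^ 'n \<Rightarrow> real \<Rightarrow> real \<Rightarrow> real \<Rightarrow> real
    \<Rightarrow> real \<times> real \<times> (real ^ 'n ^ 'n) \<times> (real ^ 'n) \<times> real \<times> real \<times> real \<Rightarrow> bool" where
  "crv_expansion Q e K \<tau> \<tau>hat \<xi> = (\<lambda>(l, r, G, s, a, b, v).
     1 \<le> l \<and> 0 \<le> a \<and> 0 \<le> b \<and> 0 \<le> v \<and>
     \<xi> = l\<^sup>2 * (r - 1)\<^sup>2 + l\<^sup>2 * (norm (G - Q))\<^sup>2 + l\<^sup>2 * (norm s)\<^sup>2 + a / l\<^sup>2 + b / l\<^sup>2 + (v - 1)\<^sup>2 \<and>
     (det (G /\<^sub>R r) \<noteq> 0 \<longrightarrow> 0 \<le> \<tau>hat * r \<and>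
       \<bar>sqrt (\<tau>hat * r) - sqrt (v * \<tau>)\<bar>
         \<le> K * norm (matrix_inv (G /\<^sub>R r) *v e - matrix_inv Q *v e) * sqrt a
           + K\<^sup>2 * norm (matrix_inv (G /\<^sub>R r) *v e)
             * norm (matrix_inv (G /\<^sub>R r) *v (s /\<^sub>R r)) * sqrt b))"

lemma tendsto_zero_of_square_le:
  fixes f g :: "'a \<Rightarrow> real"
  assumes "(g \<longlongrightarrow> 0) F" "\<forall>\<^sub>F t in F. (f t)\<^sup>2 \<le> g t"
  shows "(f \<longlongrightarrow> 0) F"
proof -
  have "((\<lambda>t. (f t)\<^sup>2) \<longlongrightarrow> 0) F"
    by (rule tendsto_sandwich[OF _ assms(2) tendsto_const assms(1)]) simp
  then have "((\<lambda>t. sqrt ((f t)\<^sup>2)) \<longlongrightarrow> sqrt 0) F"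
    by (rule tendsto_real_sqrt)
  then show ?thesis
    by (simp add: tendsto_rabs_zero_iff)
qed

text \<open>Deterministic and stated for an arbitrary filter, so that it can be used along pairs of
  sample size and outcome. Every summand of \<open>\<xi>\<close> is nonnegative, so
  \<open>\<xi> \<longlongrightarrow> 0\<close> controls all the errors at once.\<close>

lemma crv_expansion_limit:
  fixes Q :: "'i \<Rightarrow> real ^ 'n ^ 'n" and \<tau> \<tau>hat \<xi> :: "'i \<Rightarrow> real"
  assumes Q: "(Q \<longlongrightarrow> Q0) F" "det Q0 \<noteq> 0"
    and \<tau>: "0 < c" "\<forall>\<^sub>F t in F. c \<le> \<tau> t" and \<xi>: "(\<xi> \<longlongrightarrow> 0) F"
    and ex: "\<forall>\<^sub>F t in F. \<exists>d. crv_expansion (Q t) e K (\<tau> t) (\<tau>hat t) (\<xi> t) d"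
  shows "((\<lambda>t. \<tau>hat t / \<tau> t) \<longlongrightarrow> 1) F"
proof -
  \<comment> \<open>A choice of witness for each \<open>t\<close> turns the existential statement
    into functions whose limits can be taken.\<close>
  define d where "d t = (SOME d. crv_expansion (Q t) e K (\<tau> t) (\<tau>hat t) (\<xi> t) d)" for t
  define l where "l t = fst (d t)" for t
  define r where "r t = fst (snd (d t))" for t
  define G where "G t = fst (snd (snd (d t)))" for t
  define s where "s t = fst (snd (snd (snd (d t))))" for t
  define a where "a t = fst (snd (snd (snd (snd (d t)))))" for t
  define b where "b t = fst (snd (snd (snd (snd (snd (d t))))))" for t
  define v where "v t = snd (snd (snd (snd (snd (snd (d t))))))" for t
  have ex': "\<forall>\<^sub>F t in F. crv_expansion (Q t) e K (\<tau> t) (\<tau>hat t) (\<xi> t)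
      (l t, r t, G t, s t, a t, b t, v t)"
    using ex unfolding l_def r_def G_def s_def a_def b_def v_def prod.collapse d_def
    by eventually_elim (rule someI_ex)
  have pos: "\<forall>\<^sub>F t in F. 1 \<le> l t \<and> 0 \<le> a t \<and> 0 \<le> b t \<and> 0 \<le> v t"
    using ex' by eventually_elim (simp add: crv_expansion_def)
  have parts: "\<forall>\<^sub>F t in F. (l t * (r t - 1))\<^sup>2 \<le> \<xi> t \<and> (l t * norm (G t - Q t))\<^sup>2 \<le> \<xi> t
      \<and> (l t * norm (s t))\<^sup>2 \<le> \<xi> t \<and> (sqrt (a t) / l t)\<^sup>2 \<le> \<xi> t \<and> (sqrt (b t) / l t)\<^sup>2 \<le> \<xi> t
      \<and> (v t - 1)\<^sup>2 \<le> \<xi> t"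
    using ex'
  proof eventually_elim
    case (elim t)
    then have *: "1 \<le> l t" "0 \<le> a t" "0 \<le> b t" and
      eq: "\<xi> t = (l t)\<^sup>2 * (r t - 1)\<^sup>2 + (l t)\<^sup>2 * (norm (G t - Q t))\<^sup>2 + (l t)\<^sup>2 * (norm (s t))\<^sup>2
        + a t / (l t)\<^sup>2 + b t / (l t)\<^sup>2 + (v t - 1)\<^sup>2"
      by (auto simp: crv_expansion_def)
    have "0 \<le> (l t)\<^sup>2 * (r t - 1)\<^sup>2" "0 \<le> (l t)\<^sup>2 * (norm (G t - Q t))\<^sup>2"
      "0 \<le> (l t)\<^sup>2 * (norm (s t))\<^sup>2" "0 \<le> a t / (l t)\<^sup>2" "0 \<le> b t / (l t)\<^sup>2" "0 \<le> (v t - 1)\<^sup>2"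
      using * by auto
    then show ?case
      unfolding power_mult_distrib power_divide real_sqrt_pow2[OF *(2)] real_sqrt_pow2[OF *(3)] eq
      by linarith
  qed
  have lr: "((\<lambda>t. l t * (r t - 1)) \<longlongrightarrow> 0) F" and lG: "((\<lambda>t. l t * norm (G t - Q t)) \<longlongrightarrow> 0) F"
    and ls: "((\<lambda>t. l t * norm (s t)) \<longlongrightarrow> 0) F" and la: "((\<lambda>t. sqrt (a t) / l t) \<longlongrightarrow> 0) F"
    and lb: "((\<lambda>t. sqrt (b t) / l t) \<longlongrightarrow> 0) F" and v1: "((\<lambda>t. v t - 1) \<longlongrightarrow> 0) F"
    by (rule tendsto_zero_of_square_le[OF \<xi>], use parts in \<open>eventually_elim, blast\<close>)+
  have "((\<lambda>t. r t - 1) \<longlongrightarrow> 0) F"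
    by (rule Lim_null_comparison[OF _ tendsto_norm_zero[OF lr]])
      (use pos in \<open>eventually_elim, simp add: abs_mult mult_le_cancel_right1\<close>)
  then have r: "(r \<longlongrightarrow> 1) F"
    by (simp add: LIM_zero_iff)
  have "((\<lambda>t. G t - Q t) \<longlongrightarrow> 0) F"
    by (rule Lim_null_comparison[OF _ lG])
      (use pos in \<open>eventually_elim, simp add: mult_le_cancel_right1\<close>)
  from tendsto_add[OF this Q(1)] have G: "(G \<longlongrightarrow> Q0) F"
    by simp
  have v: "(v \<longlongrightarrow> 1) F"
    using v1 by (simp add: LIM_zero_iff)
  define Qh where "Qh t = G t /\<^sub>R r t" for t
  define q where "q t = matrix_inv (Q t) *v e" for t
  define qh where "qh t = matrix_inv (Qh t) *v e" for t
  define \<Delta> where "\<Delta> t = matrix_inv (Qh t) *v (s t /\<^sub>R r t)" for t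
  have ir: "((\<lambda>t. inverse (r t)) \<longlongrightarrow> 1) F"
    using tendsto_inverse[OF r] by simp
  have Qh: "(Qh \<longlongrightarrow> Q0) F"
    unfolding Qh_def using tendsto_scaleR[OF ir G] by simp
  have Qi: "((\<lambda>t. matrix_inv (Q t)) \<longlongrightarrow> matrix_inv Q0) F"
    and Qhi: "((\<lambda>t. matrix_inv (Qh t)) \<longlongrightarrow> matrix_inv Q0) F"
    by (intro tendsto_matrix_inv Q Qh)+
  have nz: "\<forall>\<^sub>F t in F. det (Q t) \<noteq> 0" "\<forall>\<^sub>F t in F. det (Qh t) \<noteq> 0" "\<forall>\<^sub>F t in F. r t \<noteq> 0"
    using tendsto_imp_eventually_ne[OF tendsto_det[OF Q(1)] Q(2)]
      tendsto_imp_eventually_ne[OF tendsto_det[OF Qh] Q(2)] tendsto_imp_eventually_ne[OF r] by auto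
  have q: "(q \<longlongrightarrow> matrix_inv Q0 *v e) F" and qh: "(qh \<longlongrightarrow> matrix_inv Q0 *v e) F"
    unfolding q_def qh_def by (intro tendsto_matrix_vector_mult Qi Qhi tendsto_const)+
  have lG': "((\<lambda>t. l t *\<^sub>R (G t - Q t)) \<longlongrightarrow> 0) F"
    by (rule Lim_null_comparison[OF _ lG]) (use pos in \<open>eventually_elim, simp\<close>)
  have ls': "((\<lambda>t. l t *\<^sub>R s t) \<longlongrightarrow> 0) F"
    by (rule Lim_null_comparison[OF _ ls]) (use pos in \<open>eventually_elim, simp\<close>)
  \<comment> \<open>From \<open>Q - G / r = ((r - 1) Q - (G - Q)) / r\<close>; both errors remain
    small after multiplication by \<open>l\<close>.\<close>
  have "((\<lambda>t. l t *\<^sub>R (Q t - Qh t)) \<longlongrightarrow> (0 * 1) *\<^sub>R Q0 - 1 *\<^sub>R 0) F"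
  proof (rule Lim_transform_eventually)
    show "((\<lambda>t. (l t * (r t - 1) * inverse (r t)) *\<^sub>R Q t - inverse (r t) *\<^sub>R (l t *\<^sub>R (G t - Q t)))
        \<longlongrightarrow> (0 * 1) *\<^sub>R Q0 - 1 *\<^sub>R 0) F"
      by (intro tendsto_intros lr ir Q(1) lG')
    show "\<forall>\<^sub>F t in F. (l t * (r t - 1) * inverse (r t)) *\<^sub>R Q t - inverse (r t) *\<^sub>R (l t *\<^sub>R (G t - Q t))
        = l t *\<^sub>R (Q t - Qh t)"
      using nz(3) by eventually_elim (simp add: Qh_def vec_eq_iff field_simps)
  qed
  then have lQ: "((\<lambda>t. l t *\<^sub>R (Q t - Qh t)) \<longlongrightarrow> 0) F"
    by simp
  \<comment> \<open>The resolvent identity: \<open>qh - q\<close> is the inverse of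
    \<open>Qh\<close> applied to \<open>(Q - Qh) q\<close>, so the rate \<open>l\<close> passes from
    the matrices to the solutions.\<close>
  have "((\<lambda>t. matrix_inv (Qh t) *v ((l t *\<^sub>R (Q t - Qh t)) *v q t))
      \<longlongrightarrow> matrix_inv Q0 *v (0 *v (matrix_inv Q0 *v e))) F"
    by (intro tendsto_matrix_vector_mult Qhi lQ q)
  moreover have "\<forall>\<^sub>F t in F. matrix_inv (Qh t) *v ((l t *\<^sub>R (Q t - Qh t)) *v q t)
      = l t *\<^sub>R (qh t - q t)"
    using nz(1,2)
  proof eventually_elim
    case (elim t)
    have "Q t *v q t = e" "matrix_inv (Qh t) *v (Qh t *v w) = w" for w
      using elim by (simp_all add: q_def matrix_vector_mul_assoc matrix_mul_inv matrix_inv_mul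
          invertible_det_nz)
    then show ?case
      by (simp add: scaleR_matrix_vector_assoc[symmetric] matrix_vector_mult_diff_rdistrib
          matrix_vector_mult_scaleR matrix_vector_mult_diff_distrib qh_def)
  qed
  ultimately have lq: "((\<lambda>t. l t *\<^sub>R (qh t - q t)) \<longlongrightarrow> 0) F"
    by (simp add: filterlim_cong)
  have "((\<lambda>t. matrix_inv (Qh t) *v (inverse (r t) *\<^sub>R (l t *\<^sub>R s t)))
      \<longlongrightarrow> matrix_inv Q0 *v (1 *\<^sub>R 0)) F"
    by (intro tendsto_matrix_vector_mult Qhi tendsto_scaleR ir ls')
  moreover have "matrix_inv (Qh t) *v (inverse (r t) *\<^sub>R (l t *\<^sub>R s t)) = l t *\<^sub>R \<Delta> t" for t
    by (simp add: \<Delta>_def matrix_vector_mult_scaleR mult.commute)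
  ultimately have l\<Delta>: "((\<lambda>t. l t *\<^sub>R \<Delta> t) \<longlongrightarrow> 0) F"
    by simp
  \<comment> \<open>The scale cancels: each estimation error is multiplied by \<open>l\<close> and
    the square root of each mass is divided by \<open>l\<close>.\<close>
  have "((\<lambda>t. K * norm (l t *\<^sub>R (qh t - q t)) * (sqrt (a t) / l t)
        + K\<^sup>2 * norm (qh t) * norm (l t *\<^sub>R \<Delta> t) * (sqrt (b t) / l t))
      \<longlongrightarrow> K * norm (0 :: real ^ 'n) * 0 + K\<^sup>2 * norm (matrix_inv Q0 *v e) * norm (0 :: real ^ 'n) * 0) F"
    by (intro tendsto_intros lq la lb l\<Delta> qh)
  then have err: "((\<lambda>t. K * norm (l t *\<^sub>R (qh t - q t)) * (sqrt (a t) / l t)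
        + K\<^sup>2 * norm (qh t) * norm (l t *\<^sub>R \<Delta> t) * (sqrt (b t) / l t)) \<longlongrightarrow> 0) F"
    by simp
  have "((\<lambda>t. sqrt (\<tau>hat t * r t) - sqrt (v t * \<tau> t)) \<longlongrightarrow> 0) F"
  proof (rule Lim_null_comparison[OF _ err])
    show "\<forall>\<^sub>F t in F. norm (sqrt (\<tau>hat t * r t) - sqrt (v t * \<tau> t))
        \<le> K * norm (l t *\<^sub>R (qh t - q t)) * (sqrt (a t) / l t)
          + K\<^sup>2 * norm (qh t) * norm (l t *\<^sub>R \<Delta> t) * (sqrt (b t) / l t)"
      using ex' nz(2)
    proof eventually_elim
      case (elim t)
      then have "1 \<le> l t"
        by (simp add: crv_expansion_def)
      then have "K * norm (l t *\<^sub>R (qh t - q t)) * (sqrt (a t) / l t)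
            + K\<^sup>2 * norm (qh t) * norm (l t *\<^sub>R \<Delta> t) * (sqrt (b t) / l t)
          = K * norm (qh t - q t) * sqrt (a t) + K\<^sup>2 * norm (qh t) * norm (\<Delta> t) * sqrt (b t)"
        by simp
      then show ?case
        using elim by (simp add: crv_expansion_def Qh_def qh_def q_def \<Delta>_def)
    qed
  qed
  from tendsto_divide[OF tendsto_rabs_zero[OF this] tendsto_const, of "sqrt c"]
  have num: "((\<lambda>t. \<bar>sqrt (\<tau>hat t * r t) - sqrt (v t * \<tau> t)\<bar> / sqrt c) \<longlongrightarrow> 0) F"
    using \<tau>(1) by simp
  \<comment> \<open>As \<open>\<tau>\<close> may be unbounded, the comparison is made after division
    by \<open>sqrt \<tau>\<close>, for which the lower bound \<open>c\<close> suffices.\<close>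
  have "((\<lambda>t. (sqrt (\<tau>hat t * r t) - sqrt (v t * \<tau> t)) / sqrt (\<tau> t)) \<longlongrightarrow> 0) F"
  proof (rule Lim_null_comparison[OF _ num])
    show "\<forall>\<^sub>F t in F. norm ((sqrt (\<tau>hat t * r t) - sqrt (v t * \<tau> t)) / sqrt (\<tau> t))
        \<le> \<bar>sqrt (\<tau>hat t * r t) - sqrt (v t * \<tau> t)\<bar> / sqrt c"
      using \<tau>(2)
    proof eventually_elim
      case (elim t)
      then have "0 < \<tau> t"
        using \<tau>(1) by simp
      then show ?case
        using elim \<tau>(1) by (auto simp: abs_divide intro!: divide_left_mono)
    qed
  qed
  from tendsto_add[OF this tendsto_real_sqrt[OF v]]
  have "((\<lambda>t. (sqrt (\<tau>hat t * r t) - sqrt (v t * \<tau> t)) / sqrt (\<tau> t) + sqrt (v t)) \<longlongrightarrow> 1) F"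
    by simp
  then have "((\<lambda>t. sqrt (\<tau>hat t * r t) / sqrt (\<tau> t)) \<longlongrightarrow> 1) F"
    by (rule Lim_transform_eventually)
      (use \<tau>(2) in \<open>eventually_elim, use \<tau>(1) in \<open>simp add: real_sqrt_mult diff_divide_distrib\<close>\<close>)
  from tendsto_mult[OF tendsto_power[OF this, of 2] ir]
  have "((\<lambda>t. (sqrt (\<tau>hat t * r t) / sqrt (\<tau> t))\<^sup>2 * inverse (r t)) \<longlongrightarrow> 1) F"
    by simp
  then show ?thesis
  proof (rule Lim_transform_eventually)
    show "\<forall>\<^sub>F t in F. (sqrt (\<tau>hat t * r t) / sqrt (\<tau> t))\<^sup>2 * inverse (r t) = \<tau>hat t / \<tau> t"
      using ex' nz(2,3) \<tau>(2)
    proof eventually_elim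
      case (elim t)
      then have "0 \<le> \<tau>hat t * r t" "0 \<le> \<tau> t"
        using \<tau>(1) by (auto simp: crv_expansion_def Qh_def)
      then show ?case
        using elim(3) by (simp add: power_divide)
    qed
  qed
qed

section \<open>Expansion of the variance estimator\<close>

lemma L2_set_le_mult:
  assumes "\<And>i. i \<in> I \<Longrightarrow> \<bar>f i\<bar> \<le> c * \<bar>g i\<bar>" "0 \<le> c"
  shows "L2_set f I \<le> c * L2_set g I"
proof -
  have "(f i)\<^sup>2 \<le> (c * g i)\<^sup>2" if "i \<in> I" for i
    using power_mono[OF assms(1)[OF that], of 2] by (simp add: power_mult_distrib)
  then have "L2_set f I \<le> L2_set (\<lambda>i. c * g i) I"
    unfolding L2_set_def by (intro real_sqrt_le_mono sum_mono)
  then show ?thesis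
    by (simp add: L2_set_right_distrib assms(2))
qed

lemma L2_set_scaled:
  assumes "0 < c"
  shows "L2_set (\<lambda>i. f i / sqrt c) I = sqrt ((\<Sum>i\<in>I. (f i)\<^sup>2) / c)"
  using assms by (simp add: L2_set_def power_divide sum_divide_distrib)

lemma norm_matrix_square: "(norm (A :: real ^ 'k ^ 'l))\<^sup>2 = (\<Sum>j\<in>UNIV. \<Sum>k\<in>UNIV. (A $ j $ k)\<^sup>2)"
  unfolding power2_norm_eq_inner inner_vec_def by (simp add: power2_eq_square)

lemma norm_vector_square: "(norm (v :: real ^ 'k))\<^sup>2 = (\<Sum>j\<in>UNIV. (v $ j)\<^sup>2)"
  unfolding power2_norm_eq_inner inner_vec_def by (simp add: power2_eq_square)

context rd_sample
begin

definition "gram z = (\<chi> j k. gram_stat z j k)"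
definition "score_vec z = (\<chi> j. score_stat z j)"
abbreviation "Qhat z \<equiv> Q_hat m h n z"
definition "qhat z = matrix_inv (Qhat z) *v e"
definition "\<Delta> z = matrix_inv (Qhat z) *v (score_vec z /\<^sub>R count_stat z)"

lemma inverse_count_stat: "inverse (win_count h n z) = inverse (count_stat z) / nw"
  using nw_pos by (simp add: count_stat_def inverse_eq_divide)

lemma Q_hat_eq: "Qhat z = gram z /\<^sub>R count_stat z"
  by (simp add: Q_hat_def inverse_count_stat gram_def gram_stat_def linear_stat_def outer_def
      vec_eq_iff)

lemma transpose_Q_hat: "transpose (Qhat z) = Qhat z"
  by (simp add: Q_hat_def outer_def vec_eq_iff transpose_def mult.commute)

text \<open>With an empty window, inversion of 0 gives 0 and \<open>Qhat\<close> would be the zero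
  matrix.\<close>

lemma count_stat_nonzero:
  assumes "det (Qhat z) \<noteq> 0"
  shows "count_stat z \<noteq> 0"
proof
  assume "count_stat z = 0"
  then have "Qhat z = 0"
    by (simp add: Q_hat_eq)
  then have "(mat 1 :: real ^ 'n ^ 'n) = 0"
    using assms matrix_mul_inv[of "Qhat z"] by (simp add: invertible_det_nz)
  then have "(mat 1 :: real ^ 'n ^ 'n) $ undefined $ undefined = 0"
    by simp
  then show False
    by (simp add: mat_def)
qed

lemma theta_hat_eq:
  assumes "det (Qhat z) \<noteq> 0"
  shows "theta_hat m h n z = \<theta> + \<Delta> z"
proof -
  have "fst v *\<^sub>R M (snd v) = outer (M (snd v)) (M (snd v)) *v \<theta> + err v *\<^sub>R M (snd v)" for v
    by (simp add: outer_mult_vec err_def win_basis_def scaleR_left_diff_distrib)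
  then have "(\<Sum>i = 1..n. fst (z i) *\<^sub>R M (snd (z i))) /\<^sub>R win_count h n z
      = Qhat z *v \<theta> + (\<Sum>i = 1..n. err (z i) *\<^sub>R M (snd (z i))) /\<^sub>R win_count h n z"
    by (simp add: Q_hat_def scaleR_matrix_vector_assoc[symmetric] sum_matrix_vector_mult
        sum.distrib scaleR_right_distrib)
  also have "(\<Sum>i = 1..n. err (z i) *\<^sub>R M (snd (z i))) /\<^sub>R win_count h n z
      = score_vec z /\<^sub>R count_stat z"
    by (simp add: inverse_count_stat score_vec_def score_stat_def linear_stat_def vec_eq_iff)
  finally show ?thesis
    using assms by (simp add: theta_hat_def \<Delta>_def matrix_vector_right_distrib
        matrix_vector_mul_assoc matrix_inv_mul invertible_det_nz)
qed

text \<open>All observations of a cluster share the regressor \<open>X g\<close>, so estimating the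
  coefficients shifts the cluster sum by the cluster size times one common number.\<close>

lemma cluster_score_eq:
  assumes "det (Qhat z) \<noteq> 0" "g \<in> W"
  shows "cluster_score m h n z (x g)
    = (linear_stat (score g) n z - linear_stat (at_point g) n z * (X g \<bullet> \<Delta> z)) *\<^sub>R X g"
proof -
  have "(of_bool (snd (z i) = x g) * residual m h n z i) *\<^sub>R M (snd (z i))
      = (score g (z i) - at_point g (z i) * (X g \<bullet> \<Delta> z)) *\<^sub>R X g" for i
    using assms by (cases "snd (z i) = x g")
      (simp_all add: residual_def theta_hat_eq score_def at_point_def err_def inner_add_right)
  then show ?thesis
    by (simp add: cluster_score_def linear_stat_def sum_subtractf sum_distrib_right
        flip: scaleR_left.sum)
qed

lemma cluster_score_outside:
  assumes "g \<in> {1..G} - W"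
  shows "cluster_score m h n z (x g) = 0"
  unfolding cluster_score_def
  by (rule sum.neutral) (use assms in \<open>auto simp: win_basis_def window_def\<close>)

text \<open>Multiplication by \<open>count_stat\<close> exchanges the random normalisation of the
  estimator for \<open>nw\<close>, leaving a sum of squares over clusters.\<close>

lemma crv_hat_eq:
  assumes "det (Qhat z) \<noteq> 0"
  shows "crv_hat m e h G x n z * count_stat z
    = (\<Sum>g\<in>W. ((qhat z \<bullet> X g)
        * (linear_stat (score g) n z - linear_stat (at_point g) n z * (X g \<bullet> \<Delta> z)))\<^sup>2) / nw"
proof -
  let ?J = "\<lambda>g. cluster_score m h n z (x g)"
  have inv: "e \<bullet> (matrix_inv (Qhat z) *v v) = qhat z \<bullet> v" for v
    unfolding qhat_def
    by (metis assms inner_matrix_vector_transpose invertible_det_nz matrix_inv_transpose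
        transpose_Q_hat)
  have "(\<Sum>g = 1..G. outer (?J g) (?J g)) = (\<Sum>g\<in>W. outer (?J g) (?J g))"
    by (rule sum.mono_neutral_right)
      (auto simp: cluster_score_outside outer_def vec_eq_iff dest: W_subset)
  then have "crv_hat m e h G x n z
      = qhat z \<bullet> (((\<Sum>g\<in>W. outer (?J g) (?J g)) /\<^sub>R win_count h n z) *v qhat z)"
    by (simp add: crv_hat_def inv qhat_def flip: matrix_vector_mul_assoc)
  also have "\<dots> = (\<Sum>g\<in>W. (qhat z \<bullet> ?J g)\<^sup>2) * inverse (win_count h n z)"
    by (simp add: scaleR_matrix_vector_assoc[symmetric] sum_matrix_vector_mult outer_mult_vec
        inner_sum_right power2_eq_square inner_commute)
  finally have "crv_hat m e h G x n z * count_stat z = (\<Sum>g\<in>W. (qhat z \<bullet> ?J g)\<^sup>2) / nw"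
    using count_stat_nonzero[OF assms] by (simp add: inverse_count_stat)
  also have "(\<Sum>g\<in>W. (qhat z \<bullet> ?J g)\<^sup>2) = (\<Sum>g\<in>W. ((qhat z \<bullet> X g)
        * (linear_stat (score g) n z - linear_stat (at_point g) n z * (X g \<bullet> \<Delta> z)))\<^sup>2)"
    by (intro sum.cong refl) (simp add: cluster_score_eq assms mult.commute)
  finally show ?thesis .
qed

text \<open>Both square roots are Euclidean norms over the clusters, so Minkowski's inequality in
  both directions avoids cross terms. In the splitting \<open>w' = w + d1 + d2\<close>, the error of
  \<open>qhat\<close> meets only the scores and \<open>\<Delta>\<close> meets only the cluster
  sizes.\<close>

lemma crv_hat_deviation:
  assumes "det (Qhat z) \<noteq> 0"
  shows "\<bar>sqrt (crv_hat m e h G x n z * count_stat z) - sqrt (main_stat z / nw)\<bar>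
    \<le> K * norm (qhat z - q) * sqrt (score_mass z)
      + K\<^sup>2 * norm (qhat z) * norm (\<Delta> z) * sqrt (count_mass z)"
proof -
  define U where "U g = linear_stat (score g) n z" for g
  define N where "N g = linear_stat (at_point g) n z" for g
  define w where "w g = (q \<bullet> X g) * U g / sqrt nw" for g
  define w' where "w' g = (qhat z \<bullet> X g) * (U g - N g * (X g \<bullet> \<Delta> z)) / sqrt nw" for g
  define d1 where "d1 g = ((qhat z - q) \<bullet> X g) * U g / sqrt nw" for g
  define d2 where "d2 g = - ((qhat z \<bullet> X g) * (X g \<bullet> \<Delta> z) * N g / sqrt nw)" for g
  have inner_le: "\<bar>y \<bullet> X g\<bar> \<le> K * norm y" if "g \<in> W" for y g
    using Cauchy_Schwarz_ineq2[of y "X g"] mult_left_mono[OF X_bound[OF that], of "norm y"]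
    by (simp add: mult.commute)
  have w: "L2_set w W = sqrt (main_stat z / nw)"
    unfolding w_def L2_set_scaled[OF nw_pos]
    by (simp add: main_stat_def wt_def U_def power_mult_distrib)
  have w': "L2_set w' W = sqrt (crv_hat m e h G x n z * count_stat z)"
    unfolding w'_def L2_set_scaled[OF nw_pos] crv_hat_eq[OF assms] U_def N_def ..
  have "L2_set d1 W \<le> (K * norm (qhat z - q)) * L2_set (\<lambda>g. U g / sqrt nw) W"
  proof (rule L2_set_le_mult)
    fix g assume "g \<in> W"
    then show "\<bar>d1 g\<bar> \<le> K * norm (qhat z - q) * \<bar>U g / sqrt nw\<bar>"
      using mult_right_mono[OF inner_le, of g "\<bar>U g / sqrt nw\<bar>" "qhat z - q"]
      by (simp add: d1_def abs_mult)
  qed (use K in simp)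
  then have d1: "L2_set d1 W \<le> K * norm (qhat z - q) * sqrt (score_mass z)"
    by (simp add: L2_set_scaled[OF nw_pos] score_mass_def U_def)
  have "L2_set d2 W \<le> (K\<^sup>2 * norm (qhat z) * norm (\<Delta> z)) * L2_set (\<lambda>g. N g / sqrt nw) W"
  proof (rule L2_set_le_mult)
    fix g assume g: "g \<in> W"
    have "\<bar>(qhat z \<bullet> X g) * (X g \<bullet> \<Delta> z)\<bar> \<le> (K * norm (qhat z)) * (K * norm (\<Delta> z))"
      unfolding abs_mult using inner_le[OF g, of "qhat z"] inner_le[OF g, of "\<Delta> z"] K
      by (intro mult_mono) (auto simp: inner_commute)
    from mult_right_mono[OF this, of "\<bar>N g / sqrt nw\<bar>"]
    show "\<bar>d2 g\<bar> \<le> K\<^sup>2 * norm (qhat z) * norm (\<Delta> z) * \<bar>N g / sqrt nw\<bar>"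
      by (simp add: d2_def abs_mult power2_eq_square mult_ac)
  qed simp
  then have d2: "L2_set d2 W \<le> K\<^sup>2 * norm (qhat z) * norm (\<Delta> z) * sqrt (count_mass z)"
    by (simp add: L2_set_scaled[OF nw_pos] count_mass_def N_def)
  have neg: "L2_set (\<lambda>g. - f g) W = L2_set f W" for f :: "nat \<Rightarrow> real"
    by (simp add: L2_set_def)
  have eq: "w' g = w g + (d1 g + d2 g)" for g
    by (simp add: w'_def w_def d1_def d2_def inner_diff_left diff_divide_distrib add_divide_distrib
        algebra_simps)
  have "L2_set w' W \<le> L2_set w W + (L2_set d1 W + L2_set d2 W)"
    unfolding eq using L2_set_triangle_ineq[of w "\<lambda>g. d1 g + d2 g" W]
      L2_set_triangle_ineq[of d1 d2 W] by linarith
  moreover have "L2_set w W \<le> L2_set w' W + (L2_set d1 W + L2_set d2 W)"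
    using L2_set_triangle_ineq[of w' "\<lambda>g. - (d1 g + d2 g)" W]
      L2_set_triangle_ineq[of d1 d2 W] neg[of "\<lambda>g. d1 g + d2 g"] by (simp add: eq)
  ultimately show ?thesis
    using d1 d2 unfolding w w' by linarith
qed

lemma
  shows integrable_gram: "integrable S (\<lambda>\<omega>. (norm (gram (zs \<omega>) - Q))\<^sup>2)"
    and integral_gram:
      "(\<integral>\<omega>. (norm (gram (zs \<omega>) - Q))\<^sup>2 \<partial>S) \<le> (real CARD('n))\<^sup>2 * K ^ 4 / nw"
    and integrable_score_vec: "integrable S (\<lambda>\<omega>. (norm (score_vec (zs \<omega>)))\<^sup>2)"
    and integral_score_vec:
      "(\<integral>\<omega>. (norm (score_vec (zs \<omega>)))\<^sup>2 \<partial>S) \<le> real CARD('n) * (K\<^sup>2 * (1 + B)) / nw"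
proof -
  show "integrable S (\<lambda>\<omega>. (norm (gram (zs \<omega>) - Q))\<^sup>2)"
    using integrable_gram_stat by (simp add: norm_matrix_square gram_def)
  have "(\<integral>\<omega>. (norm (gram (zs \<omega>) - Q))\<^sup>2 \<partial>S)
      = (\<Sum>j\<in>UNIV. \<Sum>k\<in>UNIV. \<integral>\<omega>. (gram_stat (zs \<omega>) j k - Q $ j $ k)\<^sup>2 \<partial>S)"
    using integrable_gram_stat by (simp add: norm_matrix_square gram_def)
  also have "\<dots> \<le> (\<Sum>j\<in>(UNIV :: 'n set). \<Sum>k\<in>(UNIV :: 'n set). K ^ 4 / nw)"
    by (intro sum_mono integral_gram_stat)
  finally show "(\<integral>\<omega>. (norm (gram (zs \<omega>) - Q))\<^sup>2 \<partial>S) \<le> (real CARD('n))\<^sup>2 * K ^ 4 / nw"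
    by (simp add: power2_eq_square)
  show "integrable S (\<lambda>\<omega>. (norm (score_vec (zs \<omega>)))\<^sup>2)"
    using integrable_score_stat by (simp add: norm_vector_square score_vec_def)
  have "(\<integral>\<omega>. (norm (score_vec (zs \<omega>)))\<^sup>2 \<partial>S) = (\<Sum>j\<in>UNIV. \<integral>\<omega>. (score_stat (zs \<omega>) j)\<^sup>2 \<partial>S)"
    using integrable_score_stat by (simp add: norm_vector_square score_vec_def)
  also have "\<dots> \<le> (\<Sum>j\<in>(UNIV :: 'n set). K\<^sup>2 * (1 + B) / nw)"
    by (intro sum_mono integral_score_stat)
  finally show "(\<integral>\<omega>. (norm (score_vec (zs \<omega>)))\<^sup>2 \<partial>S) \<le> real CARD('n) * (K\<^sup>2 * (1 + B)) / nw"
    by simp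
qed

text \<open>
  The scale \<open>l\<^sup>2 = nw * sqrt (1 / nw + \<rho>)\<close> balances the errors of order \<open>1 / nw\<close> against the cluster
  masses, which are of order \<open>1 + nw * \<rho>\<close>.
\<close>
lemma sample_expansion:
  assumes b: "norm (matrix_inv Q *v e) \<le> b" and c: "0 < c" "c \<le> T" and nw1: "1 \<le> nw"
  obtains \<xi> where "integrable S \<xi>" "\<And>\<omega>. 0 \<le> \<xi> \<omega>"
    and "\<And>\<omega> \<tau>. (det (Qhat (zs \<omega>)) \<noteq> 0 \<Longrightarrow> \<tau> = crv_hat m e h G x n (zs \<omega>))
      \<Longrightarrow> \<exists>d. crv_expansion Q e K T \<tau> (\<xi> \<omega>) d"
    and "(\<integral>\<omega>. \<xi> \<omega> \<partial>S) \<le> (3 + (real CARD('n))\<^sup>2 * K ^ 4 + real CARD('n) * (K\<^sup>2 * (1 + B)) + B + B\<^sup>2)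
          * sqrt (1 / nw + \<rho>)
        + 3 * (((b * K)\<^sup>2)\<^sup>2 * B / (nw * c\<^sup>2)
          + 4 * (((b * K)\<^sup>2)\<^sup>2 * ((1 + B)\<^sup>2 + B ^ 4) * \<rho>) / c\<^sup>2
          + 4 * ((b * K)\<^sup>2 * (1 + B) * \<rho>) / c)"
proof -
  \<comment> \<open>The square of \<open>l\<close> is the geometric mean of \<open>nw\<close>, the
    inverse order of the squared errors, and \<open>1 + nw * \<rho>\<close>, the order of the
    masses; both kinds of term then become multiples of \<open>\<sigma>\<close>.\<close>
  define \<sigma> where "\<sigma> = sqrt (1 / nw + \<rho>)"
  define l where "l = sqrt (nw * \<sigma>)"
  define \<xi> where "\<xi> \<omega> = l\<^sup>2 * (count_stat (zs \<omega>) - 1)\<^sup>2 + l\<^sup>2 * (norm (gram (zs \<omega>) - Q))\<^sup>2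
    + l\<^sup>2 * (norm (score_vec (zs \<omega>)))\<^sup>2 + score_mass (zs \<omega>) / l\<^sup>2 + count_mass (zs \<omega>) / l\<^sup>2
    + (main_stat (zs \<omega>) / (nw * T) - 1)\<^sup>2" for \<omega>
  have T: "0 < T"
    using c by simp
  have \<sigma>: "0 < \<sigma>" "\<sigma>\<^sup>2 = 1 / nw + \<rho>"
    using nw_pos \<rho> by (simp_all add: \<sigma>_def add_pos_nonneg)
  have l2: "l\<^sup>2 = nw * \<sigma>"
    using nw_pos \<sigma> by (simp add: l_def)
  have "1 \<le> (nw * \<sigma>)\<^sup>2"
  proof -
    have "(nw * \<sigma>)\<^sup>2 = nw + nw\<^sup>2 * \<rho>"
      unfolding power_mult_distrib \<sigma>(2) using nw_pos by (simp add: power2_eq_square field_simps)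
    then show ?thesis
      using nw1 \<rho> by (simp add: add_increasing2)
  qed
  then have "1 \<le> nw * \<sigma>"
    using nw_pos \<sigma>(1) by (intro power2_le_imp_le[of 1]) auto
  then have l1: "1 \<le> l"
    by (simp add: l_def)
  have mass: "0 \<le> score_mass z" "0 \<le> count_mass z" "0 \<le> main_stat z" for z
    using nw_pos wt_nonneg
    by (auto simp: score_mass_def count_mass_def main_stat_def intro!: sum_nonneg divide_nonneg_pos)
  have A: "wt g \<le> (b * K)\<^sup>2" if "g \<in> W" for g
  proof -
    have "\<bar>q \<bullet> X g\<bar> \<le> b * K"
      using Cauchy_Schwarz_ineq2[of q "X g"] b X_bound[OF that]
      by (metis (no_types, lifting) q_def mult_mono norm_ge_zero order_trans)
    from power_mono[OF this, of 2] show ?thesis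
      by (simp add: wt_def)
  qed
  note main = integrable_main_stat[OF A zero_le_power2 c] integral_main_stat[OF A zero_le_power2 c]
  note ints = integrable_count_stat integrable_gram integrable_score_vec integrable_score_mass
    integrable_count_mass main(1)
  show thesis
  proof (rule that[of \<xi>])
    show "integrable S \<xi>"
      unfolding \<xi>_def[abs_def] using ints by simp
    show "0 \<le> \<xi> \<omega>" for \<omega>
      using mass by (simp add: \<xi>_def)
    \<comment> \<open>\<open>\<tau>\<close> is tied to the estimator only for an invertible
      \<open>Qhat\<close>. It will be the estimator with the original regressors, which is known to
      agree with the normalised one only in that case.\<close>
    show "\<exists>d. crv_expansion Q e K T \<tau> (\<xi> \<omega>) d"
      if \<tau>: "det (Qhat (zs \<omega>)) \<noteq> 0 \<Longrightarrow> \<tau> = crv_hat m e h G x n (zs \<omega>)" for \<omega> \<tau>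
    proof (intro exI)
      let ?z = "zs \<omega>"
      have "0 \<le> \<tau> * count_stat ?z" if "det (Qhat ?z) \<noteq> 0"
        unfolding \<tau>[OF that] crv_hat_eq[OF that] using nw_pos by (intro divide_nonneg_pos sum_nonneg) auto
      moreover have "main_stat ?z / (nw * T) * T = main_stat ?z / nw"
        using T by simp
      ultimately show "crv_expansion Q e K T \<tau> (\<xi> \<omega>)
          (l, count_stat ?z, gram ?z, score_vec ?z, score_mass ?z, count_mass ?z,
           main_stat ?z / (nw * T))"
        using l1 mass nw_pos T crv_hat_deviation[of ?z] \<tau>
        by (simp add: crv_expansion_def \<xi>_def qhat_def q_def \<Delta>_def flip: Q_hat_eq)
    qed
    have "(\<integral>\<omega>. \<xi> \<omega> \<partial>S) = l\<^sup>2 * (\<integral>\<omega>. (count_stat (zs \<omega>) - 1)\<^sup>2 \<partial>S)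
        + l\<^sup>2 * (\<integral>\<omega>. (norm (gram (zs \<omega>) - Q))\<^sup>2 \<partial>S) + l\<^sup>2 * (\<integral>\<omega>. (norm (score_vec (zs \<omega>)))\<^sup>2 \<partial>S)
        + (\<integral>\<omega>. score_mass (zs \<omega>) \<partial>S) / l\<^sup>2 + (\<integral>\<omega>. count_mass (zs \<omega>) \<partial>S) / l\<^sup>2
        + (\<integral>\<omega>. (main_stat (zs \<omega>) / (nw * T) - 1)\<^sup>2 \<partial>S)"
      unfolding \<xi>_def using ints by simp
    also have "\<dots> \<le> l\<^sup>2 * (1 / nw) + l\<^sup>2 * ((real CARD('n))\<^sup>2 * K ^ 4 / nw)
        + l\<^sup>2 * (real CARD('n) * (K\<^sup>2 * (1 + B)) / nw)
        + ((1 + B) + B\<^sup>2 * (nw * \<rho>)) / l\<^sup>2 + (1 + 1 * (nw * \<rho>)) / l\<^sup>2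
        + 3 * (((b * K)\<^sup>2)\<^sup>2 * B / (nw * c\<^sup>2)
          + 4 * (((b * K)\<^sup>2)\<^sup>2 * ((1 + B)\<^sup>2 + B ^ 4) * \<rho>) / c\<^sup>2
          + 4 * ((b * K)\<^sup>2 * (1 + B) * \<rho>) / c)"
      by (intro add_mono mult_left_mono divide_right_mono integral_count_stat integral_gram
          integral_score_vec integral_score_mass integral_count_mass main(2)) auto
    \<comment> \<open>The 3 collects the window count, the count mass and the constant part of the
      score mass.\<close>
    also have "l\<^sup>2 * (1 / nw) + l\<^sup>2 * ((real CARD('n))\<^sup>2 * K ^ 4 / nw)
        + l\<^sup>2 * (real CARD('n) * (K\<^sup>2 * (1 + B)) / nw)
        + ((1 + B) + B\<^sup>2 * (nw * \<rho>)) / l\<^sup>2 + (1 + 1 * (nw * \<rho>)) / l\<^sup>2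
      \<le> (3 + (real CARD('n))\<^sup>2 * K ^ 4 + real CARD('n) * (K\<^sup>2 * (1 + B)) + B + B\<^sup>2) * \<sigma>"
    proof -
      have one: "l\<^sup>2 * (u / nw) = u * \<sigma>" for u
        using nw_pos by (simp add: l2)
      have two: "(1 + nw * \<rho>) / l\<^sup>2 = \<sigma>"
      proof -
        have "1 + nw * \<rho> = nw * \<sigma>\<^sup>2"
          using nw_pos by (simp add: \<sigma> field_simps)
        then show ?thesis
          unfolding l2 using nw_pos \<sigma>(1) by (simp add: power2_eq_square)
      qed
      \<comment> \<open>Coarsened to a multiple of \<open>1 + nw * \<rho>\<close>, which equals
        \<open>nw * \<sigma>^2\<close>.\<close>
      have "(1 + B) + B\<^sup>2 * (nw * \<rho>) \<le> (1 + B + B\<^sup>2) * (1 + nw * \<rho>)"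
        using B \<rho> nw_pos by (simp add: algebra_simps)
      then have "((1 + B) + B\<^sup>2 * (nw * \<rho>)) / l\<^sup>2 \<le> (1 + B + B\<^sup>2) * (1 + nw * \<rho>) / l\<^sup>2"
        by (rule divide_right_mono) simp
      also have "\<dots> = (1 + B + B\<^sup>2) * \<sigma>"
        using two by (simp flip: times_divide_eq_right)
      finally have three: "((1 + B) + B\<^sup>2 * (nw * \<rho>)) / l\<^sup>2 \<le> (1 + B + B\<^sup>2) * \<sigma>" .
      show ?thesis
        unfolding one using two three by (simp add: algebra_simps)
    qed
    finally show "(\<integral>\<omega>. \<xi> \<omega> \<partial>S)
        \<le> (3 + (real CARD('n))\<^sup>2 * K ^ 4 + real CARD('n) * (K\<^sup>2 * (1 + B)) + B + B\<^sup>2)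
          * sqrt (1 / nw + \<rho>)
        + 3 * (((b * K)\<^sup>2)\<^sup>2 * B / (nw * c\<^sup>2)
          + 4 * (((b * K)\<^sup>2)\<^sup>2 * ((1 + B)\<^sup>2 + B ^ 4) * \<rho>) / c\<^sup>2
          + 4 * ((b * K)\<^sup>2 * (1 + B) * \<rho>) / c)"
      by (simp add: \<sigma>_def)
  qed
qed

end

section \<open>Polynomial regressors\<close>

lemma (in iid_data) borel_measurable_crv_hat:
  fixes m :: "real \<Rightarrow> real ^ 'n"
  assumes [measurable]: "m \<in> borel_measurable borel"
  shows "(\<lambda>\<omega>. crv_hat m e h G x n (\<lambda>i. Z i \<omega>)) \<in> borel_measurable S"
proof -
  have X: "(\<lambda>\<omega>. snd (Z i \<omega>)) \<in> borel_measurable S" and Y: "(\<lambda>\<omega>. fst (Z i \<omega>)) \<in> borel_measurable S"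
    if "i \<in> {1..n}" for i
    using that by (auto intro!: borel_measurable_obs borel_measurable_continuous_onI continuous_intros)
  have M: "(\<lambda>\<omega>. win_basis m h (snd (Z i \<omega>))) \<in> borel_measurable S" if "i \<in> {1..n}" for i
  proof -
    have "win_basis m h \<in> borel_measurable borel"
      unfolding win_basis_def[abs_def] by measurable
    then show ?thesis
      by (rule measurable_compose[OF X[OF that]])
  qed
  have ind: "(\<lambda>\<omega>. of_bool (snd (Z i \<omega>) = t) :: real) \<in> borel_measurable S"
    "(\<lambda>\<omega>. of_bool (\<bar>snd (Z i \<omega>)\<bar> \<le> h) :: real) \<in> borel_measurable S" if "i \<in> {1..n}" for i t
  proof -
    note [measurable] = X[OF that]
    show "(\<lambda>\<omega>. of_bool (snd (Z i \<omega>) = t) :: real) \<in> borel_measurable S"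
      "(\<lambda>\<omega>. of_bool (\<bar>snd (Z i \<omega>)\<bar> \<le> h) :: real) \<in> borel_measurable S"
      by measurable
  qed
  have count [measurable]: "(\<lambda>\<omega>. win_count h n (\<lambda>i. Z i \<omega>)) \<in> borel_measurable S"
    unfolding win_count_def by (intro borel_measurable_sum ind)
  have Q [measurable]: "(\<lambda>\<omega>. Q_hat m h n (\<lambda>i. Z i \<omega>)) \<in> borel_measurable S"
    unfolding Q_hat_def
    by (intro borel_measurable_scaleR borel_measurable_inverse count borel_measurable_sum
        borel_measurable_outer M)
  have sum [measurable]:
    "(\<lambda>\<omega>. \<Sum>i = 1..n. fst (Z i \<omega>) *\<^sub>R win_basis m h (snd (Z i \<omega>))) \<in> borel_measurable S"
    by (intro borel_measurable_sum borel_measurable_scaleR M Y)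
  have \<theta>: "(\<lambda>\<omega>. theta_hat m h n (\<lambda>i. Z i \<omega>)) \<in> borel_measurable S"
    unfolding theta_hat_def by measurable
  have J: "(\<lambda>\<omega>. cluster_score m h n (\<lambda>i. Z i \<omega>) t) \<in> borel_measurable S" for t
    unfolding cluster_score_def residual_def
    by (intro borel_measurable_sum borel_measurable_scaleR borel_measurable_times
        borel_measurable_diff borel_measurable_inner M Y \<theta> ind)
  have "(\<lambda>\<omega>. \<Sum>g = 1..G. outer (cluster_score m h n (\<lambda>i. Z i \<omega>) (x g))
      (cluster_score m h n (\<lambda>i. Z i \<omega>) (x g))) \<in> borel_measurable S"
    by (intro borel_measurable_sum borel_measurable_outer J)
  note [measurable] = this
  show ?thesis
    unfolding crv_hat_def by measurable
qed

text \<open>Each regressor is homogeneous under positive scaling, the sign indicator included.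
  Normalised regressors are therefore the basis at \<open>x / h\<close>, with entries bounded by 1
  on the window.\<close>

lemma rd_entry_scale:
  assumes "0 < h"
  shows "rd_entry p x j = rd_entry p h j * rd_entry p (x / h) j"
  using assms by (simp add: rd_entry_def power_divide zero_le_divide_iff)

lemma rd_entry_pos: "0 < h \<Longrightarrow> 0 < rd_entry p h j"
  by (simp add: rd_entry_def)

lemma rd_entry_le_1: "\<bar>t\<bar> \<le> 1 \<Longrightarrow> \<bar>rd_entry p t j\<bar> \<le> 1"
  by (auto simp: rd_entry_def power_abs power_le_one)

lemma borel_measurable_rd_basis [measurable]: "rd_basis p idx \<in> borel_measurable borel"
proof (rule borel_measurable_vecI)
  show "(\<lambda>t. rd_basis p idx t $ i) \<in> borel_measurable borel" for i
    unfolding rd_basis_def rd_entry_def by simp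
qed

lemma norm_rd_basis_le:
  fixes idx :: "'n::finite \<Rightarrow> nat"
  assumes "\<bar>t\<bar> \<le> 1"
  shows "norm (rd_basis p idx t) \<le> real CARD('n)"
proof -
  have "norm (rd_basis p idx t) \<le> (\<Sum>i\<in>UNIV. \<bar>rd_basis p idx t $ i\<bar>)"
    by (rule norm_le_l1_cart)
  also have "\<dots> \<le> (\<Sum>i\<in>(UNIV :: 'n set). 1)"
    by (intro sum_mono) (simp add: rd_basis_def rd_entry_le_1 assms)
  finally show ?thesis
    by simp
qed

lemma diag_mult_vec: "diag v *v w = (\<chi> j. v $ j * w $ j)"
proof -
  have "(\<Sum>j\<in>UNIV. (if i = j then v $ i else 0) * w $ j)
      = (\<Sum>j\<in>UNIV. if i = j then v $ i * w $ i else 0)" for i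
    by (intro sum.cong) auto
  then show ?thesis
    by (simp add: diag_def matrix_vector_mult_def vec_eq_iff)
qed

lemma
  fixes v :: "real ^ 'n"
  assumes "\<And>j. v $ j \<noteq> 0"
  shows matrix_inv_diag: "matrix_inv (diag v) = diag (\<chi> j. 1 / v $ j)"
    and invertible_diag: "invertible (diag v)"
proof -
  have inv: "diag v ** diag (\<chi> j. 1 / v $ j) = mat 1"
    using assms
    by (simp add: matrix_eq diag_mult_vec vec_eq_iff flip: matrix_vector_mul_assoc)
  then show "matrix_inv (diag v) = diag (\<chi> j. 1 / v $ j)"
    by (rule matrix_inv_unique)
  show "invertible (diag v)"
    unfolding invertible_right_inverse using inv by blast
qed

lemma transpose_diag: "transpose (diag v) = diag v"
  by (simp add: diag_def transpose_def vec_eq_iff)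

lemma normalizer:
  fixes p :: nat and idx :: "'n::finite \<Rightarrow> nat" and h x :: real
  assumes h: "0 < h"
  defines "A \<equiv> matrix_inv (diag (rd_basis p idx h))"
  shows "invertible A" "transpose A = A" "A *v rd_basis p idx x = rd_basis p idx (x / h)"
    and "A *v first_unit idx = first_unit idx"
proof -
  have nz: "rd_basis p idx h $ j \<noteq> 0" for j
    using rd_entry_pos[OF h, of p "idx j"] by (simp add: rd_basis_def)
  have A: "A = diag (\<chi> j. 1 / rd_basis p idx h $ j)"
    unfolding A_def by (rule matrix_inv_diag[OF nz])
  show "invertible A"
    unfolding A by (rule invertible_diag) (use nz in simp)
  show "transpose A = A"
    by (simp add: A transpose_diag)
  show "A *v rd_basis p idx x = rd_basis p idx (x / h)"
    using nz by (simp add: A diag_mult_vec vec_eq_iff rd_basis_def rd_entry_scale[OF h, of p x])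
  show "A *v first_unit idx = first_unit idx"
    using h by (simp add: A diag_mult_vec vec_eq_iff first_unit_def rd_basis_def rd_entry_def)
qed

lemma power4_sum_le: "((a::real) + b) ^ 4 \<le> 8 * (a ^ 4 + b ^ 4)"
proof -
  have sq: "(s + t)\<^sup>2 \<le> 2 * (s\<^sup>2 + t\<^sup>2)" for s t :: real
    using zero_le_power2[of "s - t"] by (simp add: power2_sum power2_diff)
  have twice: "(2 * s)\<^sup>2 = 4 * s\<^sup>2" for s :: real
    by (simp add: power_mult_distrib)
  have "(a + b) ^ 4 = ((a + b)\<^sup>2)\<^sup>2"
    by (simp flip: power_mult)
  also have "\<dots> \<le> (2 * (a\<^sup>2 + b\<^sup>2))\<^sup>2"
    by (intro power_mono sq) simp
  also have "\<dots> = 4 * (a\<^sup>2 + b\<^sup>2)\<^sup>2"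
    by (rule twice)
  also have "\<dots> \<le> 4 * (2 * ((a\<^sup>2)\<^sup>2 + (b\<^sup>2)\<^sup>2))"
    by (intro mult_left_mono sq) simp
  finally have "(a + b) ^ 4 \<le> 4 * (2 * ((a\<^sup>2)\<^sup>2 + (b\<^sup>2)\<^sup>2))" .
  moreover have "(s\<^sup>2)\<^sup>2 = s ^ 4" for s :: real
    by (simp flip: power_mult)
  ultimately show ?thesis
    by simp
qed

text \<open>Conditions are given for \<open>\<epsilon>\<close> under the conditional law, whereas
  the moment bounds use \<open>u = \<epsilon> + \<delta>\<close> under \<open>P\<close>. At a fixed
  point \<open>\<delta>\<close> is a constant, and conditioning only contributes the factor
  \<open>point_prob P y\<close>.\<close>

lemma
  fixes P :: "(real \<times> real) measure" and m :: "real \<Rightarrow> real ^ 'n"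
  assumes P: "prob_space P" and sets_P: "sets P = sets borel" and pos: "0 < point_prob P y"
    and m: "m \<in> borel_measurable borel"
    and int: "integrable (cond_law P y) (\<lambda>z. (fst z - cond_mean P (snd z)) ^ 4)"
    and B1: "(\<integral>z. (fst z - cond_mean P (snd z)) ^ 4 \<partial>cond_law P y) \<le> B1"
    and B2: "\<bar>approx_bias m h P y\<bar> \<le> B2"
  shows integrable_error4: "integrable P (\<lambda>z. of_bool (snd z = y) * (fst z - m (snd z) \<bullet> theta_pop m h P) ^ 4)"
    and integral_error4: "(\<integral>z. of_bool (snd z = y) * (fst z - m (snd z) \<bullet> theta_pop m h P) ^ 4 \<partial>P)
      \<le> 8 * (B1 + B2 ^ 4) * point_prob P y"
proof -
  interpret prob_space P by fact
  have space_P [simp]: "space P = UNIV"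
    using sets_eq_imp_space_eq[OF sets_P] by simp
  let ?A = "{z :: real \<times> real. snd z = y}"
  let ?\<epsilon> = "\<lambda>z. (fst z - cond_mean P (snd z)) ^ 4"
  let ?u = "\<lambda>z. (fst z - m (snd z) \<bullet> theta_pop m h P) ^ 4"
  let ?\<delta> = "approx_bias m h P y"
  have "?A \<in> sets borel"
    by (intro borel_closed closed_Collect_eq continuous_intros)
  then have A: "?A \<in> sets P"
    by (simp add: sets_P)
  have law: "cond_law P y = uniform_measure P ?A" and pp: "point_prob P y = prob ?A"
    by (simp_all add: cond_law_def point_prob_def)
  have \<epsilon>: "?\<epsilon> \<in> borel_measurable P"
    using borel_measurable_integrable[OF int] by (simp add: law)
  note uniform = integral_uniform_measure[OF A \<epsilon> pos[unfolded pp]]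
  have int\<epsilon>: "integrable P (\<lambda>z. indicator ?A z * ?\<epsilon> z)"
    using int by (simp add: law uniform)
  have le\<epsilon>: "(\<integral>z. indicator ?A z * ?\<epsilon> z \<partial>P) \<le> B1 * point_prob P y"
    using B1 pos by (simp add: law uniform pp pos_divide_le_eq)
  have bound: "of_bool (snd z = y) * ?u z
      \<le> 8 * (indicator ?A z * ?\<epsilon> z + indicator ?A z * ?\<delta> ^ 4)" for z
  proof (cases "snd z = y")
    case True
    have eq: "fst z - m (snd z) \<bullet> theta_pop m h P = (fst z - cond_mean P (snd z)) + ?\<delta>"
      by (simp add: True approx_bias_def)
    show ?thesis
      unfolding eq using True power4_sum_le[of "fst z - cond_mean P (snd z)" ?\<delta>] by simp
  qed simp
  have intb: "integrable P (\<lambda>z. 8 * (indicator ?A z * ?\<epsilon> z + indicator ?A z * ?\<delta> ^ 4))"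
    using int\<epsilon> A by (simp add: integrable_indicator_iff emeasure_eq_measure)
  have fs: "fst \<in> borel_measurable P" "snd \<in> borel_measurable P"
    unfolding measurable_cong_sets[OF sets_P refl]
    by (intro borel_measurable_continuous_onI continuous_intros)+
  have eq: "(\<lambda>z. of_bool (snd z = y) * ?u z) = (\<lambda>z. indicator ?A z * ?u z)"
    by (auto split: split_indicator)
  have "(\<lambda>z. indicator ?A z * ?u z) \<in> borel_measurable P"
    by (intro borel_measurable_times borel_measurable_indicator A borel_measurable_power
        borel_measurable_diff borel_measurable_inner fs borel_measurable_const
        measurable_compose[OF fs(2) m])
  then have meas: "(\<lambda>z. of_bool (snd z = y) * ?u z) \<in> borel_measurable P"
    unfolding eq .
  have nonneg: "0 \<le> of_bool (snd z = y) * ?u z" for z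
    by simp
  have "norm (of_bool (snd z = y) * ?u z)
      \<le> norm (8 * (indicator ?A z * ?\<epsilon> z + indicator ?A z * ?\<delta> ^ 4))" for z
    unfolding real_norm_def using bound[of z] nonneg[of z] by linarith
  then show int_u: "integrable P (\<lambda>z. of_bool (snd z = y) * ?u z)"
    by (intro Bochner_Integration.integrable_bound[OF intb meas] AE_I2)
  have "(\<integral>z. of_bool (snd z = y) * ?u z \<partial>P)
      \<le> (\<integral>z. 8 * (indicator ?A z * ?\<epsilon> z + indicator ?A z * ?\<delta> ^ 4) \<partial>P)"
    by (intro integral_mono int_u intb bound)
  also have "\<dots> = 8 * ((\<integral>z. indicator ?A z * ?\<epsilon> z \<partial>P) + ?\<delta> ^ 4 * point_prob P y)"
    using int\<epsilon> A by (simp add: integrable_indicator_iff emeasure_eq_measure pp)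
  also have "\<dots> \<le> 8 * (B1 * point_prob P y + B2 ^ 4 * point_prob P y)"
  proof -
    have "?\<delta> ^ 4 \<le> B2 ^ 4"
      using power_mono[OF B2, of 4] by simp
    then show ?thesis
      using le\<epsilon> pos by (intro mult_left_mono add_mono mult_right_mono) auto
  qed
  finally show "(\<integral>z. of_bool (snd z = y) * ?u z \<partial>P) \<le> 8 * (B1 + B2 ^ 4) * point_prob P y"
    by (simp add: algebra_simps)
qed

section \<open>Passage to the limit along the triangular array\<close>

theorem theorem2:
  fixes p :: nat
    and idx :: "'n::finite \<Rightarrow> nat"
    and S :: "nat \<Rightarrow> 'w measure"
    and Z :: "nat \<Rightarrow> nat \<Rightarrow> 'w \<Rightarrow> real \<times> real"
    and P :: "nat \<Rightarrow> (real \<times> real) measure"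
    and Gm Gp :: "nat \<Rightarrow> nat"
    and x :: "nat \<Rightarrow> nat \<Rightarrow> real"
    and h :: "nat \<Rightarrow> real"
  defines "m \<equiv> rd_basis p idx"
    and "e1 \<equiv> first_unit idx"
    and "G \<equiv> \<lambda>N. Gm N + Gp N"
  assumes idx: "bij_betw idx UNIV {..<2 * p + 2}"
    and model: "rd_model S Z P Gm Gp x h"
    and reg_i: "regularity_i m P G x h"
    and reg_ii: "regularity_ii m P G x h"
    and many_points: "filterlim (\<lambda>N. card (window (h N) (G N) (x N))) at_top sequentially"
    and small_points: "(\<lambda>N. Max ((\<lambda>g. point_prob (P N) (x N g) / win_prob (h N) (P N))
                                 ` window (h N) (G N) (x N))) \<longlonglongrightarrow> 0"
    and nondegenerate:
      "\<exists>c>0. \<forall>\<^sub>F N in sequentially. c \<le> crv_pop m e1 (h N) (P N) (G N) (x N) N"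
  shows "\<exists>R. tendsto_zero_in_prob S R \<and>
    (\<forall>\<^sub>F N in sequentially. \<forall>\<omega>\<in>space (S N).
       crv_hat m e1 (h N) (G N) (x N) N (\<lambda>i. Z N i \<omega>)
       = (1 + R N \<omega>) * crv_pop m e1 (h N) (P N) (G N) (x N) N)"
proof -
  define A where "A N = matrix_inv (diag (m (h N)))" for N
  define m' where "m' N = (\<lambda>t. A N *v m t)" for N
  define Q where "Q N = Q_pop (m' N) (h N) (P N)" for N
  define T where "T N = crv_pop m e1 (h N) (P N) (G N) (x N) N" for N
  define That where "That N \<omega> = crv_hat m e1 (h N) (G N) (x N) N (\<lambda>i. Z N i \<omega>)" for N \<omega>
  define W where "W N = window (h N) (G N) (x N)" for N
  \<comment> \<open>The absolute value makes \<open>\<rho> N\<close> nonnegative for every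
    \<open>N\<close>, even where the window is empty and \<open>Max\<close> has no meaning.\<close>
  define \<rho> where "\<rho> N = \<bar>Max ((\<lambda>g. point_prob (P N) (x N g) / win_prob (h N) (P N)) ` W N)\<bar>" for N
  define nw where "nw N = real N * win_prob (h N) (P N)" for N
  define K where "K = real CARD('n)"

  have model: "iid_sample (S N) N (Z N) (P N)" "integrable (P N) fst"
    "discrete_running_variable (P N) (Gm N) (Gp N) (x N)" "0 < h N" if "1 \<le> N" for N
    using model that by (auto simp: rd_model_def)
  obtain B1 C where B1: "\<And>N g. 1 \<le> N \<Longrightarrow> g \<in> {1..G N} \<Longrightarrow>
        integrable (cond_law (P N) (x N g)) (\<lambda>z. (fst z - cond_mean (P N) (snd z)) ^ 4) \<and>
        (\<integral>z. (fst z - cond_mean (P N) (snd z)) ^ 4 \<partial>cond_law (P N) (x N g)) \<le> B1"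
    and C: "0 < C" "\<And>N. 1 \<le> N \<Longrightarrow> C < det (normalize_mat m (h N) (Q_pop m (h N) (P N)))"
    and nw: "filterlim nw at_top sequentially"
    and conv: "convergent (\<lambda>N. normalize_mat m (h N) (Q_pop m (h N) (P N)))"
    using reg_i unfolding regularity_i_def nw_def[abs_def] by blast
  obtain B2 where B2: "\<And>N g. 1 \<le> N \<Longrightarrow> g \<in> W N \<Longrightarrow> \<bar>approx_bias m (h N) (P N) (x N g)\<bar> \<le> B2"
    using reg_ii unfolding regularity_ii_def W_def by blast
  obtain c where c: "0 < c" "\<forall>\<^sub>F N in sequentially. c \<le> T N"
    using nondegenerate unfolding T_def by blast
  \<comment> \<open>One constant for the fourth moments of \<open>u\<close> and for the bias.
    Absolute values are taken because the bounds obtained carry no sign information.\<close>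
  define B where "B = 8 * (\<bar>B1\<bar> + \<bar>B2\<bar> ^ 4) + \<bar>B2\<bar>"

  have A: "invertible (A N)" "transpose (A N) = A N" "A N *v m t = rd_basis p idx (t / h N)"
    "A N *v e1 = e1" if "1 \<le> N" for N t
    using normalizer[OF model(4)[OF that], where p=p and idx=idx] by (auto simp: A_def m_def e1_def)
  have norm_Q: "normalize_mat m (h N) (Q_pop m (h N) (P N)) = Q N" if "1 \<le> N" for N
    using Q_pop_linear[OF A(1)[OF that], of m "h N" "P N"] A(2)[OF that]
    by (simp add: normalize_mat_def Q_def m'_def A_def)
  have Q_inv: "invertible (Q N)" "invertible (Q_pop m (h N) (P N))" if N: "1 \<le> N" for N
  proof -
    have "0 < det (Q N)"
      using C(1) C(2)[OF N] by (simp add: norm_Q[OF N])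
    then show "invertible (Q N)"
      by (simp add: invertible_det_nz)
    have "Q N = A N ** Q_pop m (h N) (P N) ** transpose (A N)"
      unfolding Q_def m'_def by (rule Q_pop_linear[OF A(1)[OF N]])
    then show "invertible (Q_pop m (h N) (P N))"
      using \<open>0 < det (Q N)\<close> by (auto simp: invertible_det_nz det_mul)
  qed
  obtain Q0 where "(\<lambda>N. normalize_mat m (h N) (Q_pop m (h N) (P N))) \<longlonglongrightarrow> Q0"
    using conv by (auto simp: convergent_def)
  then have Q0: "Q \<longlonglongrightarrow> Q0"
    by (rule Lim_transform_eventually)
      (use norm_Q in \<open>auto intro: eventually_sequentiallyI[of 1]\<close>)
  have "C \<le> det Q0"
  proof (rule tendsto_lowerbound[OF tendsto_det[OF Q0]])
    show "\<forall>\<^sub>F N in sequentially. C \<le> det (Q N)"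
      using C(2) norm_Q by (intro eventually_sequentiallyI[of 1]) (metis less_imp_le)
  qed simp
  then have det_Q0: "det Q0 \<noteq> 0"
    using C(1) by simp
  \<comment> \<open>The slack 1 above the limit makes the bound hold eventually.\<close>
  define b where "b = norm (matrix_inv Q0 *v e1) + 1"
  have "(\<lambda>N. norm (matrix_inv (Q N) *v e1)) \<longlonglongrightarrow> norm (matrix_inv Q0 *v e1)"
    by (intro tendsto_norm tendsto_matrix_vector_mult tendsto_matrix_inv Q0 det_Q0 tendsto_const)
  then have ev_b: "\<forall>\<^sub>F N in sequentially. norm (matrix_inv (Q N) *v e1) < b"
    by (rule order_tendstoD) (simp add: b_def)
  have \<rho>_lim: "\<rho> \<longlonglongrightarrow> 0"
    using tendsto_rabs[OF small_points] by (simp add: \<rho>_def[abs_def] W_def)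
  have "\<forall>\<^sub>F N in sequentially. 1 \<le> N \<and> c \<le> T N \<and> norm (matrix_inv (Q N) *v e1) < b
      \<and> \<rho> N < 1 \<and> 1 \<le> nw N"
    by (intro eventually_conj eventually_ge_at_top c(2) ev_b order_tendstoD[OF \<rho>_lim]
        filterlim_at_top[THEN iffD1, OF nw, rule_format]) simp
  then obtain N1 where N1: "\<And>N. N1 \<le> N \<Longrightarrow> 1 \<le> N \<and> c \<le> T N
      \<and> norm (matrix_inv (Q N) *v e1) < b \<and> \<rho> N < 1 \<and> 1 \<le> nw N"
    unfolding eventually_sequentially by blast

  define bnd where "bnd N = (3 + (real CARD('n))\<^sup>2 * K ^ 4 + real CARD('n) * (K\<^sup>2 * (1 + B)) + B + B\<^sup>2)
          * sqrt (1 / nw N + \<rho> N)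
        + 3 * (((b * K)\<^sup>2)\<^sup>2 * B / (nw N * c\<^sup>2)
          + 4 * (((b * K)\<^sup>2)\<^sup>2 * ((1 + B)\<^sup>2 + B ^ 4) * \<rho> N) / c\<^sup>2
          + 4 * ((b * K)\<^sup>2 * (1 + B) * \<rho> N) / c)" for N
  have "\<exists>\<xi>. integrable (S N) \<xi> \<and> (\<forall>\<omega>. 0 \<le> \<xi> \<omega>)
      \<and> (\<forall>\<omega>. \<exists>d. crv_expansion (Q N) e1 K (T N) (That N \<omega>) (\<xi> \<omega>) d)
      \<and> (\<integral>\<omega>. \<xi> \<omega> \<partial>S N) \<le> bnd N" if N: "N1 \<le> N" for N
  proof -
    have N1': "1 \<le> N" "c \<le> T N" "norm (matrix_inv (Q N) *v e1) \<le> b" "\<rho> N \<le> 1" "1 \<le> nw N"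
      using N1[OF N] by auto
    note A_N = A[OF N1'(1)] and model_N = model[OF N1'(1)]
    interpret iid: iid_data "S N" N "Z N" "P N"
      by (rule iid_data.intro[OF model_N(1) N1'(1)])
    have \<pi>: "0 < win_prob (h N) (P N)"
    proof -
      have "0 < real N * win_prob (h N) (P N)"
        using N1'(5) unfolding nw_def by linarith
      then show ?thesis
        by (simp add: zero_less_mult_iff)
    qed
    have m'_eq: "m' N = (\<lambda>t. rd_basis p idx (t / h N))"
      unfolding m'_def by (simp add: A_N(3))
    have meas: "m' N \<in> borel_measurable borel"
      unfolding m'_eq by measurable
    have K: "norm (m' N t) \<le> K" if "\<bar>t\<bar> \<le> h N" for t
    proof -
      have "\<bar>t / h N\<bar> \<le> 1"
        using that model_N(4) by (simp add: abs_divide)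
      then show ?thesis
        unfolding m'_eq K_def by (rule norm_rd_basis_le)
    qed
    have pos: "0 < point_prob (P N) (x N g)" if "g \<in> {1..G N}" for g
      using model_N(3) that unfolding discrete_running_variable_def G_def by blast
    have supp: "AE z in P N. snd z \<in> x N ` {1..G N}" and inj: "inj_on (x N) {1..G N}"
      using model_N(3) strict_mono_on_imp_inj_on[of _ "x N"]
      unfolding discrete_running_variable_def G_def by blast+
    have bias_eq: "approx_bias (m' N) (h N) (P N) t = approx_bias m (h N) (P N) t" for t
      unfolding m'_def by (rule approx_bias_linear[OF A_N(1) Q_inv(2)[OF N1'(1)]])
    have bias: "\<bar>approx_bias (m' N) (h N) (P N) (x N g)\<bar> \<le> \<bar>B2\<bar>" if "g \<in> W N" for g
      using B2[OF N1'(1) that] by (simp add: bias_eq)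
    have W: "g \<in> {1..G N}" if "g \<in> W N" for g
      using that by (simp add: W_def window_def)
    have law: "prob_space (P N)" "sets (P N) = sets borel"
      by (simp_all add: iid.prob_space_law)
    have eps: "(\<integral>z. (fst z - cond_mean (P N) (snd z)) ^ 4 \<partial>cond_law (P N) (x N g)) \<le> \<bar>B1\<bar>"
      if "g \<in> W N" for g
      using B1[OF N1'(1) W[OF that]] by linarith
    have share: "point_prob (P N) (x N g) \<le> \<rho> N * win_prob (h N) (P N)" if "g \<in> W N" for g
    proof -
      have "finite (W N)"
        by (simp add: W_def window_def)
      then have "point_prob (P N) (x N g) / win_prob (h N) (P N) \<le> \<rho> N"
        unfolding \<rho>_def using that by (intro order_trans[OF Max_ge abs_ge_self]) auto
      then show ?thesis
        using \<pi> by (simp add: pos_divide_le_eq)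
    qed
    have u4: "integrable (P N) (\<lambda>z. of_bool (snd z = x N g)
        * (fst z - m' N (snd z) \<bullet> theta_pop (m' N) (h N) (P N)) ^ 4)"
      "(\<integral>z. of_bool (snd z = x N g)
        * (fst z - m' N (snd z) \<bullet> theta_pop (m' N) (h N) (P N)) ^ 4 \<partial>P N)
        \<le> B * point_prob (P N) (x N g)" if g: "g \<in> W N" for g
    proof -
      note error4 = law pos[OF W[OF g]] meas B1[OF N1'(1) W[OF g], THEN conjunct1] eps[OF g] bias[OF g]
      show "integrable (P N) (\<lambda>z. of_bool (snd z = x N g)
          * (fst z - m' N (snd z) \<bullet> theta_pop (m' N) (h N) (P N)) ^ 4)"
        by (rule integrable_error4[OF error4])
      have "8 * (\<bar>B1\<bar> + \<bar>B2\<bar> ^ 4) * point_prob (P N) (x N g) \<le> B * point_prob (P N) (x N g)"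
        using pos[OF W[OF g]] by (intro mult_right_mono) (auto simp: B_def)
      with integral_error4[OF error4]
      show "(\<integral>z. of_bool (snd z = x N g)
          * (fst z - m' N (snd z) \<bullet> theta_pop (m' N) (h N) (P N)) ^ 4 \<partial>P N)
          \<le> B * point_prob (P N) (x N g)"
        by (rule order_trans)
    qed
    have bias': "\<bar>approx_bias (m' N) (h N) (P N) (x N g)\<bar> \<le> B" if "g \<in> W N" for g
      by (rule order_trans[OF bias[OF that]]) (simp add: B_def)
    interpret rd: rd_sample "S N" N "Z N" "P N" "m' N" e1 "h N" "G N" "x N" K B "\<rho> N"
      by (rule rd_sample.intro[OF iid.iid_data_axioms rd_sample_axioms.intro[OF meas K model_N(2)
            inj pos supp Q_inv(1)[OF N1'(1), unfolded Q_def] \<pi> u4[unfolded W_def] bias'[unfolded W_def]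
            share[unfolded W_def] _ N1'(4)]])
        (auto simp: \<rho>_def K_def B_def)
    have T: "crv_pop (m' N) e1 (h N) (P N) (G N) (x N) N = T N"
      unfolding m'_def T_def by (rule crv_pop_linear[OF A_N(1) Q_inv(2)[OF N1'(1)] A_N(4)])
    \<comment> \<open>Invertibility passes from the normalised sample Gram matrix to the original
      one through the product of determinants, and then the estimators agree.\<close>
    have That: "That N \<omega> = crv_hat (m' N) e1 (h N) (G N) (x N) N (\<lambda>i. Z N i \<omega>)"
      if "det (Q_hat (m' N) (h N) N (\<lambda>i. Z N i \<omega>)) \<noteq> 0" for \<omega>
    proof -
      have "invertible (Q_hat m (h N) N (\<lambda>i. Z N i \<omega>))"
        using that unfolding m'_def Q_hat_linear by (auto simp: invertible_det_nz det_mul)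
      then show ?thesis
        unfolding That_def m'_def by (rule crv_hat_linear[OF A_N(1) _ A_N(4), symmetric])
    qed
    have nw_eq: "rd.nw = nw N"
      by (simp add: rd.nw_def nw_def)
    obtain \<xi> where \<xi>: "integrable (S N) \<xi>" "\<And>\<omega>. 0 \<le> \<xi> \<omega>"
      "\<And>\<omega> \<tau>. (det (Q_hat (m' N) (h N) N (\<lambda>i. Z N i \<omega>)) \<noteq> 0 \<Longrightarrow>
          \<tau> = crv_hat (m' N) e1 (h N) (G N) (x N) N (\<lambda>i. Z N i \<omega>))
        \<Longrightarrow> \<exists>d. crv_expansion (Q N) e1 K (T N) \<tau> (\<xi> \<omega>) d"
      "(\<integral>\<omega>. \<xi> \<omega> \<partial>S N) \<le> bnd N"
      using rd.sample_expansion[of b c] N1'(2,3,5) c(1)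
      unfolding T nw_eq bnd_def Q_def by metis
    show ?thesis
      by (intro exI[of _ \<xi>] conjI allI \<xi>(1,2,4) \<xi>(3)[OF That])
  qed
  then obtain \<xi> where \<xi>: "\<And>N. N1 \<le> N \<Longrightarrow> integrable (S N) (\<xi> N)"
    "\<And>N \<omega>. N1 \<le> N \<Longrightarrow> 0 \<le> \<xi> N \<omega>"
    "\<And>N \<omega>. N1 \<le> N \<Longrightarrow> \<exists>d. crv_expansion (Q N) e1 K (T N) (That N \<omega>) (\<xi> N \<omega>) d"
    "\<And>N. N1 \<le> N \<Longrightarrow> (\<integral>\<omega>. \<xi> N \<omega> \<partial>S N) \<le> bnd N"
    by metis

  have "(\<lambda>N. 1 / nw N) \<longlonglongrightarrow> 0"
    using tendsto_inverse_0_at_top[OF nw] by (simp add: inverse_eq_divide)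
  then have "(\<lambda>N. (3 + (real CARD('n))\<^sup>2 * K ^ 4 + real CARD('n) * (K\<^sup>2 * (1 + B)) + B + B\<^sup>2)
          * sqrt (1 / nw N + \<rho> N)
        + 3 * (((b * K)\<^sup>2)\<^sup>2 * B / c\<^sup>2 * (1 / nw N)
          + 4 * (((b * K)\<^sup>2)\<^sup>2 * ((1 + B)\<^sup>2 + B ^ 4) * \<rho> N) / c\<^sup>2
          + 4 * ((b * K)\<^sup>2 * (1 + B) * \<rho> N) / c))
      \<longlonglongrightarrow> (3 + (real CARD('n))\<^sup>2 * K ^ 4 + real CARD('n) * (K\<^sup>2 * (1 + B)) + B + B\<^sup>2)
          * sqrt (0 + 0)
        + 3 * (((b * K)\<^sup>2)\<^sup>2 * B / c\<^sup>2 * 0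
          + 4 * (((b * K)\<^sup>2)\<^sup>2 * ((1 + B)\<^sup>2 + B ^ 4) * 0) / c\<^sup>2
          + 4 * ((b * K)\<^sup>2 * (1 + B) * 0) / c)"
    by (intro tendsto_intros \<rho>_lim) (use c(1) in auto)
  then have bnd_lim: "bnd \<longlonglongrightarrow> 0"
    by (simp add: bnd_def[abs_def] mult.commute)

  \<comment> \<open>This filter encodes joint smallness: a property holds eventually along
    \<open>F\<close> exactly if it holds for all large \<open>N\<close> and all
    \<open>\<omega>\<close> with \<open>\<xi> N \<omega>\<close> near 0. The sample spaces may
    change with \<open>N\<close>, as only the type of \<open>\<omega>\<close> is common.\<close>
  define F :: "(nat \<times> 'w) filter" where
    "F = inf (filtercomap fst sequentially) (filtercomap (\<lambda>(N, \<omega>). \<xi> N \<omega>) (nhds 0))"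
  have fst_F: "filterlim fst sequentially F" and \<xi>_F: "((\<lambda>(N, \<omega>). \<xi> N \<omega>) \<longlongrightarrow> 0) F"
    unfolding F_def
    by (auto intro: filterlim_mono[OF filterlim_filtercomap order_refl] inf_le1 inf_le2)
  have ev_F: "\<forall>\<^sub>F t in F. N1 \<le> fst t"
    using filterlim_iff[THEN iffD1, OF fst_F] eventually_ge_at_top by blast
  have ratio: "((\<lambda>t. That (fst t) (snd t) / T (fst t)) \<longlongrightarrow> 1) F"
  proof (rule crv_expansion_limit[where Q="\<lambda>t. Q (fst t)" and \<xi>="\<lambda>t. \<xi> (fst t) (snd t)"])
    show "((\<lambda>t. Q (fst t)) \<longlongrightarrow> Q0) F"
      by (rule filterlim_compose[OF Q0 fst_F])
    show "det Q0 \<noteq> 0" "0 < c"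
      by fact+
    show "((\<lambda>t. \<xi> (fst t) (snd t)) \<longlongrightarrow> 0) F"
      using \<xi>_F by (simp add: case_prod_beta')
    show "\<forall>\<^sub>F t in F. c \<le> T (fst t)"
      using ev_F by eventually_elim (use N1 in blast)
    show "\<forall>\<^sub>F t in F. \<exists>d. crv_expansion (Q (fst t)) e1 K (T (fst t)) (That (fst t) (snd t))
        (\<xi> (fst t) (snd t)) d"
      using ev_F by eventually_elim (rule \<xi>(3))
  qed

  \<comment> \<open>Measurability is required for every \<open>N\<close>, including
    \<open>N = 0\<close>, where the model says nothing about \<open>S N\<close>; the constant 0 is
    measurable there.\<close>
  define R where "R N \<omega> = (if N1 \<le> N then That N \<omega> / T N - 1 else 0)" for N \<omega>
  have R_meas: "R N \<in> borel_measurable (S N)" for N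
  proof (cases "N1 \<le> N")
    case True
    then have "1 \<le> N"
      using N1 by blast
    then interpret iid_data "S N" N "Z N" "P N"
      by (intro iid_data.intro model)
    have [measurable]: "That N \<in> borel_measurable (S N)"
      unfolding That_def[abs_def] by (rule borel_measurable_crv_hat) (simp add: m_def)
    show ?thesis
      using True unfolding R_def[abs_def] by simp
  qed (simp add: R_def[abs_def])
  have R_prob: "(\<lambda>N. \<P>(\<omega> in S N. \<bar>R N \<omega>\<bar> > \<epsilon>)) \<longlonglongrightarrow> 0" if "0 < \<epsilon>" for \<epsilon>
  proof -
    have "\<forall>\<^sub>F t in F. dist (That (fst t) (snd t) / T (fst t)) 1 < \<epsilon>"
      using tendstoD[OF ratio that] .
    \<comment> \<open>Unfolding \<open>F\<close> yields a threshold \<open>N2\<close> and a radius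
      \<open>\<delta>\<close> that is uniform in \<open>N\<close> and \<open>\<omega>\<close>. Hence
      \<open>\<bar>R\<bar> > \<epsilon>\<close> forces \<open>\<xi> \<ge> \<delta>\<close>, and
      Markov's inequality finishes.\<close>
    then obtain p1 p2 where p1: "eventually p1 (filtercomap fst sequentially)"
      and p2: "eventually p2 (filtercomap (\<lambda>(N, \<omega>). \<xi> N \<omega>) (nhds 0))"
      and p12: "\<And>t. p1 t \<Longrightarrow> p2 t \<Longrightarrow> dist (That (fst t) (snd t) / T (fst t)) 1 < \<epsilon>"
      unfolding F_def eventually_inf by blast
    obtain q1 where q1: "eventually q1 sequentially" "\<And>t. q1 (fst t) \<Longrightarrow> p1 t"
      using p1 unfolding eventually_filtercomap by blast
    obtain q2 where q2: "eventually q2 (nhds 0)" "\<And>t. q2 (case t of (N, \<omega>) \<Rightarrow> \<xi> N \<omega>) \<Longrightarrow> p2 t"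
      using p2 unfolding eventually_filtercomap by blast
    obtain N2 where N2: "\<And>N. N2 \<le> N \<Longrightarrow> q1 N"
      using q1(1) unfolding eventually_sequentially by blast
    obtain \<delta> where \<delta>: "0 < \<delta>" "\<And>t. dist t 0 < \<delta> \<Longrightarrow> q2 t"
      using q2(1) unfolding eventually_nhds_metric by blast
    have small: "\<bar>That N \<omega> / T N - 1\<bar> < \<epsilon>" if "N2 \<le> N" "\<bar>\<xi> N \<omega>\<bar> < \<delta>" for N \<omega>
      using p12[OF q1(2) q2(2), of "(N, \<omega>)"] N2[OF that(1)] \<delta>(2)[of "\<xi> N \<omega>"] that(2)
      by (simp add: dist_real_def)
    show ?thesis
    proof (rule tendsto_sandwich[OF _ _ tendsto_const])
      show "\<forall>\<^sub>F N in sequentially. 0 \<le> \<P>(\<omega> in S N. \<bar>R N \<omega>\<bar> > \<epsilon>)"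
        by simp
      show "(\<lambda>N. bnd N / \<delta>) \<longlonglongrightarrow> 0"
        using tendsto_divide[OF bnd_lim tendsto_const, of \<delta>] \<delta> by simp
      show "\<forall>\<^sub>F N in sequentially. \<P>(\<omega> in S N. \<bar>R N \<omega>\<bar> > \<epsilon>) \<le> bnd N / \<delta>"
        using eventually_ge_at_top[of "max N1 N2"]
      proof eventually_elim
        case (elim N)
        then have N: "N1 \<le> N" "N2 \<le> N"
          by auto
        then have "1 \<le> N"
          using N1 by blast
        then interpret iid_data "S N" N "Z N" "P N"
          by (intro iid_data.intro model)
        have "\<P>(\<omega> in S N. \<bar>R N \<omega>\<bar> > \<epsilon>) \<le> \<P>(\<omega> in S N. \<delta> \<le> \<xi> N \<omega>)"
        proof (rule finite_measure_mono)
          show "{\<omega> \<in> space (S N). \<bar>R N \<omega>\<bar> > \<epsilon>} \<subseteq> {\<omega> \<in> space (S N). \<delta> \<le> \<xi> N \<omega>}"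
            using small[OF N(2)] \<xi>(2)[OF N(1)] N(1) by (force simp: R_def not_le[symmetric])
          show "{\<omega> \<in> space (S N). \<delta> \<le> \<xi> N \<omega>} \<in> events"
            using borel_measurable_integrable[OF \<xi>(1)[OF N(1)]] by measurable
        qed
        also have "\<dots> \<le> (\<integral>\<omega>. \<xi> N \<omega> \<partial>S N) / \<delta>"
          by (rule integral_Markov_inequality_measure[where A="{}"])
            (use \<xi>(1,2)[OF N(1)] \<delta> in auto)
        also have "\<dots> \<le> bnd N / \<delta>"
          using \<xi>(4)[OF N(1)] \<delta> by (simp add: divide_right_mono)
        finally show ?case .
      qed
    qed
  qed
  show ?thesis
  proof (intro exI[of _ R] conjI)
    show "tendsto_zero_in_prob S R"
      using R_meas R_prob by (simp add: tendsto_zero_in_prob_def)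
    show "\<forall>\<^sub>F N in sequentially. \<forall>\<omega>\<in>space (S N).
       crv_hat m e1 (h N) (G N) (x N) N (\<lambda>i. Z N i \<omega>)
       = (1 + R N \<omega>) * crv_pop m e1 (h N) (P N) (G N) (x N) N"
      using eventually_ge_at_top[of N1]
    proof eventually_elim
      case (elim N)
      then have "0 < T N"
        using N1[OF elim] c(1) by simp
      then show ?case
        using elim by (simp add: R_def flip: That_def T_def)
    qed
  qed
qed

end
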